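(* Let $\alpha\in(0,1/2)$ be irrational, let $\mathsf f$ be an orientation preserving $C^\infty$-diffeomorphism of $\mathbb T$ with rotation number $2\alpha$, and let $\omega$, $\pi_\omega$, $\mathcal H_\omega$, $\Delta$, $\mathrm L$ and $\mathbb A^{oo}_{2\alpha}$ be as in the context. If $A\in\pi_\omega(\mathbb A_{2\alpha}^{oo})$, then the deformed commutator $$\mathcal D^\sigma_{\mathrm L}(A)=\imath\begin{pmatrix}0&\Delta^{-1}[\mathrm L,A]\\ [\mathrm L^*,A]\Delta^{-1}&0\end{pmatrix}$$ uniquely defines a bounded operator acting on $\mathcal H_\omega\oplus\mathcal H_\omega$ (i.e. it is densely defined and bounded on its domain).
   Context: $\mathbb T$ is the unit circle, $m$ its normalised Lebesgue measure, $R_\beta(z)=e^{2\pi\imath\beta}z$, $D=\frac{\mathrm d}{\mathrm dz}$. $\mathsf h$ is the unique homeomorphism of $\mathbb T$ with $\mathsf h(1)=1$ and $\mathsf f=\mathsf h\circ R_{2\alpha}\circ\mathsf h^{-1}$; $T:=\mathsf h\circ R_\alpha\circ\mathsf h^{-1}$, so $T^2=\mathsf f$; $\mu=m\circ\mathsf h$, i.e. $\mu(E)=m(\mathsf h(E))$. $\mathbb A_{2\alpha}$ is the universal unital $C^*$-algebra generated by unitaries $U,V$ with $UV=e^{4\pi\imath\alpha}VU$; $W(k,n):=e^{-2\pi\imath\alpha kn}U^kV^n$ and $W(f):=\sum f(k,n)W(k,n)$ for finitely supported $f:\mathbb Z^2\to\mathbb C$; put $\check{f^{(n)}}(z)=\sum_kf(k,n)z^k$.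 The state $\omega=\omega_\mu$ is determined by $\omega_\mu(W(f))=\sum_k\left(\int_{\mathbb T}z^k\mathrm d\mu\right)f(k,0)$. Its GNS representation is realised as $\mathcal H_\omega=\bigoplus_{n\in\mathbb Z}L^2(\mathbb T,m)$, $(\pi_\omega(W(f))g)_n=\sum_l\big(\check{f^{(l)}}\circ\mathsf h^{-1}\circ T^{2n-l}\big)g_{n-l}$, $(\xi_\omega)_n=\delta_{n,0}$. The modular operator is $\Delta=\bigoplus_{n}M_{\delta_n}$, where $M_{\delta_n}$ is multiplication by $\delta_n(z)=\frac{z(D\mathsf f^n)(z)}{\mathsf f^n(z)}$. $\Gamma_n(\mathsf f):=\max\{\|D\mathsf f^n\|_\infty,\|D\mathsf f^{-n}\|_\infty\}$ (so $\Gamma_0=1$). $\mathrm L=\bigoplus_{n\in\mathbb Z}\big(\imath z\frac{\mathrm d}{\mathrm dz}-a_nI\big)$, each summand on $H^1(\mathbb T)=\{u\text{ absolutely continuous}: u'\in L^2(\mathbb T,m)\}$, where $a_n=\sum_{l=1}^{n}\frac1{\Gamma_l(\mathsf f)}$ for $n>0$, $a_0=0$, $a_n=-\sum_{l=1}^{|n|}\frac1{\Gamma_{l-1}(\mathsf f)}$ for $n<0$; direct sums of operators have the natural maximal domain. $\mathbb A_{2\alpha}^{oo}:=\big\{\sum_{k\in J}F_k(U)V^k: J\subset\mathbb Z\text{ finite},\ F_k\in\mathcal C_0\big\}$, with $\mathcal C_0:=\{g\circ\mathsf h: g\in C^1(\mathbb T)\}$ and $F_k(U)$ given by continuous functional calculus;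 it is a dense unital $*$-subalgebra. The domain of $\mathcal D^\sigma_{\mathrm L}(A)$ consists of the pairs $\xi,\eta\in\mathcal H_\omega$ with all components in $H^1(\mathbb T)$ and $\sum_{n}\big(\|([\mathrm L^*,A]\Delta^{-1}\xi)_n\|^2+\|M_{\delta_n^{-1}}([\mathrm L,A]\eta)_n\|^2\big)<+\infty$. *)

theory Defs
  imports "HOL-Analysis.Analysis"
begin

section \<open>Complex normed spaces and unital \<open>C*\<close>-algebras\<close>

class complex_normed = real_normed_vector +
  fixes scaleC :: "complex \<Rightarrow> 'a \<Rightarrow> 'a"  (infixr "*\<^sub>C" 75)
  assumes scaleR_scaleC: "r *\<^sub>R x = complex_of_real r *\<^sub>C x"
    and scaleC_add_right: "c *\<^sub>C (x + y) = c *\<^sub>C x + c *\<^sub>C y"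
    and scaleC_add_left: "(c + d) *\<^sub>C x = c *\<^sub>C x + d *\<^sub>C x"
    and scaleC_scaleC: "c *\<^sub>C d *\<^sub>C x = (c * d) *\<^sub>C x"
    and scaleC_one: "1 *\<^sub>C x = x"
    and norm_scaleC: "norm (c *\<^sub>C x) = cmod c * norm x"

text \<open>
  The complex inner product whose real part is \<^const>\<open>inner\<close>; it is conjugate-linear in the first
  argument. The explicit formulas on the two Hilbert spaces below are \<open>cinner_L2\<close> and \<open>cinner_dsum\<close>.
\<close>
definition cinner :: "'a \<Rightarrow> 'a::{complex_normed,real_inner} \<Rightarrow> complex" where
  "cinner x y = Complex (inner x y) (inner (\<i> *\<^sub>C x) y)"

class cstar_algebra = complex_normed + real_normed_algebra_1 + banach +
  fixes star :: "'a \<Rightarrow> 'a"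
  assumes scaleC_mult_left: "(c *\<^sub>C x) * y = c *\<^sub>C (x * y)"
    and scaleC_mult_right: "x * (c *\<^sub>C y) = c *\<^sub>C (x * y)"
    and star_star: "star (star x) = x"
    and star_add: "star (x + y) = star x + star y"
    and star_scaleC: "star (c *\<^sub>C x) = cnj c *\<^sub>C star x"
    and star_mult: "star (x * y) = star y * star x"
    and cstar_identity: "norm (star x * x) = (norm x)\<^sup>2"

definition unitary :: "'a::cstar_algebra \<Rightarrow> bool" where
  "unitary u \<longleftrightarrow> star u * u = 1 \<and> u * star u = 1"

definition upow :: "'a::cstar_algebra \<Rightarrow> int \<Rightarrow> 'a" where
  "upow u k = (if k \<ge> 0 then u ^ nat k else star u ^ nat (- k))"

definition closed_star_subalgebra :: "'a::cstar_algebra set \<Rightarrow> bool" where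
  "closed_star_subalgebra S \<longleftrightarrow> closed S \<and> 1 \<in> S \<and>
     (\<forall>x\<in>S. \<forall>y\<in>S. x + y \<in> S \<and> x * y \<in> S) \<and> (\<forall>x\<in>S. star x \<in> S \<and> (\<forall>c. c *\<^sub>C x \<in> S))"

definition bounded_clinear :: "('a::complex_normed \<Rightarrow> 'b::complex_normed) \<Rightarrow> bool" where
  "bounded_clinear B \<longleftrightarrow> bounded_linear B \<and> (\<forall>c x. B (c *\<^sub>C x) = c *\<^sub>C B x)"

definition unitary_op :: "('h::{complex_normed,real_inner} \<Rightarrow> 'h) \<Rightarrow> bool" where
  "unitary_op u \<longleftrightarrow> bounded_clinear u \<and> surj u \<and> (\<forall>x y. cinner (u x) (u y) = cinner x y)"

text \<open>Contractivity is automatic for unital \<open>*\<close>-representations of \<open>C*\<close>-algebras on Hilbert spaces.\<close>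
definition star_rep :: "('a::cstar_algebra \<Rightarrow> 'h::{complex_normed,real_inner} \<Rightarrow> 'h) \<Rightarrow> bool" where
  "star_rep \<rho> \<longleftrightarrow> (\<forall>a. bounded_clinear (\<rho> a) \<and> onorm (\<rho> a) \<le> norm a) \<and> \<rho> 1 = id \<and>
     (\<forall>a b x. \<rho> (a + b) x = \<rho> a x + \<rho> b x) \<and> (\<forall>c a x. \<rho> (c *\<^sub>C a) x = c *\<^sub>C \<rho> a x) \<and>
     (\<forall>a b. \<rho> (a * b) = \<rho> a \<circ> \<rho> b) \<and> (\<forall>a x y. cinner (\<rho> (star a) x) y = cinner x (\<rho> a y))"

definition state :: "('a::cstar_algebra \<Rightarrow> complex) \<Rightarrow> bool" where
  "state \<omega> \<longleftrightarrow> (\<forall>a b. \<omega> (a + b) = \<omega> a + \<omega> b) \<and> (\<forall>c a. \<omega> (c *\<^sub>C a) = c * \<omega> a) \<and>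
     (\<forall>a. Im (\<omega> (star a * a)) = 0 \<and> Re (\<omega> (star a * a)) \<ge> 0) \<and> \<omega> 1 = 1"

definition GNS :: "('a::cstar_algebra \<Rightarrow> complex) \<Rightarrow>
    ('a \<Rightarrow> 'h::{complex_normed,real_inner} \<Rightarrow> 'h) \<Rightarrow> 'h \<Rightarrow> bool" where
  "GNS \<omega> \<rho> \<xi> \<longleftrightarrow> star_rep \<rho> \<and> closure (range (\<lambda>a. \<rho> a \<xi>)) = UNIV \<and> (\<forall>a. \<omega> a = cinner \<xi> (\<rho> a \<xi>))"


section \<open>The Hilbert space \<open>L\<^sup>2(\<T>,m)\<close>\<close>

abbreviation circle :: "complex set" where
  "circle \<equiv> sphere 0 1"

definition circ_measure :: "complex measure" where
  "circ_measure = distr (uniform_measure lborel {0..<1::real}) (restrict_space borel circle) (\<lambda>t. cis (2 * pi * t))"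

definition sq_int :: "(complex \<Rightarrow> complex) \<Rightarrow> bool" where
  "sq_int f \<longleftrightarrow> f \<in> borel_measurable circ_measure \<and> integrable circ_measure (\<lambda>z. (cmod (f z))\<^sup>2)"

definition L2_rel :: "(complex \<Rightarrow> complex) \<Rightarrow> (complex \<Rightarrow> complex) \<Rightarrow> bool" where
  "L2_rel f g \<longleftrightarrow> sq_int f \<and> sq_int g \<and> (AE z in circ_measure. f z = g z)"

lemma sq_int_zero: "sq_int (\<lambda>_. 0)"
  by (simp add: sq_int_def)

lemma sq_int_add:
  assumes f: "sq_int f" and g: "sq_int g"
  shows "sq_int (\<lambda>z. f z + g z)"
proof -
  have [measurable]: "f \<in> borel_measurable circ_measure" "g \<in> borel_measurable circ_measure"
    using assms by (auto simp: sq_int_def)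
  have le: "(cmod (a + b))\<^sup>2 \<le> 2 * (cmod a)\<^sup>2 + 2 * (cmod b)\<^sup>2" for a b
  proof -
    have "(cmod (a + b))\<^sup>2 \<le> (cmod a + cmod b)\<^sup>2"
      by (intro power_mono norm_triangle_ineq norm_ge_zero)
    also have "\<dots> \<le> 2 * (cmod a)\<^sup>2 + 2 * (cmod b)\<^sup>2"
      using zero_le_power2[of "cmod a - cmod b"] by (simp add: power2_eq_square algebra_simps)
    finally show ?thesis .
  qed
  have "integrable circ_measure (\<lambda>z. 2 * (cmod (f z))\<^sup>2 + 2 * (cmod (g z))\<^sup>2)"
    using assms by (auto simp: sq_int_def)
  then have "integrable circ_measure (\<lambda>z. (cmod (f z + g z))\<^sup>2)"
    by (rule Bochner_Integration.integrable_bound) (use le in \<open>auto intro!: AE_I2\<close>)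
  then show ?thesis by (simp add: sq_int_def)
qed

lemma sq_int_cmult: "sq_int f \<Longrightarrow> sq_int (\<lambda>z. c * f z)"
  by (auto simp: sq_int_def norm_mult power_mult_distrib)

lemma sq_int_scaleR: "sq_int f \<Longrightarrow> sq_int (\<lambda>z. r *\<^sub>R f z)"
  using sq_int_cmult[of f "complex_of_real r"] by (simp add: scaleR_conv_of_real)

lemma sq_int_uminus: "sq_int f \<Longrightarrow> sq_int (\<lambda>z. - f z)"
  by (auto simp: sq_int_def)

lemma sq_int_diff: "sq_int f \<Longrightarrow> sq_int g \<Longrightarrow> sq_int (\<lambda>z. f z - g z)"
  using sq_int_add[OF _ sq_int_uminus] by fastforce

lemma sq_int_cmod_prod:
  assumes f: "sq_int f" and g: "sq_int g"
  shows "integrable circ_measure (\<lambda>z. cmod (f z) * cmod (g z))"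
proof -
  have [measurable]: "f \<in> borel_measurable circ_measure" "g \<in> borel_measurable circ_measure"
    using assms by (auto simp: sq_int_def)
  have "integrable circ_measure (\<lambda>z. (cmod (f z))\<^sup>2 + (cmod (g z))\<^sup>2)"
    using assms by (auto simp: sq_int_def)
  moreover have "a * b \<le> a\<^sup>2 + b\<^sup>2" if "a \<ge> 0" "b \<ge> 0" for a b :: real
  proof -
    have "2 * (a * b) \<le> a\<^sup>2 + b\<^sup>2" using zero_le_power2[of "a - b"]
      by (simp add: power2_eq_square algebra_simps)
    with that show ?thesis using mult_nonneg_nonneg[of a b] by linarith
  qed
  ultimately show ?thesis
    by (elim Bochner_Integration.integrable_bound) (auto intro!: AE_I2)
qed

lemma sq_int_inner: "sq_int f \<Longrightarrow> sq_int g \<Longrightarrow> integrable circ_measure (\<lambda>z. inner (f z) (g z))"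
  by (rule Bochner_Integration.integrable_bound[OF sq_int_cmod_prod[of f g]])
     (auto simp: sq_int_def norm_mult intro!: AE_I2 order_trans[OF Cauchy_Schwarz_ineq2])

lemma sq_int_cnj_mult: "sq_int f \<Longrightarrow> sq_int g \<Longrightarrow> integrable circ_measure (\<lambda>z. cnj (f z) * g z)"
  by (rule Bochner_Integration.integrable_bound[OF sq_int_cmod_prod[of f g]])
     (auto simp: sq_int_def norm_mult intro!: AE_I2 borel_measurable_times
        borel_measurable_continuous_on[OF continuous_on_cnj[OF continuous_on_id]])

quotient_type L2 = "complex \<Rightarrow> complex" / partial: L2_rel
proof (rule part_equivpI)
  show "\<exists>f. L2_rel f f" using sq_int_zero by (auto simp: L2_rel_def)
  show "symp L2_rel" by (auto simp: L2_rel_def intro!: sympI)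
  show "transp L2_rel"
  proof (rule transpI)
    fix f g k assume "L2_rel f g" "L2_rel g k"
    then show "L2_rel f k" unfolding L2_rel_def by (auto)
  qed
qed

instantiation L2 :: real_inner
begin

lift_definition zero_L2 :: L2 is "\<lambda>_. 0"
  by (simp add: L2_rel_def sq_int_zero)

lift_definition plus_L2 :: "L2 \<Rightarrow> L2 \<Rightarrow> L2" is "\<lambda>f g z. f z + g z"
  by (auto simp: L2_rel_def sq_int_add)

lift_definition uminus_L2 :: "L2 \<Rightarrow> L2" is "\<lambda>f z. - f z"
  by (auto simp: L2_rel_def sq_int_uminus)

lift_definition minus_L2 :: "L2 \<Rightarrow> L2 \<Rightarrow> L2" is "\<lambda>f g z. f z - g z"
  by (auto simp: L2_rel_def sq_int_diff)

lift_definition scaleR_L2 :: "real \<Rightarrow> L2 \<Rightarrow> L2" is "\<lambda>r f z. r *\<^sub>R f z"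
  by (auto simp: L2_rel_def sq_int_scaleR)

lift_definition inner_L2 :: "L2 \<Rightarrow> L2 \<Rightarrow> real" is "\<lambda>f g. \<integral>z. inner (f z) (g z) \<partial>circ_measure"
  by (rule integral_cong_AE) (auto simp: L2_rel_def sq_int_def)

definition norm_L2 :: "L2 \<Rightarrow> real" where "norm_L2 x = sqrt (inner x x)"
definition sgn_L2 :: "L2 \<Rightarrow> L2" where "sgn_L2 x = inverse (norm x) *\<^sub>R x"
definition dist_L2 :: "L2 \<Rightarrow> L2 \<Rightarrow> real" where "dist_L2 x y = norm (x - y)"
definition uniformity_L2 :: "(L2 \<times> L2) filter"
  where "uniformity_L2 = (INF e\<in>{0<..}. principal {(x, y). dist x y < e})"
definition open_L2 :: "L2 set \<Rightarrow> bool"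
  where "open_L2 S = (\<forall>x\<in>S. \<forall>\<^sub>F (x', y) in uniformity. x' = x \<longrightarrow> y \<in> S)"

instance
proof
  fix x y z :: L2 and r s :: real
  show "x + y + z = x + (y + z)" by transfer (auto simp: L2_rel_def sq_int_add add.assoc)
  show "x + y = y + x" by transfer (auto simp: L2_rel_def sq_int_add add.commute)
  show "0 + x = x" by transfer (auto simp: L2_rel_def sq_int_add sq_int_zero)
  show "- x + x = 0" by transfer (auto simp: L2_rel_def sq_int_zero)
  show "x - y = x + - y" by transfer (auto simp: L2_rel_def sq_int_diff)
  show "r *\<^sub>R (x + y) = r *\<^sub>R x + r *\<^sub>R y"
    by transfer (simp add: L2_rel_def sq_int_add sq_int_scaleR algebra_simps)
  show "(r + s) *\<^sub>R x = r *\<^sub>R x + s *\<^sub>R x"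
    by transfer (simp add: L2_rel_def sq_int_add sq_int_scaleR scaleR_add_left)
  show "r *\<^sub>R s *\<^sub>R x = (r * s) *\<^sub>R x"
    by transfer (simp add: L2_rel_def sq_int_scaleR)
  show "1 *\<^sub>R x = x" by transfer (simp add: L2_rel_def sq_int_scaleR)
  show "sgn x = inverse (norm x) *\<^sub>R x" by (simp add: sgn_L2_def)
  show "dist x y = norm (x - y)" by (simp add: dist_L2_def)
  show "uniformity = (INF e\<in>{0<..}. principal {(x::L2, y). dist x y < e})"
    by (simp add: uniformity_L2_def)
  show "open S = (\<forall>x\<in>S. \<forall>\<^sub>F (x', y) in uniformity. x' = x \<longrightarrow> y \<in> S)" for S :: "L2 set"
    by (simp add: open_L2_def)
  show "inner x y = inner y x" by transfer (simp add: inner_commute)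
  show "inner (x + y) z = inner x z + inner y z"
    by transfer (simp add: L2_rel_def inner_add_left sq_int_inner)
  show "inner (r *\<^sub>R x) y = r * inner x y" by transfer simp
  show "0 \<le> inner x x" by transfer simp
  show "(inner x x = 0) = (x = 0)"
  proof transfer
    fix f assume "L2_rel f f"
    then have f: "sq_int f" by (simp add: L2_rel_def)
    have "((\<integral>z. inner (f z) (f z) \<partial>circ_measure) = 0) = (AE z in circ_measure. inner (f z) (f z) = 0)"
      by (rule integral_nonneg_eq_0_iff_AE) (use sq_int_inner[OF f f] in auto)
    then show "((\<integral>z. inner (f z) (f z) \<partial>circ_measure) = 0) = L2_rel f (\<lambda>_. 0)"
      by (simp add: L2_rel_def f sq_int_zero)
  qed
  show "norm x = sqrt (inner x x)" by (simp add: norm_L2_def)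
qed

end

instantiation L2 :: complex_normed
begin

lift_definition scaleC_L2 :: "complex \<Rightarrow> L2 \<Rightarrow> L2" is "\<lambda>c f z. c * f z"
  by (auto simp: L2_rel_def sq_int_cmult)

instance
proof
  fix x y :: L2 and r :: real and c d :: complex
  show "r *\<^sub>R x = complex_of_real r *\<^sub>C x"
    by transfer (simp add: L2_rel_def sq_int_cmult scaleR_conv_of_real)
  show "c *\<^sub>C (x + y) = c *\<^sub>C x + c *\<^sub>C y"
    by transfer (simp add: L2_rel_def sq_int_cmult sq_int_add algebra_simps)
  show "(c + d) *\<^sub>C x = c *\<^sub>C x + d *\<^sub>C x"
    by transfer (simp add: L2_rel_def sq_int_cmult sq_int_add ring_distribs)
  show "c *\<^sub>C d *\<^sub>C x = (c * d) *\<^sub>C x"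
    by transfer (simp add: L2_rel_def sq_int_cmult mult.assoc)
  show "1 *\<^sub>C x = x" by transfer (simp add: L2_rel_def)
  have "inner (c *\<^sub>C x) (c *\<^sub>C x) = (cmod c)\<^sup>2 * inner x x"
    by transfer (simp add: power2_norm_eq_inner[symmetric] norm_mult power_mult_distrib)
  then show "norm (c *\<^sub>C x) = cmod c * norm x"
    by (simp add: norm_eq_sqrt_inner real_sqrt_mult)
qed

end

lemma cinner_L2:
  assumes "sq_int f" "sq_int g"
  shows "cinner (abs_L2 f) (abs_L2 g) = (\<integral>z. cnj (f z) * g z \<partial>circ_measure)"
proof -
  have L: "L2_rel f f" "L2_rel g g" and i: "sq_int (\<lambda>z. \<i> * f z)" "L2_rel (\<lambda>z. \<i> * f z) (\<lambda>z. \<i> * f z)"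
    using assms sq_int_cmult[of f \<i>] by (auto simp: L2_rel_def)
  have int: "integrable circ_measure (\<lambda>z. cnj (f z) * g z)" using assms by (rule sq_int_cnj_mult)
  have "cinner (abs_L2 f) (abs_L2 g) =
      Complex (\<integral>z. inner (f z) (g z) \<partial>circ_measure) (\<integral>z. inner (\<i> * f z) (g z) \<partial>circ_measure)"
    by (simp add: cinner_def inner_L2.abs_eq scaleC_L2.abs_eq L i)
  also have "\<dots> = (\<integral>z. cnj (f z) * g z \<partial>circ_measure)"
    by (simp add: complex_eq_iff inner_complex_def
        flip: integral_Re[OF int] integral_Im[OF int])
  finally show ?thesis .
qed


section \<open>The Hilbert space direct sum over \<open>\<int>\<close> of copies of \<open>L\<^sup>2(\<T>,m)\<close>\<close>

lemma sq_summable_add: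
  fixes x y :: "int \<Rightarrow> 'a::real_inner"
  assumes "(\<lambda>n. (norm (x n))\<^sup>2) summable_on UNIV" "(\<lambda>n. (norm (y n))\<^sup>2) summable_on UNIV"
  shows "(\<lambda>n. (norm (x n + y n))\<^sup>2) summable_on UNIV"
proof (rule summable_on_comparison_test)
  show "(\<lambda>n. 2 * (norm (x n))\<^sup>2 + 2 * (norm (y n))\<^sup>2) summable_on UNIV"
    by (intro summable_on_add summable_on_cmult_right assms)
  fix n
  have "(norm (x n + y n))\<^sup>2 \<le> (norm (x n) + norm (y n))\<^sup>2"
    by (intro power_mono norm_triangle_ineq norm_ge_zero)
  also have "\<dots> \<le> 2 * (norm (x n))\<^sup>2 + 2 * (norm (y n))\<^sup>2"
    using zero_le_power2[of "norm (x n) - norm (y n)"] by (simp add: power2_eq_square algebra_simps)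
  finally show "(norm (x n + y n))\<^sup>2 \<le> 2 * (norm (x n))\<^sup>2 + 2 * (norm (y n))\<^sup>2" .
qed auto

lemma inner_summable:
  fixes x y :: "int \<Rightarrow> 'a::real_inner"
  assumes "(\<lambda>n. (norm (x n))\<^sup>2) summable_on UNIV" "(\<lambda>n. (norm (y n))\<^sup>2) summable_on UNIV"
  shows "(\<lambda>n. inner (x n) (y n)) summable_on UNIV"
proof -
  have "(\<lambda>n. norm (inner (x n) (y n))) summable_on UNIV"
  proof (rule summable_on_comparison_test)
    show "(\<lambda>n. (norm (x n))\<^sup>2 + (norm (y n))\<^sup>2) summable_on UNIV"
      by (intro summable_on_add assms)
    fix n
    have "norm (inner (x n) (y n)) \<le> norm (x n) * norm (y n)"
      using Cauchy_Schwarz_ineq2[of "x n" "y n"] by simp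
    also have "\<dots> \<le> (norm (x n))\<^sup>2 + (norm (y n))\<^sup>2"
    proof -
      have "2 * (norm (x n) * norm (y n)) \<le> (norm (x n))\<^sup>2 + (norm (y n))\<^sup>2"
        using zero_le_power2[of "norm (x n) - norm (y n)"] by (simp add: power2_eq_square algebra_simps)
      then show ?thesis using mult_nonneg_nonneg[of "norm (x n)" "norm (y n)", OF norm_ge_zero norm_ge_zero] by linarith
    qed
    finally show "norm (inner (x n) (y n)) \<le> (norm (x n))\<^sup>2 + (norm (y n))\<^sup>2" .
  qed auto
  then show ?thesis by (rule abs_summable_summable)
qed

typedef dsum = "{x :: int \<Rightarrow> L2. (\<lambda>n. (norm (x n))\<^sup>2) summable_on UNIV}"
  morphisms comps Dsum
  by (rule exI[of _ "\<lambda>_. 0"]) simp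

setup_lifting type_definition_dsum

instantiation dsum :: real_inner
begin

lift_definition zero_dsum :: dsum is "\<lambda>_. 0" by simp

lift_definition plus_dsum :: "dsum \<Rightarrow> dsum \<Rightarrow> dsum" is "\<lambda>x y n. x n + y n"
  by (rule sq_summable_add)

lift_definition uminus_dsum :: "dsum \<Rightarrow> dsum" is "\<lambda>x n. - x n" by simp

lift_definition minus_dsum :: "dsum \<Rightarrow> dsum \<Rightarrow> dsum" is "\<lambda>x y n. x n - y n"
proof -
  fix x y :: "int \<Rightarrow> L2"
  assume "(\<lambda>n. (norm (x n))\<^sup>2) summable_on UNIV" "(\<lambda>n. (norm (y n))\<^sup>2) summable_on UNIV"
  then show "(\<lambda>n. (norm (x n - y n))\<^sup>2) summable_on UNIV"
    using sq_summable_add[of x "\<lambda>n. - y n"] by simp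
qed

lift_definition scaleR_dsum :: "real \<Rightarrow> dsum \<Rightarrow> dsum" is "\<lambda>r x n. r *\<^sub>R x n"
  by (simp add: power_mult_distrib summable_on_cmult_right)

lift_definition inner_dsum :: "dsum \<Rightarrow> dsum \<Rightarrow> real" is "\<lambda>x y. \<Sum>\<^sub>\<infinity>n. inner (x n) (y n)" .

definition norm_dsum :: "dsum \<Rightarrow> real" where "norm_dsum x = sqrt (inner x x)"
definition sgn_dsum :: "dsum \<Rightarrow> dsum" where "sgn_dsum x = inverse (norm x) *\<^sub>R x"
definition dist_dsum :: "dsum \<Rightarrow> dsum \<Rightarrow> real" where "dist_dsum x y = norm (x - y)"
definition uniformity_dsum :: "(dsum \<times> dsum) filter"
  where "uniformity_dsum = (INF e\<in>{0<..}. principal {(x, y). dist x y < e})"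
definition open_dsum :: "dsum set \<Rightarrow> bool"
  where "open_dsum S = (\<forall>x\<in>S. \<forall>\<^sub>F (x', y) in uniformity. x' = x \<longrightarrow> y \<in> S)"

instance
proof
  fix x y z :: dsum and r s :: real
  show "x + y + z = x + (y + z)" by transfer (auto simp: add.assoc)
  show "x + y = y + x" by transfer (auto simp: add.commute)
  show "0 + x = x" by transfer auto
  show "- x + x = 0" by transfer auto
  show "x - y = x + - y" by transfer auto
  show "r *\<^sub>R (x + y) = r *\<^sub>R x + r *\<^sub>R y" by transfer (auto simp: scaleR_add_right)
  show "(r + s) *\<^sub>R x = r *\<^sub>R x + s *\<^sub>R x" by transfer (auto simp: scaleR_add_left)
  show "r *\<^sub>R s *\<^sub>R x = (r * s) *\<^sub>R x" by transfer auto
  show "1 *\<^sub>R x = x" by transfer auto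
  show "sgn x = inverse (norm x) *\<^sub>R x" by (simp add: sgn_dsum_def)
  show "dist x y = norm (x - y)" by (simp add: dist_dsum_def)
  show "uniformity = (INF e\<in>{0<..}. principal {(x::dsum, y). dist x y < e})"
    by (simp add: uniformity_dsum_def)
  show "open S = (\<forall>x\<in>S. \<forall>\<^sub>F (x', y) in uniformity. x' = x \<longrightarrow> y \<in> S)" for S :: "dsum set"
    by (simp add: open_dsum_def)
  show "inner x y = inner y x" by transfer (simp add: inner_commute)
  show "inner (x + y) z = inner x z + inner y z"
    by transfer (simp add: inner_add_left infsum_add inner_summable)
  show "inner (r *\<^sub>R x) y = r * inner x y"
    by transfer (simp add: infsum_cmult_right inner_summable)
  show "0 \<le> inner x x" by transfer (simp add: infsum_nonneg)
  show "(inner x x = 0) = (x = 0)"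
  proof transfer
    fix x :: "int \<Rightarrow> L2" assume x: "(\<lambda>n. (norm (x n))\<^sup>2) summable_on UNIV"
    have "x n = 0" if "(\<Sum>\<^sub>\<infinity>n. inner (x n) (x n)) = 0" for n
      using nonneg_infsum_le_0D[of "\<lambda>n. inner (x n) (x n)" UNIV n] that inner_summable[OF x x] by simp
    then have "(\<Sum>\<^sub>\<infinity>n. inner (x n) (x n)) = 0 \<Longrightarrow> x = (\<lambda>_. 0)" by (rule ext)
    then show "((\<Sum>\<^sub>\<infinity>n. inner (x n) (x n)) = 0) = (x = (\<lambda>_. 0))" by (intro iffI) simp_all
  qed
  show "norm x = sqrt (inner x x)" by (simp add: norm_dsum_def)
qed

end

instantiation dsum :: complex_normed
begin

lift_definition scaleC_dsum :: "complex \<Rightarrow> dsum \<Rightarrow> dsum" is "\<lambda>c x n. c *\<^sub>C x n"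
  by (simp add: norm_scaleC power_mult_distrib summable_on_cmult_right)

instance
proof
  fix x y :: dsum and r :: real and c d :: complex
  show "r *\<^sub>R x = complex_of_real r *\<^sub>C x" by transfer (simp add: scaleR_scaleC)
  show "c *\<^sub>C (x + y) = c *\<^sub>C x + c *\<^sub>C y" by transfer (simp add: scaleC_add_right)
  show "(c + d) *\<^sub>C x = c *\<^sub>C x + d *\<^sub>C x" by transfer (simp add: scaleC_add_left)
  show "c *\<^sub>C d *\<^sub>C x = (c * d) *\<^sub>C x" by transfer (simp add: scaleC_scaleC)
  show "1 *\<^sub>C x = x" by transfer (simp add: scaleC_one)
  have "inner (c *\<^sub>C x) (c *\<^sub>C x) = (cmod c)\<^sup>2 * inner x x"
    by transfer (simp add: power2_norm_eq_inner[symmetric] norm_scaleC power_mult_distrib infsum_cmult_right)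
  then show "norm (c *\<^sub>C x) = cmod c * norm x"
    by (simp add: norm_eq_sqrt_inner real_sqrt_mult)
qed

end

lemma cinner_dsum: "cinner x y = (\<Sum>\<^sub>\<infinity>n. cinner (comps x n) (comps y n))"
proof -
  have i: "comps (\<i> *\<^sub>C x) = (\<lambda>n. \<i> *\<^sub>C comps x n)" by transfer simp
  have s: "(\<lambda>n. inner (comps u n) (comps v n)) summable_on UNIV" for u v
    by transfer (rule inner_summable)
  have "((\<lambda>n. of_real (inner (comps x n) (comps y n)) + \<i> * of_real (inner (comps (\<i> *\<^sub>C x) n) (comps y n)))
      has_sum (of_real (inner x y) + \<i> * of_real (inner (\<i> *\<^sub>C x) y))) UNIV"
    unfolding inner_dsum.rep_eq
    by (intro has_sum_add has_sum_cmult_right has_sum_of_real has_sum_infsum s)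
  then show ?thesis
    by (simp add: cinner_def Complex_eq i infsumI)
qed

instantiation prod :: (complex_normed, complex_normed) complex_normed
begin

definition scaleC_prod :: "complex \<Rightarrow> 'a \<times> 'b \<Rightarrow> 'a \<times> 'b" where
  "scaleC_prod c p = (c *\<^sub>C fst p, c *\<^sub>C snd p)"

instance
proof
  fix c d :: complex and r :: real and x y :: "'a \<times> 'b"
  show "r *\<^sub>R x = complex_of_real r *\<^sub>C x"
    by (simp add: scaleC_prod_def prod_eq_iff scaleR_scaleC)
  show "c *\<^sub>C (x + y) = c *\<^sub>C x + c *\<^sub>C y" by (simp add: scaleC_prod_def scaleC_add_right)
  show "(c + d) *\<^sub>C x = c *\<^sub>C x + d *\<^sub>C x" by (simp add: scaleC_prod_def scaleC_add_left)
  show "c *\<^sub>C d *\<^sub>C x = (c * d) *\<^sub>C x" by (simp add: scaleC_prod_def scaleC_scaleC)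
  show "1 *\<^sub>C x = x" by (simp add: scaleC_prod_def scaleC_one)
  show "norm (c *\<^sub>C x) = cmod c * norm x"
    by (simp add: scaleC_prod_def norm_prod_def norm_scaleC power_mult_distrib real_sqrt_mult
        flip: distrib_left)
qed

end

definition dsum_single :: "int \<Rightarrow> L2 \<Rightarrow> dsum" where
  "dsum_single m u = Dsum (\<lambda>n. if n = m then u else 0)"

definition L2_mult :: "(complex \<Rightarrow> complex) \<Rightarrow> L2 \<Rightarrow> L2" where
  "L2_mult \<phi> u = abs_L2 (\<lambda>z. \<phi> z * rep_L2 u z)"


section \<open>Circle diffeomorphisms\<close>

text \<open>
  Maps of the circle are functions on \<^typ>\<open>complex\<close> of which only the values on \<^const>\<open>circle\<close>
  matter.
\<close>

definition rot :: "real \<Rightarrow> complex \<Rightarrow> complex" where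
  "rot \<beta> z = cis (2 * pi * \<beta>) * z"

definition cinv :: "(complex \<Rightarrow> complex) \<Rightarrow> complex \<Rightarrow> complex" where
  "cinv f = inv_into circle f"

definition citer :: "(complex \<Rightarrow> complex) \<Rightarrow> int \<Rightarrow> complex \<Rightarrow> complex" where
  "citer f n = (if n \<ge> 0 then f ^^ nat n else cinv f ^^ nat (- n))"

definition circle_smooth :: "(complex \<Rightarrow> complex) \<Rightarrow> bool" where
  "circle_smooth f \<longleftrightarrow> (\<exists>G :: nat \<Rightarrow> real \<Rightarrow> complex. (\<forall>t. G 0 t = f (cis (2 * pi * t))) \<and>
     (\<forall>k t. (G k has_vector_derivative G (Suc k) t) (at t)))"

definition circle_diffeo :: "(complex \<Rightarrow> complex) \<Rightarrow> bool" where
  "circle_diffeo f \<longleftrightarrow> bij_betw f circle circle \<and> circle_smooth f \<and> circle_smooth (cinv f)"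

definition circle_lift :: "(complex \<Rightarrow> complex) \<Rightarrow> (real \<Rightarrow> real) \<Rightarrow> bool" where
  "circle_lift f F \<longleftrightarrow> continuous_on UNIV F \<and> (\<forall>t. f (cis (2 * pi * t)) = cis (2 * pi * F t))"

definition orientation_preserving :: "(complex \<Rightarrow> complex) \<Rightarrow> bool" where
  "orientation_preserving f \<longleftrightarrow> (\<exists>F. circle_lift f F \<and> strict_mono F)"

text \<open>
  The rotation number is defined modulo 1; as adding an integer to a lift adds it to the limit,
  every representative of the rotation number is the limit for some lift.
\<close>
definition has_rotation_number :: "(complex \<Rightarrow> complex) \<Rightarrow> real \<Rightarrow> bool" where
  "has_rotation_number f \<rho> \<longleftrightarrow>
     (\<exists>F. circle_lift f F \<and> (\<forall>t. (\<lambda>n. (F ^^ n) t / real n) \<longlonglongrightarrow> \<rho>))"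

definition conjugate_rot :: "(complex \<Rightarrow> complex) \<Rightarrow> real \<Rightarrow> complex \<Rightarrow> complex" where
  "conjugate_rot h \<beta> = h \<circ> rot \<beta> \<circ> cinv h"

definition circ_deriv :: "(complex \<Rightarrow> complex) \<Rightarrow> complex \<Rightarrow> complex" where
  "circ_deriv f z = (THE d. (f has_field_derivative d) (at z within circle))"

definition circle_C1 :: "(complex \<Rightarrow> complex) set" where
  "circle_C1 = {g. \<exists>g'. continuous_on circle g' \<and>
     (\<forall>z\<in>circle. (g has_field_derivative g' z) (at z within circle))}"

definition Growth :: "(complex \<Rightarrow> complex) \<Rightarrow> int \<Rightarrow> real" where
  "Growth f n = max (SUP z\<in>circle. cmod (circ_deriv (citer f n) z))
                    (SUP z\<in>circle. cmod (circ_deriv (citer f (- n)) z))"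

definition mod_weight :: "(complex \<Rightarrow> complex) \<Rightarrow> int \<Rightarrow> complex \<Rightarrow> complex" where
  "mod_weight f n z = z * circ_deriv (citer f n) z / citer f n z"


section \<open>The noncommutative torus and its representation\<close>

text \<open>
  \<open>is_rotation_algebra \<theta> U V\<close>: the ambient \<open>C*\<close>-algebra is the universal one generated by unitaries
  with \<open>UV = exp(2\<pi>\<i>\<theta>)VU\<close>. A \<open>C*\<close>-algebra generated by two elements is separable, hence acts
  faithfully on the separable infinite-dimensional Hilbert space \<^typ>\<open>dsum\<close>; it therefore suffices to
  ask for the universal property with respect to pairs of unitary operators on \<^typ>\<open>dsum\<close>.
\<close>
definition is_rotation_algebra :: "real \<Rightarrow> 'a::cstar_algebra \<Rightarrow> 'a \<Rightarrow> bool" where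
  "is_rotation_algebra \<theta> U V \<longleftrightarrow> unitary U \<and> unitary V \<and> U * V = cis (2 * pi * \<theta>) *\<^sub>C (V * U) \<and>
     (\<forall>S. closed_star_subalgebra S \<and> U \<in> S \<and> V \<in> S \<longrightarrow> S = UNIV) \<and>
     (\<forall>u v :: dsum \<Rightarrow> dsum. unitary_op u \<and> unitary_op v \<and>
        (\<forall>x. u (v x) = cis (2 * pi * \<theta>) *\<^sub>C v (u x)) \<longrightarrow>
        (\<exists>\<rho>. star_rep \<rho> \<and> \<rho> U = u \<and> \<rho> V = v))"

definition fin_supp :: "(int \<times> int \<Rightarrow> complex) \<Rightarrow> bool" where
  "fin_supp c \<longleftrightarrow> finite {p. c p \<noteq> 0}"

definition Weyl :: "real \<Rightarrow> 'a::cstar_algebra \<Rightarrow> 'a \<Rightarrow> int \<Rightarrow> int \<Rightarrow> 'a" where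
  "Weyl \<alpha> U V k n = cis (- 2 * pi * \<alpha> * of_int k * of_int n) *\<^sub>C (upow U k * upow V n)"

definition Weyl_sum :: "real \<Rightarrow> 'a::cstar_algebra \<Rightarrow> 'a \<Rightarrow> (int \<times> int \<Rightarrow> complex) \<Rightarrow> 'a" where
  "Weyl_sum \<alpha> U V c = (\<Sum>p | c p \<noteq> 0. c p *\<^sub>C Weyl \<alpha> U V (fst p) (snd p))"

definition row_poly :: "(int \<times> int \<Rightarrow> complex) \<Rightarrow> int \<Rightarrow> complex \<Rightarrow> complex" where
  "row_poly c n z = (\<Sum>k | c (k, n) \<noteq> 0. c (k, n) * z powi k)"

text \<open>\<open>\<mu>(E) = m(h(E))\<close> is the push-forward of \<open>m\<close> under \<open>h\<^sup>-\<^sup>1\<close>.\<close>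
definition is_omega_mu :: "real \<Rightarrow> (complex \<Rightarrow> complex) \<Rightarrow> 'a::cstar_algebra \<Rightarrow> 'a \<Rightarrow> ('a \<Rightarrow> complex) \<Rightarrow> bool" where
  "is_omega_mu \<alpha> h U V \<omega> \<longleftrightarrow> state \<omega> \<and> (\<forall>c. fin_supp c \<longrightarrow> \<omega> (Weyl_sum \<alpha> U V c) =
     (\<Sum>k | c (k, 0) \<noteq> 0. (\<integral>z. z powi k \<partial>(distr circ_measure circ_measure (cinv h))) * c (k, 0)))"

definition xi_omega :: dsum where
  "xi_omega = dsum_single 0 (abs_L2 (\<lambda>_. 1))"

definition is_pi_omega :: "real \<Rightarrow> (complex \<Rightarrow> complex) \<Rightarrow> 'a::cstar_algebra \<Rightarrow> 'a \<Rightarrow> ('a \<Rightarrow> complex) \<Rightarrow>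
    ('a \<Rightarrow> dsum \<Rightarrow> dsum) \<Rightarrow> bool" where
  "is_pi_omega \<alpha> h U V \<omega> \<rho> \<longleftrightarrow> GNS \<omega> \<rho> xi_omega \<and>
     (\<forall>c g n. fin_supp c \<longrightarrow> comps (\<rho> (Weyl_sum \<alpha> U V c) g) n =
        (\<Sum>l | \<exists>k. c (k, l) \<noteq> 0.
           L2_mult (row_poly c l \<circ> cinv h \<circ> citer (conjugate_rot h \<alpha>) (2 * n - l)) (comps g (n - l))))"

text \<open>
  Continuous functional calculus of a unitary, \<open>x = F(U)\<close>: \<open>x\<close> is the norm limit of \<open>p(U)\<close> for
  Laurent polynomials \<open>p\<close> converging to \<open>F\<close> uniformly on the circle.
\<close>
definition has_fun_calc :: "'a::cstar_algebra \<Rightarrow> (complex \<Rightarrow> complex) \<Rightarrow> 'a \<Rightarrow> bool" where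
  "has_fun_calc U F x \<longleftrightarrow> (\<forall>e>0. \<exists>(K::int set) c. finite K \<and>
     (\<forall>z\<in>circle. cmod (F z - (\<Sum>k\<in>K. c k * z powi k)) < e) \<and> norm (x - (\<Sum>k\<in>K. c k *\<^sub>C upow U k)) < e)"

definition smooth_subalgebra :: "(complex \<Rightarrow> complex) \<Rightarrow> 'a::cstar_algebra \<Rightarrow> 'a \<Rightarrow> 'a set" where
  "smooth_subalgebra h U V = {\<Sum>k\<in>J. X k * upow V k | (J :: int set) X.
     finite J \<and> (\<forall>k\<in>J. \<exists>g\<in>circle_C1. has_fun_calc U (g \<circ> h) (X k))}"


section \<open>The operator \<open>L\<close> and the deformed commutator\<close>

definition abs_cont_on :: "real \<Rightarrow> real \<Rightarrow> (real \<Rightarrow> complex) \<Rightarrow> bool" where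
  "abs_cont_on a b f \<longleftrightarrow> (\<forall>e>0. \<exists>d>0. \<forall>D. D division_of \<Union>D \<and> \<Union>D \<subseteq> {a..b} \<and> (\<Sum>k\<in>D. Sup k - Inf k) < d \<longrightarrow>
     (\<Sum>k\<in>D. cmod (f (Sup k) - f (Inf k))) < e)"

definition H1_deriv :: "L2 \<Rightarrow> L2 \<Rightarrow> bool" where
  "H1_deriv u v \<longleftrightarrow> (\<exists>f g. sq_int f \<and> sq_int g \<and> u = abs_L2 f \<and> v = abs_L2 g \<and>
     abs_cont_on 0 1 (\<lambda>t. f (cis (2 * pi * t))) \<and>
     (AE z in circ_measure. (f has_field_derivative g z) (at z within circle)))"

definition H1 :: "L2 set" where
  "H1 = {u. \<exists>v. H1_deriv u v}"

definition L2_deriv :: "L2 \<Rightarrow> L2" where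
  "L2_deriv u = (THE v. H1_deriv u v)"

definition a_coeff :: "(complex \<Rightarrow> complex) \<Rightarrow> int \<Rightarrow> real" where
  "a_coeff f n = (if n > 0 then (\<Sum>l=1..n. 1 / Growth f l) else - (\<Sum>l=1..\<bar>n\<bar>. 1 / Growth f (l - 1)))"

text \<open>The \<open>n\<close>-th summand of \<open>L\<close>, on the domain \<^const>\<open>H1\<close>.\<close>
definition L_summand :: "(complex \<Rightarrow> complex) \<Rightarrow> int \<Rightarrow> L2 \<Rightarrow> L2" where
  "L_summand f n u = \<i> *\<^sub>C L2_mult (\<lambda>z. z) (L2_deriv u) - a_coeff f n *\<^sub>R u"

text \<open>The Hilbert space adjoint of an operator \<open>S\<close> with dense domain \<open>Dom\<close>.\<close>
definition adjoint_on :: "'h::{complex_normed,real_inner} set \<Rightarrow> ('h \<Rightarrow> 'h) \<Rightarrow> 'h \<Rightarrow> 'h" where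
  "adjoint_on Dom S v = (THE w. \<forall>u\<in>Dom. cinner w u = cinner v (S u))"

text \<open>The adjoint of a direct sum of operators is the direct sum of the adjoints.\<close>
definition L_adj_summand :: "(complex \<Rightarrow> complex) \<Rightarrow> int \<Rightarrow> L2 \<Rightarrow> L2" where
  "L_adj_summand f n = adjoint_on H1 (L_summand f n)"

text \<open>
  The commutators are formed componentwise, since \<open>L\<eta>\<close> and \<open>\<Delta>\<^sup>-\<^sup>1\<xi>\<close> need not be square-summable for
  \<open>(\<xi>,\<eta>)\<close> in the domain of the deformed commutator. \<open>ext_comps A\<close> extends \<open>A\<close> to arbitrary sequences
  through its matrix entries; for \<open>A\<close> in the image of the smooth subalgebra all the sums are finite.
\<close>
definition mat_entry :: "(dsum \<Rightarrow> dsum) \<Rightarrow> int \<Rightarrow> int \<Rightarrow> L2 \<Rightarrow> L2" where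
  "mat_entry A n m u = comps (A (dsum_single m u)) n"

definition ext_comps :: "(dsum \<Rightarrow> dsum) \<Rightarrow> (int \<Rightarrow> L2) \<Rightarrow> int \<Rightarrow> L2" where
  "ext_comps A x n = (\<Sum>\<^sub>\<infinity>m. mat_entry A n m (x m))"

definition dcommutator :: "(int \<Rightarrow> L2 \<Rightarrow> L2) \<Rightarrow> (dsum \<Rightarrow> dsum) \<Rightarrow> (int \<Rightarrow> L2) \<Rightarrow> int \<Rightarrow> L2" where
  "dcommutator S A x n = S n (ext_comps A x n) - ext_comps A (\<lambda>m. S m (x m)) n"

definition Delta_inv :: "(complex \<Rightarrow> complex) \<Rightarrow> (int \<Rightarrow> L2) \<Rightarrow> int \<Rightarrow> L2" where
  "Delta_inv f x n = L2_mult (\<lambda>z. inverse (mod_weight f n z)) (x n)"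

definition D_sigma_dom :: "(complex \<Rightarrow> complex) \<Rightarrow> (dsum \<Rightarrow> dsum) \<Rightarrow> (dsum \<times> dsum) set" where
  "D_sigma_dom f A = {(\<xi>, \<eta>). (\<forall>n. comps \<xi> n \<in> H1 \<and> comps \<eta> n \<in> H1) \<and>
     (\<lambda>n. (norm (dcommutator (L_adj_summand f) A (Delta_inv f (comps \<xi>)) n))\<^sup>2 +
          (norm (Delta_inv f (dcommutator (L_summand f) A (comps \<eta>)) n))\<^sup>2) summable_on UNIV}"

definition D_sigma :: "(complex \<Rightarrow> complex) \<Rightarrow> (dsum \<Rightarrow> dsum) \<Rightarrow> dsum \<times> dsum \<Rightarrow> dsum \<times> dsum" where
  "D_sigma f A = (\<lambda>(\<xi>, \<eta>). \<i> *\<^sub>C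
     (Dsum (Delta_inv f (dcommutator (L_summand f) A (comps \<eta>))),
      Dsum (dcommutator (L_adj_summand f) A (Delta_inv f (comps \<xi>)))))"

definition densely_defined_bounded :: "'a::complex_normed set \<Rightarrow> ('a \<Rightarrow> 'b::complex_normed) \<Rightarrow> bool" where
  "densely_defined_bounded Dom B \<longleftrightarrow>
     0 \<in> Dom \<and> (\<forall>x\<in>Dom. \<forall>y\<in>Dom. x + y \<in> Dom \<and> B (x + y) = B x + B y) \<and>
     (\<forall>c. \<forall>x\<in>Dom. c *\<^sub>C x \<in> Dom \<and> B (c *\<^sub>C x) = c *\<^sub>C B x) \<and>
     closure Dom = UNIV \<and> (\<exists>C. \<forall>x\<in>Dom. norm (B x) \<le> C * norm x)"

end

(* An element sum_l F_l(U) V^l with F_l = g_l o h acts on the direct sum as a band matrix whose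
   (n, n - l) entry is multiplication by g_l o f^n, because T = h R_alpha h^-1 and T^2 = f. By
   integration by parts L* is -i z d/dz - a_n on H^1, so the commutators with L and L* are again
   band matrices of multiplication operators, with symbols
   +-i z (g_l o f^n)' - (a_n - a_(n-l)) (g_l o f^n). Weighting by Delta^-1 keeps them bounded
   uniformly in n: the derivative term by the chain rule, and the other one since
   a_n - a_(n-1) = 1/Gamma_n for every integer n while Gamma_m / Gamma_n <= Gamma_(m-n). *)
theory Submission
  imports Defs
begin

section \<open>Calculus along the circle\<close>

text \<open>Boundedness makes the summability condition in the domain automatic: the domain is the
  set of all pairs with components in H^1, so its density reduces to that of H^1 in L^2. The same
  density is used a second time, since it makes the value chosen by \<open>adjoint_on\<close>
  unique. Integration by parts concerns functions that are only absolutely continuous, which calls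
  for a fundamental theorem of calculus with a derivative off a null set. The formula for the
  adjoint is established on H^1, while the adjoint is applied to Delta^{-1} xi; hence the weights
  must be C^1, and as they contain D f^n, the iterates must be C^2. The two corners meet different
  weights. In the entry (n, n - l), Delta^{-1}[L,A] divides by delta_n and cancels the D f^n of the
  chain rule, whereas [L*,A]Delta^{-1} divides by delta_{n-l} and leaves D f^l at a shifted point.
  In both, |1/delta_m| is at most Gamma_m, and Gamma_m |a_n - a_{n-l}| telescopes into |l| quotients
  of growth constants. The representation is prescribed on Laurent polynomials, so a general F_l is
  reached by uniform approximation.\<close>

lemma circle_limit_point:
  assumes "z \<in> circle" shows "at z within circle \<noteq> bot"
proof -
  have "connected circle" by (rule connected_sphere) simp
  moreover have "\<not> circle \<subseteq> {z}"
  proof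
    assume "circle \<subseteq> {z}"
    moreover have "1 \<in> circle" "-1 \<in> circle" by auto
    ultimately have "1 = z" "-1 = z" by blast+
    then show False by (metis one_neq_neg_one)
  qed
  moreover have "circle \<noteq> {x}" for x :: complex
    using \<open>\<not> circle \<subseteq> {z}\<close> assms by (metis empty_iff insert_iff order_refl)
  ultimately have "z islimpt circle"
    using connected_imp_perfect[of circle z] assms by blast
  then show ?thesis by (simp add: trivial_limit_within)
qed

text \<open>Makes the \<open>THE\<close> in \<open>circ_deriv\<close> meaningful. A difference
  quotient has only one limit because the filter \<open>at z within circle\<close> is nontrivial,
  and that holds since a connected set with two points has no isolated point.\<close>

lemma circle_deriv_unique:
  assumes "(f has_field_derivative d) (at z within circle)"
    and "(f has_field_derivative d') (at z within circle)" and "z \<in> circle"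
  shows "d = d'"
  using tendsto_unique[OF circle_limit_point] assms unfolding has_field_derivative_iff by blast

lemma circ_deriv_eq:
  assumes "(f has_field_derivative d) (at z within circle)" and "z \<in> circle"
  shows "circ_deriv f z = d"
  unfolding circ_deriv_def using assms circle_deriv_unique by blast

lemma circle_deriv_cong:
  assumes "(f has_field_derivative d) (at z within circle)" and "z \<in> circle"
    and "\<And>w. w \<in> circle \<Longrightarrow> g w = f w"
  shows "(g has_field_derivative d) (at z within circle)"
  by (rule has_field_derivative_transform_within[OF assms(1) zero_less_one]) (use assms in auto)

lemma circle_C1I:
  assumes "\<And>z. z \<in> circle \<Longrightarrow> (g has_field_derivative g' z) (at z within circle)"
    and "continuous_on circle g'"
  shows "g \<in> circle_C1"
  using assms unfolding circle_C1_def by blast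

lemma circle_C1_has_deriv:
  assumes "g \<in> circle_C1" "z \<in> circle"
  shows "(g has_field_derivative circ_deriv g z) (at z within circle)"
  using assms circ_deriv_eq unfolding circle_C1_def by fastforce

lemma circle_C1_continuous_deriv:
  assumes "g \<in> circle_C1"
  shows "continuous_on circle (circ_deriv g)"
proof -
  obtain g' where g': "continuous_on circle g'"
    "\<And>z. z \<in> circle \<Longrightarrow> (g has_field_derivative g' z) (at z within circle)"
    using assms unfolding circle_C1_def by blast
  then have "circ_deriv g z = g' z" if "z \<in> circle" for z using circ_deriv_eq that by blast
  then show ?thesis using g'(1) continuous_on_cong[OF refl, of circle "circ_deriv g" g'] by blast
qed

lemma circle_C1_continuous: "g \<in> circle_C1 \<Longrightarrow> continuous_on circle g"
  by (rule DERIV_continuous_on) (rule circle_C1_has_deriv)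

lemma circle_C1_cong:
  assumes "f \<in> circle_C1" "\<And>w. w \<in> circle \<Longrightarrow> g w = f w"
  shows "g \<in> circle_C1"
  using circle_deriv_cong[OF circle_C1_has_deriv[OF assms(1)] _ assms(2)]
    circle_C1_continuous_deriv[OF assms(1)] by (rule circle_C1I)

lemma circ_deriv_cong:
  assumes "f \<in> circle_C1" "\<And>w. w \<in> circle \<Longrightarrow> g w = f w" "z \<in> circle"
  shows "circ_deriv g z = circ_deriv f z"
  using circle_deriv_cong[OF circle_C1_has_deriv[OF assms(1)] _ assms(2)] assms(3)
  by (blast intro: circ_deriv_eq)

section \<open>Algebra and composition of C^1 functions on the circle\<close>

lemma circle_C1_const: "(\<lambda>_. c) \<in> circle_C1"
  by (rule circle_C1I[of _ "\<lambda>_. 0"]) auto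

lemma circle_C1_ident: "(\<lambda>z. z) \<in> circle_C1"
  by (rule circle_C1I[of _ "\<lambda>_. 1"]) auto

lemma circle_C1_add:
  assumes "f \<in> circle_C1" "g \<in> circle_C1" shows "(\<lambda>z. f z + g z) \<in> circle_C1"
  by (rule circle_C1I[OF DERIV_add])
     (use assms in \<open>auto intro!: circle_C1_has_deriv continuous_intros circle_C1_continuous_deriv\<close>)

lemma circle_C1_mult:
  assumes "f \<in> circle_C1" "g \<in> circle_C1" shows "(\<lambda>z. f z * g z) \<in> circle_C1"
  using DERIV_mult[OF circle_C1_has_deriv[OF assms(1)] circle_C1_has_deriv[OF assms(2)]]
  by (rule circle_C1I)
     (assumption+, intro continuous_intros assms[THEN circle_C1_continuous] assms[THEN circle_C1_continuous_deriv])

lemma circle_C1_inverse: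
  assumes "f \<in> circle_C1" "\<And>z. z \<in> circle \<Longrightarrow> f z \<noteq> 0" shows "(\<lambda>z. inverse (f z)) \<in> circle_C1"
  using DERIV_inverse'[OF circle_C1_has_deriv[OF assms(1)] assms(2)]
  by (rule circle_C1I)
     (use assms(2) in \<open>auto intro!: continuous_intros circle_C1_continuous[OF assms(1)]
        circle_C1_continuous_deriv[OF assms(1)] simp del: mem_sphere\<close>)

lemma circle_has_deriv_compose:
  assumes "f \<in> circle_C1" "g \<in> circle_C1" "g ` circle \<subseteq> circle" "z \<in> circle"
  shows "((f \<circ> g) has_field_derivative circ_deriv f (g z) * circ_deriv g z) (at z within circle)"
proof (rule DERIV_image_chain)
  have "g z \<in> circle" using assms by blast
  then show "(f has_field_derivative circ_deriv f (g z)) (at (g z) within g ` circle)"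
    using DERIV_subset[OF circle_C1_has_deriv assms(3)] assms(1) by blast
qed (use assms circle_C1_has_deriv in auto)

lemma circle_C1_compose:
  assumes "f \<in> circle_C1" "g \<in> circle_C1" "g ` circle \<subseteq> circle"
  shows "(f \<circ> g) \<in> circle_C1"
  using circle_has_deriv_compose[OF assms]
proof (rule circle_C1I)
  have "continuous_on circle (circ_deriv f \<circ> g)"
    by (rule continuous_on_compose)
       (use assms circle_C1_continuous circle_C1_continuous_deriv continuous_on_subset in blast)+
  then show "continuous_on circle (\<lambda>z. circ_deriv f (g z) * circ_deriv g z)"
    using circle_C1_continuous_deriv[OF assms(2)] by (auto intro!: continuous_intros simp: o_def)
qed

lemma circ_deriv_compose:
  assumes "f \<in> circle_C1" "g \<in> circle_C1" "g ` circle \<subseteq> circle" "z \<in> circle"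
  shows "circ_deriv (f \<circ> g) z = circ_deriv f (g z) * circ_deriv g z"
  using circle_has_deriv_compose[OF assms] assms(4) by (rule circ_deriv_eq)

text \<open>Near a point of the circle the angle is a branch of \<open>Ln\<close>, so derivatives in the angle and
  derivatives along the circle determine each other.\<close>
lemma has_field_derivative_circleI:
  assumes "((\<lambda>t. f (cis (2 * pi * t))) has_vector_derivative d) (at t)"
  shows "(f has_field_derivative d / (2 * pi * \<i> * cis (2 * pi * t))) (at (cis (2 * pi * t)) within circle)"
proof -
  define w where "w = cis (2 * pi * t)"
  define F where "F = (\<lambda>t. f (cis (2 * pi * t)))"
  \<comment> \<open>The angle from w to z in full turns, on the principal branch: it vanishes at w,
    is continuous there, and \<open>t + \<tau> z\<close> is a parameter of z.\<close>
  define \<tau> where "\<tau> = (\<lambda>z. Im (Ln (z / w)) / (2 * pi))"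
  have w0: "w \<noteq> 0" "cmod w = 1" by (auto simp: w_def)
  have Ln_eq: "Ln (z / w) = 2 * pi * \<i> * \<tau> z" if "z \<in> circle" for z
  proof -
    have "z / w \<noteq> 0" "cmod (z / w) = 1" using that w0 by (auto simp: norm_divide)
    then have "Re (Ln (z / w)) = 0" by simp
    then show ?thesis by (simp add: \<tau>_def complex_eq_iff)
  qed
  have z_eq: "z = cis (2 * pi * (t + \<tau> z))" if "z \<in> circle" for z
  proof -
    have "z / w = exp (Ln (z / w))" using that w0 by (subst exp_Ln) auto
    also have "\<dots> = cis (2 * pi * \<tau> z)" unfolding Ln_eq[OF that] by (simp add: cis_conv_exp mult_ac)
    finally show ?thesis using w0 by (simp add: w_def cis_mult[symmetric] distrib_left field_simps)
  qed
  have "((\<lambda>s. norm (F s - F t - (s - t) *\<^sub>R d) / norm (s - t)) \<longlongrightarrow> 0) (at t)"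
    using assms unfolding F_def has_vector_derivative_def has_derivative_iff_norm by blast
  then have "((\<lambda>s. norm ((F s - F t) / of_real (s - t) - d)) \<longlongrightarrow> 0) (at t)"
  proof (rule Lim_transform_eventually)
    have "norm (F s - F t - (s - t) *\<^sub>R d) / norm (s - t) = norm ((F s - F t) / of_real (s - t) - d)"
      if "s \<noteq> t" for s
    proof -
      have "(F s - F t) / of_real (s - t) - d = (F s - F t - (s - t) *\<^sub>R d) / of_real (s - t)"
        using that by (simp add: field_simps scaleR_conv_of_real)
      then show ?thesis by (simp add: norm_divide flip: of_real_diff)
    qed
    then show "\<forall>\<^sub>F s in at t. norm (F s - F t - (s - t) *\<^sub>R d) / norm (s - t) = norm ((F s - F t) / of_real (s - t) - d)"
      by (simp add: eventually_at_filter)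
  qed
  then have Fd: "((\<lambda>s. (F s - F t) / of_real (s - t)) \<longlongrightarrow> d) (at t)"
    using LIM_zero_iff tendsto_norm_zero_iff by blast
  have dLn: "((\<lambda>z. Ln (z / w)) has_field_derivative 1 / w) (at w within circle)"
    using w0 by (auto intro!: derivative_eq_intros)
  have "((\<lambda>z. Ln (z / w)) \<longlongrightarrow> Ln (w / w)) (at w within circle)"
    using DERIV_continuous[OF dLn] by (simp add: continuous_within)
  then have \<tau>0: "((\<lambda>z. t + \<tau> z) \<longlongrightarrow> t) (at w within circle)"
    unfolding \<tau>_def using w0 by (auto intro!: tendsto_eq_intros)
  have ne: "\<tau> z \<noteq> 0" if "z \<in> circle" "z \<noteq> w" for z
    using z_eq[OF that(1)] that(2) by (auto simp: w_def)
  have ev: "\<forall>\<^sub>F z in at w within circle. z \<in> circle \<and> z \<noteq> w"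
    by (simp add: eventually_at_filter)
  have "filterlim (\<lambda>z. t + \<tau> z) (at t) (at w within circle)"
    by (rule filterlim_atI[OF \<tau>0]) (use ev ne in \<open>auto elim: eventually_mono\<close>)
  from filterlim_compose[OF Fd this]
  have 1: "((\<lambda>z. (F (t + \<tau> z) - F t) / of_real (\<tau> z)) \<longlongrightarrow> d) (at w within circle)" by simp
  have 2: "((\<lambda>z. (Ln (z / w) - Ln (w / w)) / (z - w)) \<longlongrightarrow> 1 / w) (at w within circle)"
    using dLn by (simp add: has_field_derivative_iff)
  \<comment> \<open>The difference quotient of f at w factors into the quotient in the angle and the
    quotient \<open>\<tau> z / (z - w)\<close>; the latter is the difference quotient of
    \<open>Ln\<close> divided by \<open>2 * pi * \<i>\<close>.\<close>
  have "((\<lambda>z. (F (t + \<tau> z) - F t) / of_real (\<tau> z) * ((Ln (z / w) - Ln (w / w)) / (z - w) / (2 * pi * \<i>)))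
      \<longlongrightarrow> d * (1 / w / (2 * pi * \<i>))) (at w within circle)"
    by (intro tendsto_mult 1 tendsto_divide 2 tendsto_const) auto
  then have "((\<lambda>z. (f z - f w) / (z - w)) \<longlongrightarrow> d * (1 / w / (2 * pi * \<i>))) (at w within circle)"
  proof (rule Lim_transform_eventually)
    show "\<forall>\<^sub>F z in at w within circle. (F (t + \<tau> z) - F t) / of_real (\<tau> z) *
        ((Ln (z / w) - Ln (w / w)) / (z - w) / (2 * pi * \<i>)) = (f z - f w) / (z - w)"
      using ev
    proof (rule eventually_mono, elim conjE)
      fix z assume z: "z \<in> circle" "z \<noteq> w"
      have "F (t + \<tau> z) = f z" using z_eq[OF z(1)] by (simp add: F_def)
      then show "(F (t + \<tau> z) - F t) / of_real (\<tau> z) *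
        ((Ln (z / w) - Ln (w / w)) / (z - w) / (2 * pi * \<i>)) = (f z - f w) / (z - w)"
        using Ln_eq[OF z(1)] w0 ne[OF z] z by (simp add: F_def w_def)
    qed
  qed
  then show ?thesis
    unfolding has_field_derivative_iff w_def by (simp add: mult_ac)
qed

lemma has_vector_derivative_circleD:
  assumes "(f has_field_derivative d) (at (cis (2 * pi * t)) within circle)"
  shows "((\<lambda>t. f (cis (2 * pi * t))) has_vector_derivative 2 * pi * \<i> * cis (2 * pi * t) * d) (at t)"
proof -
  have "((\<lambda>t. cis (2 * pi * t)) has_vector_derivative 2 * pi * \<i> * cis (2 * pi * t)) (at t)"
    unfolding cis_conv_exp
    by (auto intro!: derivative_eq_intros has_vector_derivative_real_field  simp: has_field_derivative_def)
  then have "((f \<circ> (\<lambda>t. cis (2 * pi * t))) has_vector_derivative 2 * pi * \<i> * cis (2 * pi * t) * d) (at t)"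
    by (rule field_vector_diff_chain_within)
       (rule DERIV_subset[OF assms], auto)
  then show ?thesis by (simp add: o_def)
qed

section \<open>Multiplication operators\<close>

lemma space_circ_measure [simp]: "space circ_measure = circle"
  by (simp add: circ_measure_def space_restrict_space)

lemma sets_circ_measure: "sets circ_measure = sets (restrict_space borel circle)"
  by (simp add: circ_measure_def)

lemma measurable_circle_param:
  "(\<lambda>t. cis (2 * pi * t)) \<in> measurable (uniform_measure lborel {0..<1::real}) (restrict_space borel circle)"
proof -
  have "(\<lambda>t. cis (2 * pi * t)) \<in> borel_measurable borel"
    by (intro borel_measurable_continuous_onI continuous_intros)
  then show ?thesis by (intro measurable_restrict_space2) auto
qed

lemma uniform_measure_unit_interval:
  "uniform_measure lborel {0..<1} = density lborel (\<lambda>t::real. ennreal (indicator {0..<1} t))"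
  unfolding uniform_measure_def by (intro density_cong) (auto simp: indicator_def divide_ennreal_def)

lemma finite_measure_circ_measure: "finite_measure circ_measure"
proof (rule finite_measureI)
  have "emeasure circ_measure circle = emeasure (uniform_measure lborel {0..<1::real}) ((\<lambda>t. cis (2 * pi * t)) -` circle)"
    unfolding circ_measure_def
    by (subst emeasure_distr[OF measurable_circle_param]) (auto simp: sets_restrict_space)
  also have "(\<lambda>t::real. cis (2 * pi * t)) -` circle = UNIV" by auto
  also have "emeasure (uniform_measure lborel {0..<1::real}) UNIV = 1"
    by simp
  finally show "emeasure circ_measure (space circ_measure) \<noteq> \<infinity>" by simp
qed

lemma borel_measurable_circ_continuous:
  "continuous_on circle \<phi> \<Longrightarrow> \<phi> \<in> borel_measurable circ_measure"
  using borel_measurable_continuous_on_restrict[of circle \<phi>] measurable_cong_sets[OF sets_circ_measure refl]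
  by blast

lemma borel_measurable_circ_measure_borel: "\<phi> \<in> borel_measurable borel \<Longrightarrow> \<phi> \<in> borel_measurable circ_measure"
  using measurable_restrict_space1[of \<phi> borel borel circle] measurable_cong_sets[OF sets_circ_measure refl]
  by blast

lemma AE_circ_measure_param:
  assumes "AE z in circ_measure. P z"
  shows "AE t in lborel. t \<in> {0..<1} \<longrightarrow> P (cis (2 * pi * t))"
proof -
  have "AE t in uniform_measure lborel {0..<1}. P (cis (2 * pi * t))"
    using assms AE_distrD[OF measurable_circle_param] unfolding circ_measure_def by blast
  then show ?thesis
    unfolding uniform_measure_unit_interval by (subst (asm) AE_density) (auto simp: indicator_def)
qed

text \<open>Pulling the measure back to the parameter turns circle integrals into gauge integrals,
  the form in which the fundamental theorem below is stated. Closing the half-open interval changes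
  nothing because the point 1 is negligible.\<close>

lemma circ_integral_param:
  fixes f :: "complex \<Rightarrow> complex"
  assumes "integrable circ_measure f"
  shows "((\<lambda>t. f (cis (2 * pi * t))) has_integral (\<integral>z. f z \<partial>circ_measure)) {0..1}"
proof -
  define g where "g = (\<lambda>t. f (cis (2 * pi * t)))"
  note um = uniform_measure_unit_interval
  have fm: "f \<in> borel_measurable (restrict_space borel circle)"
    using borel_measurable_integrable[OF assms] measurable_cong_sets[OF sets_circ_measure refl] by blast
  have gm: "g \<in> borel_measurable lborel"
    using measurable_compose[OF measurable_circle_param fm] by (simp add: g_def)
  have "integrable (uniform_measure lborel {0..<1}) g"
    using assms integrable_distr_eq[OF measurable_circle_param fm] by (simp add: circ_measure_def g_def)
  then have "set_integrable lborel {0..<1} g"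
    unfolding um set_integrable_def using gm by (subst (asm) integrable_density) auto
  then have "(g has_integral (LINT t:{0..<1}|lborel. g t)) {0..<1}"
    using set_borel_integral_eq_integral[of "{0..<1}" g] by (simp add: has_integral_iff)
  moreover have "(LINT t:{0..<1}|lborel. g t) = (\<integral>z. f z \<partial>circ_measure)"
  proof -
    have "(LINT t:{0..<1}|lborel. g t) = (\<integral>t. g t \<partial>uniform_measure lborel {0..<1})"
      unfolding um set_lebesgue_integral_def using gm by (subst integral_density) auto
    then show ?thesis
      unfolding circ_measure_def integral_distr[OF measurable_circle_param fm] by (simp add: g_def)
  qed
  ultimately have "(g has_integral (\<integral>z. f z \<partial>circ_measure)) {0..<1}" by simp
  moreover have "(g has_integral y) {0..<1} \<longleftrightarrow> (g has_integral y) {0..1}" for y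
    by (rule has_integral_spike_set_eq) (auto intro: negligible_subset[of "{1}"])
  ultimately show ?thesis unfolding g_def by blast
qed

section \<open>Classes in L^2 and their representatives\<close>

lemma L2_relI:
  assumes "sq_int f" "\<And>z. z \<in> circle \<Longrightarrow> g z = f z"
  shows "L2_rel f g"
proof -
  have "g \<in> borel_measurable circ_measure \<longleftrightarrow> f \<in> borel_measurable circ_measure"
    by (rule measurable_cong) (use assms in auto)
  moreover have "integrable circ_measure (\<lambda>z. (cmod (g z))\<^sup>2) \<longleftrightarrow> integrable circ_measure (\<lambda>z. (cmod (f z))\<^sup>2)"
    by (rule Bochner_Integration.integrable_cong) (use assms in auto)
  ultimately have "sq_int g" using assms(1) by (simp add: sq_int_def)
  then show ?thesis using assms by (auto simp: L2_rel_def intro!: AE_I2)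
qed

lemma sq_int_rep_L2: "sq_int (rep_L2 u)"
  using Quotient_rep_reflp[OF Quotient_L2, of u] by (simp add: L2_rel_def)

lemma abs_rep_L2: "abs_L2 (rep_L2 u) = u"
  by (rule Quotient_abs_rep[OF Quotient_L2])

lemma abs_L2_eq_iff: "sq_int f \<Longrightarrow> sq_int g \<Longrightarrow> abs_L2 f = abs_L2 g \<longleftrightarrow> (AE z in circ_measure. f z = g z)"
  using Quotient_rel[OF Quotient_L2, of f g] by (auto simp: L2_rel_def)

lemma abs_L2_cong: "sq_int f \<Longrightarrow> (\<And>z. z \<in> circle \<Longrightarrow> g z = f z) \<Longrightarrow> abs_L2 g = abs_L2 f"
  using L2_relI[of f g] Quotient_rel[OF Quotient_L2, of f g] by auto

lemma L2_cases [cases type: L2]: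
  obtains f where "u = abs_L2 f" "sq_int f"
  using sq_int_rep_L2[of u] abs_rep_L2[of u] by metis

lemma abs_L2_add: "sq_int f \<Longrightarrow> sq_int g \<Longrightarrow> abs_L2 f + abs_L2 g = abs_L2 (\<lambda>z. f z + g z)"
  by (rule plus_L2.abs_eq) (auto simp: L2_rel_def)

lemma abs_L2_diff: "sq_int f \<Longrightarrow> sq_int g \<Longrightarrow> abs_L2 f - abs_L2 g = abs_L2 (\<lambda>z. f z - g z)"
  by (rule minus_L2.abs_eq) (auto simp: L2_rel_def)

lemma abs_L2_scaleC: "sq_int f \<Longrightarrow> c *\<^sub>C abs_L2 f = abs_L2 (\<lambda>z. c * f z)"
  by (rule scaleC_L2.abs_eq) (auto simp: L2_rel_def)

lemma abs_L2_zero: "abs_L2 (\<lambda>_. 0) = 0"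
  by (simp add: zero_L2_def)

lemma norm_abs_L2: "sq_int f \<Longrightarrow> (norm (abs_L2 f))\<^sup>2 = (\<integral>z. (cmod (f z))\<^sup>2 \<partial>circ_measure)"
  by (simp add: power2_norm_eq_inner inner_L2.abs_eq L2_rel_def)

lemma continuous_on_circle_bounded:
  fixes \<phi> :: "complex \<Rightarrow> complex"
  assumes "continuous_on circle \<phi>"
  obtains C where "C \<ge> 0" "\<And>z. z \<in> circle \<Longrightarrow> cmod (\<phi> z) \<le> C"
proof -
  have "bounded (\<phi> ` circle)"
    using compact_continuous_image[OF assms compact_sphere] compact_imp_bounded by blast
  then obtain C where "\<forall>z\<in>circle. cmod (\<phi> z) \<le> C" by (auto simp: bounded_iff)
  then show thesis using that[of "max C 0"] by force
qed

lemma sq_int_bounded_mult: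
  assumes \<phi>: "\<phi> \<in> borel_measurable circ_measure" "\<And>z. z \<in> circle \<Longrightarrow> cmod (\<phi> z) \<le> C" and f: "sq_int f"
  shows "sq_int (\<lambda>z. \<phi> z * f z)"
proof -
  have [measurable]: "f \<in> borel_measurable circ_measure" using f by (simp add: sq_int_def)
  have "integrable circ_measure (\<lambda>z. C\<^sup>2 * (cmod (f z))\<^sup>2)" using f by (simp add: sq_int_def)
  then have "integrable circ_measure (\<lambda>z. (cmod (\<phi> z * f z))\<^sup>2)"
    by (rule Bochner_Integration.integrable_bound)
       (use \<phi> in \<open>auto intro!: AE_I2 mult_right_mono power_mono simp: norm_mult power_mult_distrib\<close>)
  then show ?thesis using \<phi>(1) by (simp add: sq_int_def)
qed

lemma sq_int_bounded:
  assumes "\<phi> \<in> borel_measurable circ_measure" "\<And>z. z \<in> circle \<Longrightarrow> cmod (\<phi> z) \<le> C"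
  shows "sq_int \<phi>"
proof -
  interpret finite_measure circ_measure by (rule finite_measure_circ_measure)
  have "sq_int (\<lambda>_. 1)" by (simp add: sq_int_def)
  from sq_int_bounded_mult[OF assms this] show ?thesis by simp
qed

lemma sq_int_continuous: "continuous_on circle \<phi> \<Longrightarrow> sq_int \<phi>"
  using continuous_on_circle_bounded sq_int_bounded borel_measurable_circ_continuous by metis

lemma sq_int_mult: "continuous_on circle \<phi> \<Longrightarrow> sq_int f \<Longrightarrow> sq_int (\<lambda>z. \<phi> z * f z)"
  using continuous_on_circle_bounded sq_int_bounded_mult borel_measurable_circ_continuous by metis

lemma norm_abs_L2_le:
  assumes "sq_int f" "sq_int g" "C \<ge> 0" "\<And>z. z \<in> circle \<Longrightarrow> cmod (f z) \<le> C * cmod (g z)"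
  shows "norm (abs_L2 f) \<le> C * norm (abs_L2 g)"
proof -
  have "(norm (abs_L2 f))\<^sup>2 \<le> (\<integral>z. C\<^sup>2 * (cmod (g z))\<^sup>2 \<partial>circ_measure)"
    unfolding norm_abs_L2[OF assms(1)]
  proof (intro integral_mono)
    fix z assume "z \<in> space circ_measure"
    then show "(cmod (f z))\<^sup>2 \<le> C\<^sup>2 * (cmod (g z))\<^sup>2"
      using power_mono[OF assms(4), of z 2] by (simp add: power_mult_distrib)
  qed (use assms in \<open>auto simp: sq_int_def\<close>)
  also have "\<dots> = (C * norm (abs_L2 g))\<^sup>2"
    using assms by (simp add: power_mult_distrib norm_abs_L2)
  finally show ?thesis using assms by (simp add: power2_le_iff_abs_le)
qed

section \<open>Multiplication by continuous functions\<close>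

lemma L2_mult_abs:
  assumes "continuous_on circle \<phi>" "sq_int f"
  shows "L2_mult \<phi> (abs_L2 f) = abs_L2 (\<lambda>z. \<phi> z * f z)"
proof -
  have "AE z in circ_measure. rep_L2 (abs_L2 f) z = f z"
    using abs_L2_eq_iff[OF sq_int_rep_L2 assms(2)] abs_rep_L2 by blast
  then have "AE z in circ_measure. \<phi> z * rep_L2 (abs_L2 f) z = \<phi> z * f z" by (rule AE_mp) auto
  then show ?thesis
    unfolding L2_mult_def using assms by (simp add: abs_L2_eq_iff sq_int_mult sq_int_rep_L2)
qed

lemma L2_mult_cong:
  assumes "continuous_on circle \<phi>" "\<And>z. z \<in> circle \<Longrightarrow> \<psi> z = \<phi> z"
  shows "L2_mult \<psi> u = L2_mult \<phi> u"
  unfolding L2_mult_def by (rule abs_L2_cong) (use assms in \<open>auto intro: sq_int_mult sq_int_rep_L2\<close>)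

lemma L2_mult_add: "continuous_on circle \<phi> \<Longrightarrow> L2_mult \<phi> (u + v) = L2_mult \<phi> u + L2_mult \<phi> v"
  by (cases u; cases v) (simp add: abs_L2_add L2_mult_abs sq_int_add sq_int_mult distrib_left)

lemma L2_mult_diff: "continuous_on circle \<phi> \<Longrightarrow> L2_mult \<phi> (u - v) = L2_mult \<phi> u - L2_mult \<phi> v"
  by (cases u; cases v) (simp add: abs_L2_diff L2_mult_abs sq_int_diff sq_int_mult right_diff_distrib)

lemma L2_mult_scaleC: "continuous_on circle \<phi> \<Longrightarrow> L2_mult \<phi> (c *\<^sub>C u) = c *\<^sub>C L2_mult \<phi> u"
  by (cases u) (simp add: abs_L2_scaleC L2_mult_abs sq_int_cmult sq_int_mult mult.left_commute)

lemma L2_mult_diff_fun: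
  "continuous_on circle \<phi> \<Longrightarrow> continuous_on circle \<psi> \<Longrightarrow> L2_mult (\<lambda>z. \<phi> z - \<psi> z) u = L2_mult \<phi> u - L2_mult \<psi> u"
  by (cases u) (simp add: abs_L2_diff L2_mult_abs sq_int_mult continuous_on_diff left_diff_distrib)

lemma L2_mult_mult:
  "continuous_on circle \<phi> \<Longrightarrow> continuous_on circle \<psi> \<Longrightarrow> L2_mult \<phi> (L2_mult \<psi> u) = L2_mult (\<lambda>z. \<phi> z * \<psi> z) u"
  by (cases u) (simp add: L2_mult_abs sq_int_mult continuous_on_mult mult.assoc)

lemma L2_mult_const: "L2_mult (\<lambda>_. c) u = c *\<^sub>C u"
  by (cases u) (simp add: L2_mult_abs abs_L2_scaleC)

lemma norm_L2_mult_le: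
  assumes "continuous_on circle \<phi>" "C \<ge> 0" "\<And>z. z \<in> circle \<Longrightarrow> cmod (\<phi> z) \<le> C"
  shows "norm (L2_mult \<phi> u) \<le> C * norm u"
proof (cases u)
  case (1 f)
  then show ?thesis
    using assms by (auto simp: L2_mult_abs norm_mult intro!: norm_abs_L2_le sq_int_mult mult_right_mono)
qed

section \<open>Absolutely continuous functions\<close>

lemma abs_cont_onD:
  assumes "abs_cont_on a b f" "e > 0"
  obtains d where "d > 0" "\<And>D. D division_of \<Union>D \<Longrightarrow> \<Union>D \<subseteq> {a..b} \<Longrightarrow> (\<Sum>k\<in>D. Sup k - Inf k) < d \<Longrightarrow>
     (\<Sum>k\<in>D. cmod (f (Sup k) - f (Inf k))) < e"
proof -
  from assms obtain d where "d > 0" "\<forall>D. D division_of \<Union>D \<and> \<Union>D \<subseteq> {a..b} \<and> (\<Sum>k\<in>D. Sup k - Inf k) < d \<longrightarrow>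
     (\<Sum>k\<in>D. cmod (f (Sup k) - f (Inf k))) < e" unfolding abs_cont_on_def by blast
  with that show thesis by blast
qed

lemma division_Sup_Inf_mem:
  assumes "D division_of \<Union>D" "k \<in> D"
  shows "Sup k \<in> k" "Inf k \<in> (k :: real set)" "Inf k \<le> Sup k"
proof -
  obtain u v where k: "k = cbox u v" "k \<noteq> {}"
    using division_ofD(3,4)[OF assms] by blast
  then show "Sup k \<in> k" "Inf k \<in> k" "Inf k \<le> Sup k" by auto
qed

text \<open>A comparison principle: increments of f over a division are dominated by those of g and
  h, so the smaller of their two moduli, each taken for \<open>e / (2 * C)\<close>, serves for f.
  Sums, products, conjugates and Lipschitz functions are all instances.\<close>

lemma abs_cont_on_domI:
  fixes f :: "real \<Rightarrow> complex"
  assumes g: "abs_cont_on a b g" and h: "abs_cont_on a b h" and C: "C > 0"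
    and le: "\<And>x y. x \<in> {a..b} \<Longrightarrow> y \<in> {a..b} \<Longrightarrow> cmod (f x - f y) \<le> C * (cmod (g x - g y) + cmod (h x - h y))"
  shows "abs_cont_on a b f"
  unfolding abs_cont_on_def
proof (intro allI impI)
  fix e :: real assume e: "e > 0"
  define e' where "e' = e / (2 * C)"
  have e': "e' > 0" using e C by (simp add: e'_def)
  obtain d1 where d1: "d1 > 0" "\<And>D. D division_of \<Union>D \<Longrightarrow> \<Union>D \<subseteq> {a..b} \<Longrightarrow> (\<Sum>k\<in>D. Sup k - Inf k) < d1 \<Longrightarrow>
     (\<Sum>k\<in>D. cmod (g (Sup k) - g (Inf k))) < e'" using abs_cont_onD[OF g e'] by blast
  obtain d2 where d2: "d2 > 0" "\<And>D. D division_of \<Union>D \<Longrightarrow> \<Union>D \<subseteq> {a..b} \<Longrightarrow> (\<Sum>k\<in>D. Sup k - Inf k) < d2 \<Longrightarrow>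
     (\<Sum>k\<in>D. cmod (h (Sup k) - h (Inf k))) < e'" using abs_cont_onD[OF h e'] by blast
  show "\<exists>d>0. \<forall>D. D division_of \<Union>D \<and> \<Union>D \<subseteq> {a..b} \<and> (\<Sum>k\<in>D. Sup k - Inf k) < d \<longrightarrow>
     (\<Sum>k\<in>D. cmod (f (Sup k) - f (Inf k))) < e"
  proof (intro exI[of _ "min d1 d2"] conjI allI impI; (elim conjE)?)
    fix D assume D: "D division_of \<Union>D" "\<Union>D \<subseteq> {a..b}" "(\<Sum>k\<in>D. Sup k - Inf k) < min d1 d2"
    have "(\<Sum>k\<in>D. cmod (f (Sup k) - f (Inf k)))
        \<le> (\<Sum>k\<in>D. C * (cmod (g (Sup k) - g (Inf k)) + cmod (h (Sup k) - h (Inf k))))"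
      by (intro sum_mono le) (use division_Sup_Inf_mem[OF D(1)] D(2) in blast)+
    also have "\<dots> = C * ((\<Sum>k\<in>D. cmod (g (Sup k) - g (Inf k))) + (\<Sum>k\<in>D. cmod (h (Sup k) - h (Inf k))))"
      by (simp add: sum_distrib_left sum.distrib distrib_left)
    also have "\<dots> < C * (e' + e')"
      using d1(2)[OF D(1,2)] d2(2)[OF D(1,2)] D(3) C by (intro mult_strict_left_mono add_strict_mono) auto
    also have "\<dots> = e" using C by (simp add: e'_def)
    finally show "(\<Sum>k\<in>D. cmod (f (Sup k) - f (Inf k))) < e" .
  qed (use d1 d2 in auto)
qed

lemma abs_cont_on_of_real: "abs_cont_on a b of_real"
  unfolding abs_cont_on_def
proof (intro allI impI)
  fix e :: real assume e: "e > 0"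
  have "(\<Sum>k\<in>D. cmod (of_real (Sup k) - of_real (Inf k))) < e"
    if "D division_of \<Union>D" "(\<Sum>k\<in>D. Sup k - Inf k) < e" for D
  proof -
    have "(\<Sum>k\<in>D. cmod (of_real (Sup k) - of_real (Inf k))) = (\<Sum>k\<in>D. Sup k - Inf k)"
      using division_Sup_Inf_mem(3)[OF that(1)] by (intro sum.cong) (auto simp flip: of_real_diff)
    then show ?thesis using that by simp
  qed
  then show "\<exists>d>0. \<forall>D. D division_of \<Union>D \<and> \<Union>D \<subseteq> {a..b} \<and> (\<Sum>k\<in>D. Sup k - Inf k) < d \<longrightarrow>
     (\<Sum>k\<in>D. cmod (of_real (Sup k) - of_real (Inf k))) < e" using e by blast
qed

text \<open>The identity serves as both comparison functions; \<open>\<bar>C\<bar> + 1\<close> is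
  positive whatever the sign of C.\<close>

lemma abs_cont_on_lipschitz:
  fixes f :: "real \<Rightarrow> complex"
  assumes "\<And>x y. x \<in> {a..b} \<Longrightarrow> y \<in> {a..b} \<Longrightarrow> cmod (f x - f y) \<le> C * \<bar>x - y\<bar>"
  shows "abs_cont_on a b f"
proof (rule abs_cont_on_domI[OF abs_cont_on_of_real abs_cont_on_of_real, of "\<bar>C\<bar> + 1"])
  fix x y assume xy: "x \<in> {a..b}" "y \<in> {a..b}"
  have "cmod (f x - f y) \<le> C * \<bar>x - y\<bar>" using assms[OF xy] .
  also have "\<dots> \<le> (\<bar>C\<bar> + 1) * (\<bar>x - y\<bar> + \<bar>x - y\<bar>)" by (intro mult_mono) auto
  finally show "cmod (f x - f y) \<le> (\<bar>C\<bar> + 1) * (cmod (of_real x - of_real y) + cmod (of_real x - of_real y))"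
    by (simp flip: of_real_diff)
qed simp

text \<open>A single interval between two nearby points is itself a division, so the modulus of
  absolute continuity is a modulus of uniform continuity.\<close>

lemma abs_cont_on_continuous:
  assumes "abs_cont_on a b f"
  shows "continuous_on {a..b} f"
  unfolding continuous_on_iff
proof (intro ballI allI impI)
  fix x e :: real assume x: "x \<in> {a..b}" and "e > 0"
  then obtain d where d: "d > 0" "\<And>D. D division_of \<Union>D \<Longrightarrow> \<Union>D \<subseteq> {a..b} \<Longrightarrow> (\<Sum>k\<in>D. Sup k - Inf k) < d \<Longrightarrow>
     (\<Sum>k\<in>D. cmod (f (Sup k) - f (Inf k))) < e" using abs_cont_onD[OF assms] by blast
  have main: "cmod (f v - f u) < e" if "u \<in> {a..b}" "v \<in> {a..b}" "u \<le> v" "v - u < d" for u v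
    using d(2)[of "{cbox u v}"] that division_of_self[of u v] by auto
  have "dist (f y) (f x) < e" if "y \<in> {a..b}" "dist y x < d" for y
    using main[of x y] main[of y x] x that by (cases "x \<le> y") (auto simp: dist_norm norm_minus_commute)
  then show "\<exists>d>0. \<forall>y\<in>{a..b}. dist y x < d \<longrightarrow> dist (f y) (f x) < e" using d(1) by blast
qed

lemma abs_cont_on_add:
  "abs_cont_on a b f \<Longrightarrow> abs_cont_on a b g \<Longrightarrow> abs_cont_on a b (\<lambda>t. f t + g t)"
  by (erule (1) abs_cont_on_domI[of _ _ _ _ 1])
     (auto intro: order_trans[OF norm_triangle_ineq] simp: add_diff_add)

lemma abs_cont_on_mult:
  assumes f: "abs_cont_on a b f" and g: "abs_cont_on a b g"
  shows "abs_cont_on a b (\<lambda>t. f t * g t)"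
proof -
  have "bounded (f ` {a..b})" "bounded (g ` {a..b})"
    using abs_cont_on_continuous[OF f] abs_cont_on_continuous[OF g]
    by (auto intro!: compact_imp_bounded compact_continuous_image)
  then obtain B1 B2 where B: "\<And>t. t \<in> {a..b} \<Longrightarrow> cmod (f t) \<le> B1" "\<And>t. t \<in> {a..b} \<Longrightarrow> cmod (g t) \<le> B2"
    unfolding bounded_iff by fast
  show ?thesis
  \<comment> \<open>The constant bounds both factors on the interval and stays positive whatever the
    signs of B1 and B2.\<close>
  proof (rule abs_cont_on_domI[OF f g, of "\<bar>B1\<bar> + \<bar>B2\<bar> + 1"])
    fix x y assume xy: "x \<in> {a..b}" "y \<in> {a..b}"
    have "f x * g x - f y * g y = (f x - f y) * g x + f y * (g x - g y)" by (simp add: algebra_simps)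
    also have "cmod \<dots> \<le> cmod (f x - f y) * cmod (g x) + cmod (f y) * cmod (g x - g y)"
      by (rule order_trans[OF norm_triangle_ineq]) (simp add: norm_mult)
    also have "\<dots> \<le> cmod (f x - f y) * (\<bar>B1\<bar> + \<bar>B2\<bar> + 1) + (\<bar>B1\<bar> + \<bar>B2\<bar> + 1) * cmod (g x - g y)"
      using B(2)[OF xy(1)] B(1)[OF xy(2)] by (intro add_mono mult_left_mono mult_right_mono) auto
    finally show "cmod (f x * g x - f y * g y) \<le> (\<bar>B1\<bar> + \<bar>B2\<bar> + 1) * (cmod (f x - f y) + cmod (g x - g y))"
      by (simp add: algebra_simps)
  qed simp
qed

lemma abs_cont_on_cnj: "abs_cont_on a b f \<Longrightarrow> abs_cont_on a b (\<lambda>t. cnj (f t))"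
  by (rule abs_cont_on_domI[of _ _ f f 1]) (auto simp flip: complex_cnj_diff)

text \<open>In the gauge below, intervals tagged in the exceptional null set lie in an open set of small
  measure, where absolute continuity controls the increments.\<close>
lemma fundamental_theorem_of_calculus_abs_cont:
  fixes f :: "real \<Rightarrow> complex"
  assumes ab: "a \<le> b" and ac: "abs_cont_on a b f" and N: "negligible N"
    and der: "\<And>x. x \<in> {a..b} - N \<Longrightarrow> (f has_vector_derivative g x) (at x within {a..b})"
  shows "(g has_integral (f b - f a)) {a..b}"
proof (rule has_integral_spike[OF N])
  \<comment> \<open>With the value 0 on N, an interval tagged in N contributes to the error exactly
    the increment of f, without a derivative term.\<close>
  define g0 where "g0 = (\<lambda>x. if x \<in> N then 0 else g x)"
  show "g x = g0 x" if "x \<in> {a..b} - N" for x using that by (simp add: g0_def)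
  show "(g0 has_integral (f b - f a)) {a..b}"
    unfolding has_integral_real
  proof (intro allI impI)
    fix e :: real assume e: "e > 0"
    \<comment> \<open>Slope tolerance: intervals tagged outside N contribute at most
      \<open>c * (b - a)\<close>, which is kept below e/2; the summand 1 covers the case a =
      b.\<close>
    define c where "c = e / (2 * (b - a + 1))"
    have c: "c > 0" using e ab by (simp add: c_def)
    have "c * (b - a) \<le> c * (b - a + 1)" using c by (intro mult_left_mono) auto
    also have "\<dots> = e / 2" using ab unfolding c_def by (subst times_divide_eq_left, subst divide_eq_eq) auto
    finally have c_le: "c * (b - a) \<le> e / 2" .
    have "\<forall>x. \<exists>d>0. x \<in> {a..b} - N \<longrightarrow>
         (\<forall>y\<in>{a..b}. norm (y - x) < d \<longrightarrow> norm (f y - f x - (y - x) *\<^sub>R g x) \<le> c * norm (y - x))"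
      using der[unfolded has_vector_derivative_def has_derivative_within_alt] c by blast
    then obtain r where r: "\<And>x. 0 < r x"
      "\<And>x y. \<lbrakk>x \<in> {a..b} - N; y \<in> {a..b}; norm (y - x) < r x\<rbrakk>
             \<Longrightarrow> norm (f y - f x - (y - x) *\<^sub>R g x) \<le> c * norm (y - x)"
      by metis
    obtain \<delta> where \<delta>: "\<delta> > 0" "\<And>D. D division_of \<Union>D \<Longrightarrow> \<Union>D \<subseteq> {a..b} \<Longrightarrow> (\<Sum>k\<in>D. Sup k - Inf k) < \<delta> \<Longrightarrow>
       (\<Sum>k\<in>D. cmod (f (Sup k) - f (Inf k))) < e / 2" using abs_cont_onD[OF ac half_gt_zero[OF e]] by blast
    obtain T where T: "open T" "N \<subseteq> T" "T - N \<in> lmeasurable" "emeasure lebesgue (T - N) < ennreal \<delta>"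
      using sets_lebesgue_outer_open[OF _ \<delta>(1), of N] N by (metis negligible_imp_sets)
    define \<gamma> where "\<gamma> = (\<lambda>x. if x \<in> N then T else ball x (r x))"
    have "gauge \<gamma>" unfolding gauge_def \<gamma>_def using T r(1) by auto
    moreover have "norm ((\<Sum>(x,K)\<in>p. measure lborel K *\<^sub>R g0 x) - (f b - f a)) < e"
      if p: "p tagged_division_of {a..b}" and fine: "\<gamma> fine p" for p
    proof -
      have fin: "finite p" by (rule tagged_division_of_finite[OF p])
      define p1 where "p1 = {xk \<in> p. fst xk \<in> N}"
      define err where "err = (\<lambda>(x,K). measure lborel K *\<^sub>R g0 x - (f (Sup K) - f (Inf K)))"
      have pK: "\<exists>u v. K = {u..v} \<and> u \<le> v \<and> x \<in> K \<and> K \<subseteq> {a..b}" if xK: "(x, K) \<in> p" for x K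
      proof -
        obtain u v where "K = cbox u v" using tagged_division_ofD(4)[OF p xK] by blast
        then show ?thesis using tagged_division_ofD(2,3)[OF p xK] by auto
      qed
      have "(\<Sum>(x,K)\<in>p. measure lborel K *\<^sub>R g0 x) - (f b - f a) = sum err p"
        unfolding additive_tagged_division_1[OF ab p, of f, symmetric] err_def
        by (simp add: sum_subtractf[symmetric] case_prod_unfold)
      also have "sum err p = sum err p1 + sum err (p - p1)"
        using sum.subset_diff[of p1 p err] fin by (simp add: p1_def)
      also have "norm \<dots> \<le> (\<Sum>xk\<in>p1. norm (err xk)) + (\<Sum>xk\<in>p - p1. norm (err xk))"
        by (intro order_trans[OF norm_triangle_ineq] add_mono norm_sum)
      also have "\<dots> < e / 2 + e / 2"
      proof (rule add_less_le_mono)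
        have "(\<Sum>xk\<in>p - p1. norm (err xk)) \<le> (\<Sum>(x,K)\<in>p - p1. c * (Sup K - Inf K))"
        proof (intro sum_mono, clarify)
          fix x K assume xK: "(x, K) \<in> p" "(x, K) \<notin> p1"
          then obtain u v where uv: "K = {u..v}" "u \<le> v" "x \<in> K" "K \<subseteq> {a..b}" using pK by blast
          have xN: "x \<notin> N" using xK by (simp add: p1_def)
          have "K \<subseteq> ball x (r x)" using fineD[OF fine xK(1)] xN by (simp add: \<gamma>_def)
          moreover have "u \<in> K" "v \<in> K" using uv by auto
          ultimately have near: "norm (u - x) < r x" "norm (v - x) < r x"
            by (auto simp: subset_iff dist_real_def abs_minus_commute)
          \<comment> \<open>Straddle estimate: the tag x lies between u and v, so the linearisation
            errors at the two end points add up to a multiple of \<open>v - u\<close>.\<close>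
          have "err (x, K) = (f u - f x - (u - x) *\<^sub>R g x) - (f v - f x - (v - x) *\<^sub>R g x)"
            using uv xN by (simp add: err_def g0_def algebra_simps)
          also have "norm \<dots> \<le> norm (f u - f x - (u - x) *\<^sub>R g x) + norm (f v - f x - (v - x) *\<^sub>R g x)"
            by (rule norm_triangle_ineq4)
          also have "\<dots> \<le> c * norm (u - x) + c * norm (v - x)"
            using near uv xN by (intro add_mono r(2)) auto
          also have "\<dots> = c * (Sup K - Inf K)" using uv by (simp add: algebra_simps)
          finally show "norm (err (x, K)) \<le> c * (Sup K - Inf K)" .
        qed
        also have "\<dots> \<le> (\<Sum>(x,K)\<in>p. c * (Sup K - Inf K))"
        proof (rule sum_mono2[OF fin])
          fix xK assume "xK \<in> p - (p - p1)"
          then obtain x K where "xK = (x, K)" "(x, K) \<in> p" by (cases xK) auto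
          moreover from pK[OF this(2)] obtain u v where "K = {u..v}" "u \<le> v" by blast
          ultimately show "0 \<le> (case xK of (x, K) \<Rightarrow> c * (Sup K - Inf K))" using c by simp
        qed simp
        also have "\<dots> = c * (b - a)"
          using additive_tagged_division_1[OF ab p, of "\<lambda>x. x"] by (simp add: sum_distrib_left[symmetric] case_prod_unfold)
        finally show "(\<Sum>xk\<in>p - p1. norm (err xk)) \<le> e / 2" using c_le by linarith
      next
        have p1: "p1 tagged_division_of \<Union>(snd ` p1)"
        proof (rule tagged_partial_division_of_Union_self)
          show "p1 tagged_partial_division_of {a..b}"
            using p by (intro tagged_partial_division_subset[of p "{a..b}" p1])
              (auto simp: p1_def tagged_division_of_def)
        qed
        define D where "D = snd ` p1"
        have D: "D division_of \<Union>D" unfolding D_def by (rule division_of_tagged_division[OF p1])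
        have DK: "\<exists>x. (x, K) \<in> p \<and> x \<in> N" if "K \<in> D" for K
          using that unfolding D_def p1_def by (auto simp: image_iff)
        have Dab: "\<Union>D \<subseteq> {a..b}"
        proof (rule Union_least)
          fix K assume "K \<in> D"
          then show "K \<subseteq> {a..b}" using DK pK by blast
        qed
        have DT: "\<Union>D \<subseteq> T"
        proof (rule Union_least)
          fix K assume "K \<in> D"
          then obtain x where "(x, K) \<in> p" "x \<in> N" using DK by blast
          then show "K \<subseteq> T" using fineD[OF fine, of x K] by (simp add: \<gamma>_def)
        qed
        \<comment> \<open>The increment, forced to 0 on the empty set: passing from tagged intervals
          to the division D requires a function that vanishes on all degenerate boxes, the empty one
          included.\<close>
        define d where "d = (\<lambda>K::real set. if K = {} then 0 else cmod (f (Sup K) - f (Inf K)))"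
        have "(\<Sum>xk\<in>p1. norm (err xk)) = (\<Sum>(x,K)\<in>p1. d K)"
        proof (rule sum.cong, simp, clarify)
          fix x K assume "(x, K) \<in> p1"
          then have "x \<in> N" "K \<noteq> {}" using pK[of x K] by (auto simp: p1_def)
          then show "norm (err (x, K)) = d K" by (simp add: err_def g0_def d_def norm_minus_commute)
        qed
        also have "\<dots> = sum d D"
          unfolding D_def
        proof (rule sum.over_tagged_division_lemma[OF p1])
          fix u v :: real assume "box u v = {}"
          then have "u \<ge> v" by (simp add: box_real)
          then have "cbox u v = {} \<or> cbox u v = {u}" by (cases "u = v") auto
          then show "d (cbox u v) = 0" by (auto simp: d_def)
        qed
        also have "\<dots> = (\<Sum>K\<in>D. cmod (f (Sup K) - f (Inf K)))"
          using division_ofD(3)[OF D] by (intro sum.cong) (auto simp: d_def)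
        also have "\<dots> < e / 2"
        proof (rule \<delta>(2)[OF D Dab])
          have "(\<Sum>K\<in>D. Sup K - Inf K) = (\<Sum>K\<in>D. measure lebesgue K)"
          proof (rule sum.cong)
            fix K assume K: "K \<in> D"
            then obtain u v where "K = {u..v}" "u \<le> v" using DK pK by blast
            then show "Sup K - Inf K = measure lebesgue K" by simp
          qed simp
          also have "\<dots> = measure lebesgue (\<Union>D)" by (rule content_division[OF D])
          \<comment> \<open>Discarding the null set is harmless for the measure and brings in
            \<open>T - N\<close>, the set whose measure was made smaller than \<delta>.\<close>
          also have "\<dots> = measure lebesgue (\<Union>D - N)"
            using measure_Diff_null_set[of "\<Union>D" lebesgue N] fmeasurableD[OF lmeasurable_division[OF D]] N
            unfolding negligible_iff_null_sets by metis
          also have "\<dots> \<le> measure lebesgue (T - N)"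
          proof (rule measure_mono_fmeasurable[OF _ _ T(3)])
            show "\<Union>D - N \<in> sets lebesgue"
              using fmeasurableD[OF lmeasurable_division[OF D]] negligible_imp_sets[OF N] by (rule sets.Diff)
          qed (use DT in blast)
          also have "\<dots> < \<delta>"
            using T(4) \<delta>(1) unfolding emeasure_eq_measure2[OF T(3)]
            by (subst (asm) ennreal_less_iff) auto
          finally show "(\<Sum>K\<in>D. Sup K - Inf K) < \<delta>" .
        qed
        finally show "(\<Sum>xk\<in>p1. norm (err xk)) < e / 2" .
      qed
      finally show ?thesis by simp
    qed
    ultimately show "\<exists>\<gamma>. gauge \<gamma> \<and> (\<forall>p. p tagged_division_of {a..b} \<and> \<gamma> fine p \<longrightarrow>
        norm ((\<Sum>(x,k)\<in>p. measure lborel k *\<^sub>R g0 x) - (f b - f a)) < e)"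
      by (intro exI[of _ \<gamma>] conjI allI impI; (elim conjE)?)
  qed
qed

section \<open>The Sobolev space and integration by parts\<close>

lemma circle_param_ex:
  assumes "z \<in> circle"
  obtains t where "t \<in> {0..<1}" "z = cis (2 * pi * t)"
proof
  show "Arg2pi z / (2 * pi) \<in> {0..<1}" using Arg2pi_ge_0[of z] Arg2pi_lt_2pi[of z] by auto
  show "z = cis (2 * pi * (Arg2pi z / (2 * pi)))" using Arg2pi_eq[of z] assms by (simp add: cis_conv_exp)
qed

lemma AE_circ_measure_negligible:
  assumes "AE z in circ_measure. P z"
  obtains N where "negligible N" "\<And>t. t \<in> {0..1} - N \<Longrightarrow> P (cis (2 * pi * t))"
proof -
  have "AE t in lebesgue. t \<in> {0..<1} \<longrightarrow> P (cis (2 * pi * t))"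
    using AE_completion[OF AE_circ_measure_param[OF assms]] .
  then obtain N where "negligible N" "{t. \<not> (t \<in> {0..<1} \<longrightarrow> P (cis (2 * pi * t)))} \<subseteq> N"
    unfolding eventually_ae_filter_negligible by blast
  then show thesis by (intro that[of "insert 1 N"]) force+
qed

text \<open>The parameters in ]0,1[ at which two continuous representatives differ form an open
  negligible set, hence none exist; the end points follow by continuity. A class in H^1 thus has a
  single absolutely continuous representative on the circle.\<close>

lemma abs_cont_circle_AE_eq:
  assumes f: "abs_cont_on 0 1 (\<lambda>t. f (cis (2 * pi * t)))" and g: "abs_cont_on 0 1 (\<lambda>t. g (cis (2 * pi * t)))"
    and AE: "AE z in circ_measure. f z = g z" and z: "z \<in> circle"
  shows "f z = g z"
proof -
  define F where "F = (\<lambda>t. f (cis (2 * pi * t)) - g (cis (2 * pi * t)))"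
  have cont: "continuous_on {0..1} F"
    unfolding F_def by (intro continuous_intros abs_cont_on_continuous f g)
  obtain N where N: "negligible N" "\<And>t. t \<in> {0..1} - N \<Longrightarrow> F t = 0"
    using AE_circ_measure_negligible[OF AE] unfolding F_def by auto
  have "open ({0<..<1} \<inter> F -` (- {0}))"
    by (rule continuous_open_preimage[OF continuous_on_subset[OF cont]]) auto
  moreover have "negligible ({0<..<1} \<inter> F -` (- {0}))"
    by (rule negligible_subset[OF N(1)]) (use N(2) in force)
  ultimately have "{0<..<1} \<inter> F -` (- {0}) = {}" using open_not_negligible by blast
  then have "\<And>t. t \<in> {0<..<1} \<Longrightarrow> F t = 0" by blast
  moreover have cl: "closure {0<..<1::real} = {0..1}" by simp
  ultimately have "F t = 0" if "t \<in> {0..1}" for t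
    using continuous_constant_on_closure[of "{0<..<1}" F 0 t] cont that unfolding cl by blast
  moreover obtain t where "t \<in> {0..<1}" "z = cis (2 * pi * t)" using circle_param_ex[OF z] .
  ultimately show ?thesis unfolding F_def by fastforce
qed

lemma H1_derivE:
  assumes "H1_deriv u v"
  obtains f g where "sq_int f" "sq_int g" "u = abs_L2 f" "v = abs_L2 g"
    "abs_cont_on 0 1 (\<lambda>t. f (cis (2 * pi * t)))"
    "AE z in circ_measure. (f has_field_derivative g z) (at z within circle)"
  using assms unfolding H1_deriv_def by (elim exE conjE) (rule that)

lemma H1_derivI:
  assumes "sq_int f" "sq_int g" "abs_cont_on 0 1 (\<lambda>t. f (cis (2 * pi * t)))"
    and "AE z in circ_measure. (f has_field_derivative g z) (at z within circle)"
  shows "H1_deriv (abs_L2 f) (abs_L2 g)"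
  unfolding H1_deriv_def using assms by blast

text \<open>As the absolutely continuous representative is unique on the circle, so is its
  derivative almost everywhere. This justifies the \<open>THE\<close> in
  \<open>L2_deriv\<close>.\<close>

lemma H1_deriv_unique:
  assumes "H1_deriv u v" "H1_deriv u w"
  shows "v = w"
proof -
  obtain f g where 1: "sq_int f" "sq_int g" "u = abs_L2 f" "v = abs_L2 g"
    "abs_cont_on 0 1 (\<lambda>t. f (cis (2 * pi * t)))"
    "AE z in circ_measure. (f has_field_derivative g z) (at z within circle)"
    by (rule H1_derivE[OF assms(1)])
  obtain f' g' where 2: "sq_int f'" "sq_int g'" "u = abs_L2 f'" "w = abs_L2 g'"
    "abs_cont_on 0 1 (\<lambda>t. f' (cis (2 * pi * t)))"
    "AE z in circ_measure. (f' has_field_derivative g' z) (at z within circle)"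
    by (rule H1_derivE[OF assms(2)])
  have ae: "AE z in circ_measure. f z = f' z" using iffD1[OF abs_L2_eq_iff[OF 1(1) 2(1)] trans[OF 1(3)[symmetric] 2(3)]] .
  have eq: "f' z = f z" if "z \<in> circle" for z
    by (rule abs_cont_circle_AE_eq[OF 1(5) 2(5) ae that, symmetric])
  have "AE z in circ_measure. z \<in> circle" by (rule AE_I2) simp
  then have "AE z in circ_measure. g z = g' z"
    using 1(6) 2(6)
  proof eventually_elim
    fix z assume z: "z \<in> circle" "(f has_field_derivative g z) (at z within circle)"
      "(f' has_field_derivative g' z) (at z within circle)"
    show "g z = g' z"
      using circle_deriv_unique[OF circle_deriv_cong[OF z(2,1) eq] z(3,1)] .
  qed
  then show ?thesis unfolding 1(4) 2(4) by (rule iffD2[OF abs_L2_eq_iff[OF 1(2) 2(2)]])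
qed

lemma L2_deriv_eq: "H1_deriv u v \<Longrightarrow> L2_deriv u = v"
  unfolding L2_deriv_def using H1_deriv_unique by blast

lemma H1_deriv_L2_deriv: "u \<in> H1 \<Longrightarrow> H1_deriv u (L2_deriv u)"
  unfolding H1_def using L2_deriv_eq by auto

text \<open>By the mean value inequality the function is Lipschitz in the angle; the factor
  \<open>2 * pi\<close> is the speed of the parametrisation.\<close>

lemma abs_cont_on_circle_C1:
  assumes "\<phi> \<in> circle_C1"
  shows "abs_cont_on a b (\<lambda>t. \<phi> (cis (2 * pi * t)))"
proof -
  obtain C where C: "C \<ge> 0" "\<And>z. z \<in> circle \<Longrightarrow> cmod (circ_deriv \<phi> z) \<le> C"
    using continuous_on_circle_bounded[OF circle_C1_continuous_deriv[OF assms]] by blast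
  define F where "F = (\<lambda>t. 2 * pi * \<i> * cis (2 * pi * t) * circ_deriv \<phi> (cis (2 * pi * t)))"
  have F: "((\<lambda>t. \<phi> (cis (2 * pi * t))) has_vector_derivative F t) (at t)" for t
    unfolding F_def by (rule has_vector_derivative_circleD[OF circle_C1_has_deriv[OF assms]]) simp
  have FC: "cmod (F t) \<le> 2 * pi * C" for t
    using C(2)[of "cis (2 * pi * t)"] by (simp add: F_def norm_mult)
  show ?thesis
  proof (rule abs_cont_on_lipschitz)
    fix x y
    have "norm (\<phi> (cis (2 * pi * x)) - \<phi> (cis (2 * pi * y))) \<le> 2 * pi * C * norm (x - y)"
    proof (rule differentiable_bound[of UNIV _ "\<lambda>t h. h *\<^sub>R F t"])
      show "onorm (\<lambda>h. h *\<^sub>R F t) \<le> 2 * pi * C" for t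
        by (rule onorm_le) (use FC[of t] in \<open>auto intro!: mult_left_mono simp: mult.commute\<close>)
    qed (use F in \<open>auto simp: has_vector_derivative_def\<close>)
    then show "cmod (\<phi> (cis (2 * pi * x)) - \<phi> (cis (2 * pi * y))) \<le> 2 * pi * C * \<bar>x - y\<bar>" by simp
  qed
qed

lemma H1_deriv_circle_C1:
  assumes "\<phi> \<in> circle_C1"
  shows "H1_deriv (abs_L2 \<phi>) (abs_L2 (circ_deriv \<phi>))"
  by (intro H1_derivI AE_I2)
     (use assms in \<open>auto intro!: circle_C1_has_deriv abs_cont_on_circle_C1 sq_int_continuous
        intro: circle_C1_continuous_deriv circle_C1_continuous\<close>)

lemma H1_deriv_add:
  assumes "H1_deriv u u'" "H1_deriv v v'"
  shows "H1_deriv (u + v) (u' + v')"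
proof -
  obtain f g where 1: "sq_int f" "sq_int g" "u = abs_L2 f" "u' = abs_L2 g"
    "abs_cont_on 0 1 (\<lambda>t. f (cis (2 * pi * t)))"
    "AE z in circ_measure. (f has_field_derivative g z) (at z within circle)"
    by (rule H1_derivE[OF assms(1)])
  obtain p q where 2: "sq_int p" "sq_int q" "v = abs_L2 p" "v' = abs_L2 q"
    "abs_cont_on 0 1 (\<lambda>t. p (cis (2 * pi * t)))"
    "AE z in circ_measure. (p has_field_derivative q z) (at z within circle)"
    by (rule H1_derivE[OF assms(2)])
  have "AE z in circ_measure. ((\<lambda>z. f z + p z) has_field_derivative g z + q z) (at z within circle)"
    using 1(6) 2(6) by eventually_elim (rule DERIV_add)
  then show ?thesis
    unfolding 1(3,4) 2(3,4) abs_L2_add[OF 1(1) 2(1)] abs_L2_add[OF 1(2) 2(2)]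
    by (intro H1_derivI sq_int_add abs_cont_on_add 1(1,2,5) 2(1,2,5))
qed

lemma H1_deriv_mult:
  assumes \<phi>: "\<phi> \<in> circle_C1" and u: "H1_deriv u u'"
  shows "H1_deriv (L2_mult \<phi> u) (L2_mult \<phi> u' + L2_mult (circ_deriv \<phi>) u)"
proof -
  obtain f g where 1: "sq_int f" "sq_int g" "u = abs_L2 f" "u' = abs_L2 g"
    "abs_cont_on 0 1 (\<lambda>t. f (cis (2 * pi * t)))"
    "AE z in circ_measure. (f has_field_derivative g z) (at z within circle)"
    by (rule H1_derivE[OF u])
  have c: "continuous_on circle \<phi>" "continuous_on circle (circ_deriv \<phi>)"
    using \<phi> circle_C1_continuous circle_C1_continuous_deriv by blast+
  have "AE z in circ_measure. z \<in> circle" by (rule AE_I2) simp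
  then have "AE z in circ_measure. ((\<lambda>z. \<phi> z * f z) has_field_derivative \<phi> z * g z + circ_deriv \<phi> z * f z) (at z within circle)"
    using 1(6)
  proof eventually_elim
    fix z assume "z \<in> circle" "(f has_field_derivative g z) (at z within circle)"
    then show "((\<lambda>z. \<phi> z * f z) has_field_derivative \<phi> z * g z + circ_deriv \<phi> z * f z) (at z within circle)"
      using DERIV_mult[OF circle_C1_has_deriv[OF \<phi>]] by (fastforce simp: algebra_simps)
  qed
  then show ?thesis
    unfolding 1(3,4) L2_mult_abs[OF c(1) 1(1)] L2_mult_abs[OF c(1) 1(2)] L2_mult_abs[OF c(2) 1(1)]
      abs_L2_add[OF sq_int_mult[OF c(1) 1(2)] sq_int_mult[OF c(2) 1(1)]]
    by (intro H1_derivI sq_int_add sq_int_mult abs_cont_on_mult abs_cont_on_circle_C1 \<phi> c 1(1,2,5))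
qed

lemma circ_deriv_const: "z \<in> circle \<Longrightarrow> circ_deriv (\<lambda>_. c) z = 0"
  by (rule circ_deriv_eq) auto

lemma H1_deriv_scaleC:
  assumes "H1_deriv u u'"
  shows "H1_deriv (c *\<^sub>C u) (c *\<^sub>C u')"
proof -
  have "L2_mult (circ_deriv (\<lambda>_. c)) u = L2_mult (\<lambda>_. 0) u"
    by (rule L2_mult_cong) (auto simp: circ_deriv_const)
  also have "\<dots> = 0" by (cases u) (simp add: L2_mult_abs abs_L2_zero)
  finally show ?thesis
    using H1_deriv_mult[OF circle_C1_const assms, of c] by (simp add: L2_mult_const)
qed

lemma H1_add: "u \<in> H1 \<Longrightarrow> v \<in> H1 \<Longrightarrow> u + v \<in> H1"
  unfolding H1_def using H1_deriv_add by blast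

lemma H1_scaleC: "u \<in> H1 \<Longrightarrow> c *\<^sub>C u \<in> H1"
  unfolding H1_def using H1_deriv_scaleC by blast

lemma H1_mult: "\<phi> \<in> circle_C1 \<Longrightarrow> u \<in> H1 \<Longrightarrow> L2_mult \<phi> u \<in> H1"
  unfolding H1_def using H1_deriv_mult by blast

lemma H1_circle_C1: "\<phi> \<in> circle_C1 \<Longrightarrow> abs_L2 \<phi> \<in> H1"
  unfolding H1_def using H1_deriv_circle_C1 by blast

lemma H1_zero: "0 \<in> H1"
  using H1_circle_C1[OF circle_C1_const, of 0] by (simp add: abs_L2_zero)

lemma H1_sum: "(\<And>i. i \<in> I \<Longrightarrow> x i \<in> H1) \<Longrightarrow> sum x I \<in> H1"
  by (induction I rule: infinite_finite_induct) (auto simp: H1_zero H1_add)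

lemma L2_deriv_add: "u \<in> H1 \<Longrightarrow> v \<in> H1 \<Longrightarrow> L2_deriv (u + v) = L2_deriv u + L2_deriv v"
  using H1_deriv_add[OF H1_deriv_L2_deriv H1_deriv_L2_deriv] by (rule L2_deriv_eq)

lemma L2_deriv_zero: "L2_deriv 0 = 0"
  using L2_deriv_add[OF H1_zero H1_zero] by simp

lemma L2_deriv_mult:
  "\<phi> \<in> circle_C1 \<Longrightarrow> u \<in> H1 \<Longrightarrow> L2_deriv (L2_mult \<phi> u) = L2_mult \<phi> (L2_deriv u) + L2_mult (circ_deriv \<phi>) u"
  using H1_deriv_mult[OF _ H1_deriv_L2_deriv] by (blast intro: L2_deriv_eq)

text \<open>Integration by parts: with \<open>z = exp(2\<pi>\<i>t)\<close> the operator \<open>\<i> z d/dz\<close> is \<open>(2\<pi>)\<^sup>-\<^sup>1 d/dt\<close>.\<close>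
lemma cinner_circle_deriv:
  assumes "H1_deriv u u'" "H1_deriv v v'"
  shows "cinner ((- \<i>) *\<^sub>C L2_mult (\<lambda>z. z) v') u = cinner v (\<i> *\<^sub>C L2_mult (\<lambda>z. z) u')"
proof -
  obtain f g where 1: "sq_int f" "sq_int g" "u = abs_L2 f" "u' = abs_L2 g"
    "abs_cont_on 0 1 (\<lambda>t. f (cis (2 * pi * t)))"
    "AE z in circ_measure. (f has_field_derivative g z) (at z within circle)"
    by (rule H1_derivE[OF assms(1)])
  obtain p q where 2: "sq_int p" "sq_int q" "v = abs_L2 p" "v' = abs_L2 q"
    "abs_cont_on 0 1 (\<lambda>t. p (cis (2 * pi * t)))"
    "AE z in circ_measure. (p has_field_derivative q z) (at z within circle)"
    by (rule H1_derivE[OF assms(2)])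
  let ?l = "\<lambda>z. cnj (- \<i> * (z * q z)) * f z" and ?r = "\<lambda>z. cnj (p z) * (\<i> * (z * g z))"
  have id: "continuous_on circle (\<lambda>z. z)" by (rule continuous_on_id)
  have sq: "sq_int (\<lambda>z. - \<i> * (z * q z))" "sq_int (\<lambda>z. \<i> * (z * g z))"
    using sq_int_cmult[OF sq_int_mult[OF id 2(2)]] sq_int_cmult[OF sq_int_mult[OF id 1(2)]] by blast+
  have il: "integrable circ_measure ?l" by (rule sq_int_cnj_mult[OF sq(1) 1(1)])
  have ir: "integrable circ_measure ?r" by (rule sq_int_cnj_mult[OF 2(1) sq(2)])
  have L: "cinner ((- \<i>) *\<^sub>C L2_mult (\<lambda>z. z) v') u = (\<integral>z. ?l z \<partial>circ_measure)"
    unfolding 1(3) 2(4) L2_mult_abs[OF id 2(2)] abs_L2_scaleC[OF sq_int_mult[OF id 2(2)]]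
    by (rule cinner_L2[OF sq(1) 1(1)])
  have R: "cinner v (\<i> *\<^sub>C L2_mult (\<lambda>z. z) u') = (\<integral>z. ?r z \<partial>circ_measure)"
    unfolding 2(3) 1(4) L2_mult_abs[OF id 1(2)] abs_L2_scaleC[OF sq_int_mult[OF id 1(2)]]
    by (rule cinner_L2[OF 2(1) sq(2)])
  define H where "H = (\<lambda>t. cnj (p (cis (2 * pi * t))) * f (cis (2 * pi * t)))"
  define H' where "H' = (\<lambda>t. 2 * pi * (?r (cis (2 * pi * t)) - ?l (cis (2 * pi * t))))"
  obtain N where N: "negligible N"
    "\<And>t. t \<in> {0..1} - N \<Longrightarrow> (f has_field_derivative g (cis (2 * pi * t))) (at (cis (2 * pi * t)) within circle) \<and>
      (p has_field_derivative q (cis (2 * pi * t))) (at (cis (2 * pi * t)) within circle)"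
  proof (rule AE_circ_measure_negligible)
    show "AE z in circ_measure. (f has_field_derivative g z) (at z within circle) \<and>
      (p has_field_derivative q z) (at z within circle)" using 1(6) 2(6) by (rule AE_conjI)
  qed (rule that, assumption+)
  \<comment> \<open>Conjugation changes the sign of i in the derivative of p. This is why the formal
    adjoint carries \<open>- \<i>\<close>; the integral of the whole expression then vanishes by
    periodicity.\<close>
  have deriv_eq: "cnj P * (2 * pi * \<i> * w * G) + cnj (2 * pi * \<i> * w * Q) * F
      = 2 * pi * (cnj P * (\<i> * (w * G)) - cnj (- \<i> * (w * Q)) * F)" for P w G Q F
    by (simp add: algebra_simps)
  have "(H' has_integral (H 1 - H 0)) {0..1}"
  proof (rule fundamental_theorem_of_calculus_abs_cont[OF _ _ N(1)])
    show "abs_cont_on 0 1 H" unfolding H_def by (intro abs_cont_on_mult abs_cont_on_cnj 1(5) 2(5))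
  next
    fix t assume t: "t \<in> {0..1} - N"
    note has_vector_derivative_circleD[OF conjunct1[OF N(2)[OF t]]]
      has_vector_derivative_circleD[OF conjunct2[OF N(2)[OF t]]]
    then have "(H has_vector_derivative
        cnj (p (cis (2 * pi * t))) * (2 * pi * \<i> * cis (2 * pi * t) * g (cis (2 * pi * t))) +
        cnj (2 * pi * \<i> * cis (2 * pi * t) * q (cis (2 * pi * t))) * f (cis (2 * pi * t))) (at t)"
      unfolding H_def by (intro has_vector_derivative_mult bounded_linear.has_vector_derivative[OF bounded_linear_cnj])
    then show "(H has_vector_derivative H' t) (at t within {0..1})"
      unfolding deriv_eq H'_def by (rule has_vector_derivative_at_within)
  qed simp
  moreover have "H 1 = H 0" by (simp add: H_def cis_2pi)
  moreover have "(H' has_integral 2 * pi * ((\<integral>z. ?r z \<partial>circ_measure) - (\<integral>z. ?l z \<partial>circ_measure))) {0..1}"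
    unfolding H'_def
    by (rule has_integral_mult_right[OF has_integral_diff[OF circ_integral_param[OF ir] circ_integral_param[OF il]]])
  ultimately have "2 * pi * ((\<integral>z. ?r z \<partial>circ_measure) - (\<integral>z. ?l z \<partial>circ_measure)) = H 1 - H 0"
    by (intro has_integral_unique[of H' _ "{0..1}"])
  then show ?thesis using \<open>H 1 = H 0\<close> unfolding L R by simp
qed

section \<open>Density and the adjoint\<close>

text \<open>Dominated convergence for the squared distance: the limit inherits the bound by g, so
  the difference is at most twice |g|, whence the majorant with factor 4.\<close>

lemma L2_tendsto_dominated:
  assumes f: "sq_int f" and g: "sq_int g" and F: "\<And>i. F i \<in> borel_measurable circ_measure"
    and bound: "\<And>i z. z \<in> circle \<Longrightarrow> cmod (F i z) \<le> cmod (g z)"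
    and lim: "\<And>z. z \<in> circle \<Longrightarrow> (\<lambda>i. F i z) \<longlonglongrightarrow> f z"
  shows "(\<lambda>i. abs_L2 (F i)) \<longlonglongrightarrow> abs_L2 f"
proof -
  have [measurable]: "f \<in> borel_measurable circ_measure" "g \<in> borel_measurable circ_measure"
    using f g by (auto simp: sq_int_def)
  note F[measurable]
  have Fsq: "sq_int (F i)" for i
  proof -
    have "integrable circ_measure (\<lambda>z. (cmod (g z))\<^sup>2)" using g by (simp add: sq_int_def)
    then have "integrable circ_measure (\<lambda>z. (cmod (F i z))\<^sup>2)"
      by (rule Bochner_Integration.integrable_bound) (use bound in \<open>auto intro!: AE_I2 power_mono\<close>)
    then show ?thesis using F by (simp add: sq_int_def)
  qed
  have fg: "cmod (f z) \<le> cmod (g z)" if "z \<in> circle" for z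
    using tendsto_upperbound[OF tendsto_norm[OF lim[OF that]], of "cmod (g z)"] bound[OF that] by simp
  have "(\<lambda>i. \<integral>z. (cmod (F i z - f z))\<^sup>2 \<partial>circ_measure) \<longlonglongrightarrow> (\<integral>z. 0 \<partial>circ_measure)"
  proof (rule integral_dominated_convergence)
    show "integrable circ_measure (\<lambda>z. 4 * (cmod (g z))\<^sup>2)" using g by (simp add: sq_int_def)
    show "AE z in circ_measure. (\<lambda>i. (cmod (F i z - f z))\<^sup>2) \<longlonglongrightarrow> 0"
    proof (rule AE_I2)
      fix z assume "z \<in> space circ_measure"
      then have "(\<lambda>i. F i z) \<longlonglongrightarrow> f z" using lim by simp
      then have "(\<lambda>i. (cmod (F i z - f z))\<^sup>2) \<longlonglongrightarrow> (cmod (f z - f z))\<^sup>2"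
        by (intro tendsto_intros)
      then show "(\<lambda>i. (cmod (F i z - f z))\<^sup>2) \<longlonglongrightarrow> 0" by simp
    qed
    show "AE z in circ_measure. norm ((cmod (F i z - f z))\<^sup>2) \<le> 4 * (cmod (g z))\<^sup>2" for i
    proof (rule AE_I2)
      fix z assume "z \<in> space circ_measure"
      then have z: "z \<in> circle" by simp
      have "cmod (F i z - f z) \<le> 2 * cmod (g z)"
        using norm_triangle_ineq4[of "F i z" "f z"] bound[OF z, of i] fg[OF z] by linarith
      from power_mono[OF this, of 2] show "norm ((cmod (F i z - f z))\<^sup>2) \<le> 4 * (cmod (g z))\<^sup>2"
        by (simp add: power_mult_distrib)
    qed
  qed auto
  moreover have "(\<integral>z. (cmod (F i z - f z))\<^sup>2 \<partial>circ_measure) = (norm (abs_L2 (F i) - abs_L2 f))\<^sup>2" for i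
    unfolding abs_L2_diff[OF Fsq f] norm_abs_L2[OF sq_int_diff[OF Fsq f]] ..
  ultimately have "(\<lambda>i. (norm (abs_L2 (F i) - abs_L2 f))\<^sup>2) \<longlonglongrightarrow> 0" by simp
  then have "(\<lambda>i. sqrt ((norm (abs_L2 (F i) - abs_L2 f))\<^sup>2)) \<longlonglongrightarrow> sqrt 0" by (rule tendsto_real_sqrt)
  then show ?thesis by (simp add: LIM_zero_iff tendsto_norm_zero_iff)
qed

section \<open>Density of H^1 in L^2 of the circle\<close>

lemma closure_H1_lim:
  assumes "\<And>i. x i \<in> closure H1" "x \<longlonglongrightarrow> y"
  shows "y \<in> closure H1"
  using closed_sequentially[OF closed_closure assms] .

lemma closure_H1_add:
  assumes "x \<in> closure H1" "y \<in> closure H1"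
  shows "x + y \<in> closure H1"
proof -
  obtain a b where "\<And>i. a i \<in> H1" "a \<longlonglongrightarrow> x" "\<And>i. b i \<in> H1" "b \<longlonglongrightarrow> y"
    using assms unfolding closure_sequential by blast
  then show ?thesis
    unfolding closure_sequential
    by (intro exI[of _ "\<lambda>i. a i + b i"]) (auto intro: H1_add tendsto_add)
qed

lemma tendsto_scaleC:
  fixes x :: "'a::complex_normed"
  assumes "(a \<longlongrightarrow> x) F"
  shows "((\<lambda>i. c *\<^sub>C a i) \<longlongrightarrow> c *\<^sub>C x) F"
proof -
  have d: "c *\<^sub>C u - c *\<^sub>C v = c *\<^sub>C (u - v)" for u v :: 'a
    using scaleC_add_right[of c "u - v" v] by simp
  have "((\<lambda>i. cmod c * norm (a i - x)) \<longlongrightarrow> cmod c * 0) F"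
    using assms by (intro tendsto_mult tendsto_const) (simp add: LIM_zero_iff tendsto_norm_zero_iff)
  then have "((\<lambda>i. norm (c *\<^sub>C a i - c *\<^sub>C x)) \<longlongrightarrow> 0) F" by (simp add: d norm_scaleC)
  then show ?thesis by (simp add: LIM_zero_iff tendsto_norm_zero_iff)
qed

lemma closure_H1_scaleC:
  assumes "x \<in> closure H1"
  shows "c *\<^sub>C x \<in> closure H1"
proof -
  obtain a where "\<And>i. a i \<in> H1" "a \<longlonglongrightarrow> x"
    using assms unfolding closure_sequential by blast
  then show ?thesis
    unfolding closure_sequential
    by (intro exI[of _ "\<lambda>i. c *\<^sub>C a i"]) (auto intro: H1_scaleC tendsto_scaleC)
qed

text \<open>On the circle \<open>Re z\<close> and \<open>Im z\<close> are combinations of \<open>z\<close> and \<open>1/z\<close>.\<close>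
lemma real_polynomial_function_circle_C1:
  assumes "real_polynomial_function p"
  shows "(\<lambda>z. complex_of_real (p z)) \<in> circle_C1"
  using assms
proof induction
  case (linear L)
  have "(\<lambda>z. complex_of_real (L 1 / 2) * (z + inverse z) + (- \<i> * complex_of_real (L \<i>) / 2) * (z + (- 1) * inverse z)) \<in> circle_C1"
    by (intro circle_C1_add circle_C1_mult circle_C1_const circle_C1_inverse circle_C1_ident) auto
  then show ?case
  proof (rule circle_C1_cong)
    fix z assume "z \<in> circle"
    then have inv: "inverse z = cnj z" by (simp add: inverse_complex_def complex_eq_iff cmod_def real_sqrt_eq_1_iff)
    interpret bounded_linear L by fact
    have z: "z = Re z *\<^sub>R 1 + Im z *\<^sub>R \<i>" by (simp add: complex_eq_iff)
    have "L z = Re z * L 1 + Im z * L \<i>" by (subst z) (simp only: add scaleR, simp)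
    then show "complex_of_real (L z) =
        complex_of_real (L 1 / 2) * (z + inverse z) + (- \<i> * complex_of_real (L \<i>) / 2) * (z + (- 1) * inverse z)"
      unfolding inv by (simp add: complex_eq_iff algebra_simps)
  qed
qed (auto intro: circle_C1_const circle_C1_add circle_C1_mult)

text \<open>The measure is finite, so the uniform approximation by polynomials supplied by
  Stone-Weierstrass is also an L^2 approximation; the norm of the constant function 1 is the
  conversion factor.\<close>

lemma continuous_real_in_closure_H1:
  assumes "continuous_on circle \<phi>"
  shows "abs_L2 (\<lambda>z. complex_of_real (\<phi> z)) \<in> closure H1"
  unfolding closure_approachable
proof (intro allI impI)
  fix e :: real assume e: "e > 0"
  define n where "n = norm (abs_L2 (\<lambda>_. 1))"
  define d where "d = e / (n + 1)"
  have n: "n \<ge> 0" by (simp add: n_def)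
  have d: "d > 0" using e n by (simp add: d_def)
  obtain p where p: "real_polynomial_function p" "\<And>z. z \<in> circle \<Longrightarrow> \<bar>\<phi> z - p z\<bar> < d"
    using Stone_Weierstrass_real_polynomial_function[OF compact_sphere assms d] by blast
  have pC1: "(\<lambda>z. complex_of_real (p z)) \<in> circle_C1"
    by (rule real_polynomial_function_circle_C1[OF p(1)])
  have s: "sq_int (\<lambda>z. complex_of_real (p z))" "sq_int (\<lambda>z. complex_of_real (\<phi> z))"
    using assms circle_C1_continuous[OF pC1] by (auto intro!: sq_int_continuous continuous_intros)
  have "norm (abs_L2 (\<lambda>z. complex_of_real (p z)) - abs_L2 (\<lambda>z. complex_of_real (\<phi> z))) \<le> d * n"
    unfolding abs_L2_diff[OF s] n_def
  proof (rule norm_abs_L2_le)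
    fix z assume "z \<in> circle"
    from p(2)[OF this] show "cmod (complex_of_real (p z) - complex_of_real (\<phi> z)) \<le> d * cmod 1"
      by (simp flip: of_real_diff)
  qed (use d s in \<open>auto intro: sq_int_diff sq_int_continuous\<close>)
  also have "\<dots> < d * (n + 1)" using d by simp
  also have "\<dots> = e" using n by (simp add: d_def)
  finally show "\<exists>y\<in>H1. dist y (abs_L2 (\<lambda>z. complex_of_real (\<phi> z))) < e"
    using H1_circle_C1[OF pC1] by (auto simp: dist_norm)
qed

lemma compact_indicator_in_closure_H1:
  assumes K: "compact K"
  shows "abs_L2 (indicator K) \<in> closure H1"
proof (cases "K = {}")
  \<comment> \<open>The distance to the empty set is 0 by convention, so the functions used in the
    other case would be constantly 1 here.\<close>
  case True
  then have "indicator K = (\<lambda>_::complex. 0::complex)" by (simp add: fun_eq_iff)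
  then show ?thesis using subsetD[OF closure_subset H1_zero] abs_L2_zero by metis
next
  case False
  \<comment> \<open>Continuous tents of slope n around K; they converge pointwise to the indicator
    because K is closed.\<close>
  define \<phi> where "\<phi> = (\<lambda>(n::nat) z. max 0 (1 - real n * infdist z K))"
  show ?thesis
  proof (rule closure_H1_lim)
    show "abs_L2 (\<lambda>z. complex_of_real (\<phi> n z)) \<in> closure H1" for n
      unfolding \<phi>_def by (intro continuous_real_in_closure_H1 continuous_intros)
    show "(\<lambda>n. abs_L2 (\<lambda>z. complex_of_real (\<phi> n z))) \<longlonglongrightarrow> abs_L2 (indicator K)"
    proof (rule L2_tendsto_dominated)
      show "sq_int (\<lambda>_. 1)" by (intro sq_int_continuous continuous_intros)
      show "sq_int (indicator K)"
        using K by (intro sq_int_bounded[of _ 1] borel_measurable_circ_measure_borel)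
          (auto simp: indicator_def compact_imp_closed)
      show "(\<lambda>z. complex_of_real (\<phi> n z)) \<in> borel_measurable circ_measure" for n
        unfolding \<phi>_def by (intro borel_measurable_circ_continuous continuous_intros)
      show "cmod (complex_of_real (\<phi> n z)) \<le> cmod 1" for n z
        unfolding \<phi>_def norm_of_real norm_one using mult_nonneg_nonneg[OF of_nat_0_le_iff infdist_nonneg] by (simp add: abs_of_nonneg)
      show "(\<lambda>n. complex_of_real (\<phi> n z)) \<longlonglongrightarrow> indicator K z" for z
      proof (cases "z \<in> K")
        case True
        then have "\<phi> n z = 1" for n by (simp add: \<phi>_def)
        then show ?thesis using True by (simp only: indicator_simps of_real_1) (rule tendsto_const)
      next
        case z: False
        then have pos: "infdist z K > 0"
          using in_closed_iff_infdist_zero[OF compact_imp_closed[OF K] False, of z] infdist_nonneg[of z K] by linarith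
        obtain N where N: "1 / infdist z K < real N" using reals_Archimedean2 by blast
        have "\<phi> n z = 0" if "n \<ge> N" for n
        proof -
          have "1 < real N * infdist z K" using N pos by (simp add: field_simps)
          also have "\<dots> \<le> real n * infdist z K" using that pos by (intro mult_right_mono) auto
          finally show ?thesis by (simp add: \<phi>_def)
        qed
        then have "\<forall>\<^sub>F n in sequentially. complex_of_real (\<phi> n z) = indicator K z"
          using z by (auto simp: eventually_sequentially)
        then show ?thesis by (rule tendsto_eventually)
      qed
    qed
  qed
qed

text \<open>Inner regularity reduces a Borel set to a compact subset. The squared distance of the
  two indicators is the measure of the difference set, hence the tolerance
  \<open>e\<^sup>2\<close>.\<close>

lemma Borel_indicator_in_closure_H1:
  assumes B: "B \<in> sets circ_measure"
  shows "abs_L2 (indicator B) \<in> closure H1"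
proof -
  interpret finite_measure circ_measure by (rule finite_measure_circ_measure)
  have B': "B \<in> sets borel" "B \<subseteq> circle"
    using B by (auto simp: sets_circ_measure sets_restrict_space_iff)
  have id: "(\<lambda>z. z) \<in> measurable circ_measure borel"
    by (rule borel_measurable_circ_continuous) (rule continuous_on_id)
  \<comment> \<open>Inner regularity concerns Borel measures on the whole plane, so
    \<open>circ_measure\<close> is pushed forward along the inclusion of the circle.\<close>
  define M where "M = distr circ_measure borel (\<lambda>z. z)"
  have M: "emeasure M A = emeasure circ_measure A" if "A \<in> sets borel" "A \<subseteq> circle" for A
    using that unfolding M_def by (subst emeasure_distr[OF id]) (auto intro!: arg_cong[of _ _ "emeasure _"])
  have fin: "emeasure M (space M) \<noteq> \<infinity>"
    unfolding M_def by (subst emeasure_distr[OF id]) auto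
  have ind: "sq_int (indicator A)" if "A \<in> sets borel" for A
    using that by (intro sq_int_bounded[of _ 1] borel_measurable_circ_measure_borel) (auto simp: indicator_def)
  have "\<exists>y\<in>closure H1. dist y (abs_L2 (indicator B)) < e" if e: "e > 0" for e
  proof -
    have "\<exists>K\<in>{K. K \<subseteq> B \<and> compact K}. emeasure M B < emeasure M K + ennreal (e\<^sup>2)"
    proof (rule SUP_approx_ennreal)
      show "emeasure M B = (SUP K\<in>{K. K \<subseteq> B \<and> compact K}. emeasure M K)"
        by (rule inner_regular) (use fin B' in \<open>auto simp: M_def\<close>)
      show "emeasure M B \<noteq> \<infinity>" using M[OF B'] by simp
    qed (use e in auto)
    then obtain K where K: "K \<subseteq> B" "compact K" "emeasure M B < emeasure M K + ennreal (e\<^sup>2)" by blast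
    have Kb: "K \<in> sets borel" using K(2) by (simp add: compact_imp_closed borel_closed)
    have Ks: "K \<in> sets circ_measure" using Kb K(1) B' by (auto simp: sets_circ_measure sets_restrict_space_iff)
    have "emeasure circ_measure B < emeasure circ_measure K + ennreal (e\<^sup>2)"
      using K(3) M[OF B'] M[OF Kb] K(1) B'(2) by auto
    then have "measure circ_measure B < measure circ_measure K + e\<^sup>2"
      unfolding emeasure_eq_measure by (simp add: ennreal_less_iff flip: ennreal_plus)
    then have lt: "measure circ_measure (B - K) < e\<^sup>2"
      using finite_measure_Diff[OF B Ks K(1)] by simp
    have "(norm (abs_L2 (indicator K) - abs_L2 (indicator B)))\<^sup>2 =
        (\<integral>z. (cmod (indicator K z - indicator B z))\<^sup>2 \<partial>circ_measure)"
      unfolding abs_L2_diff[OF ind[OF Kb] ind[OF B'(1)]]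
      by (rule norm_abs_L2) (intro sq_int_diff ind Kb B')
    also have "\<dots> = (\<integral>z. indicator (B - K) z \<partial>circ_measure)"
      by (rule Bochner_Integration.integral_cong) (use K(1) in \<open>auto simp: indicator_def\<close>)
    also have "\<dots> = measure circ_measure (B - K)"
    proof -
      have "(B - K) \<inter> circle = B - K" using B'(2) by blast
      then show ?thesis by simp
    qed
    finally have "norm (abs_L2 (indicator K) - abs_L2 (indicator B)) < e"
      using lt e by (intro power_less_imp_less_base[of _ 2 e]) auto
    then show ?thesis using compact_indicator_in_closure_H1[OF K(2)] by (auto simp: dist_norm)
  qed
  then have "abs_L2 (indicator B) \<in> closure (closure H1)" unfolding closure_approachable by blast
  then show ?thesis by simp
qed

text \<open>Every square integrable function is a pointwise limit of simple functions dominated by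
  twice its modulus, and simple functions are finite combinations of Borel indicators.\<close>

lemma closure_H1: "closure H1 = UNIV"
proof -
  have ind: "sq_int (indicator B)" if "B \<in> sets circ_measure" for B
    using that by (intro sq_int_bounded[of _ 1]) (auto simp: indicator_def)
  have sum: "sq_int (\<lambda>z. \<Sum>y\<in>Y. y * indicator (B y) z) \<and> abs_L2 (\<lambda>z. \<Sum>y\<in>Y. y * indicator (B y) z) \<in> closure H1"
    if "finite Y" "\<And>y. B y \<in> sets circ_measure" for Y :: "complex set" and B
    using that(1)
  proof induction
    case empty
    then show ?case using subsetD[OF closure_subset H1_zero] by (simp add: abs_L2_zero sq_int_zero)
  next
    case (insert y Y)
    have s: "sq_int (\<lambda>z. y * indicator (B y) z)" by (intro sq_int_cmult ind that)
    have "abs_L2 (\<lambda>z. y * indicator (B y) z) \<in> closure H1"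
      unfolding abs_L2_scaleC[OF ind[OF that(2)], symmetric]
      by (intro closure_H1_scaleC Borel_indicator_in_closure_H1 that)
    moreover have *: "(\<lambda>z. \<Sum>y\<in>insert y Y. y * indicator (B y) z) =
        (\<lambda>z. y * indicator (B y) z + (\<Sum>y\<in>Y. y * indicator (B y) z))"
      by (simp only: sum.insert[OF insert(1,2)])
    ultimately show ?case
      unfolding * abs_L2_add[OF s conjunct1[OF insert.IH], symmetric]
      by (intro conjI sq_int_add[OF s conjunct1[OF insert.IH]] closure_H1_add conjunct2[OF insert.IH])
  qed
  have "u \<in> closure H1" for u
  proof (cases u)
    case (1 f)
    then have fm: "f \<in> borel_measurable circ_measure" by (simp add: sq_int_def)
    obtain F where F0: "\<forall>i. simple_function circ_measure (F i)"
      "\<forall>z\<in>circle. (\<lambda>i. F i z) \<longlonglongrightarrow> f z"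
      "\<forall>i. \<forall>z\<in>circle. dist (F i z) 0 \<le> 2 * dist (f z) 0"
      using borel_measurable_implies_sequence_metric[OF fm, of 0] unfolding space_circ_measure by blast
    have F: "simple_function circ_measure (F i)" "z \<in> circle \<Longrightarrow> (\<lambda>i. F i z) \<longlonglongrightarrow> f z"
      "z \<in> circle \<Longrightarrow> cmod (F i z) \<le> 2 * cmod (f z)" for i z
      using F0 by (auto simp del: mem_sphere)
    show ?thesis
      unfolding 1(1)
    proof (rule closure_H1_lim)
      show "(\<lambda>i. abs_L2 (F i)) \<longlonglongrightarrow> abs_L2 f"
        by (rule L2_tendsto_dominated[OF 1(2) sq_int_cmult[OF 1(2), of 2]])
           (use F in \<open>auto simp: norm_mult intro: borel_measurable_simple_function\<close>)
      fix i
      define Y where "Y = F i ` circle"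
      define B where "B = (\<lambda>y. F i -` {y} \<inter> circle)"
      have Y: "finite Y" using simple_functionD(1)[OF F(1)] by (simp add: Y_def)
      have B: "B y \<in> sets circ_measure" for y
        using simple_functionD(2)[OF F(1), of i "{y}"] by (simp add: B_def)
      have "F i z = (\<Sum>y\<in>Y. y * indicator (B y) z)" if "z \<in> circle" for z
      proof -
        have "(\<Sum>y\<in>Y. y * indicator (B y) z) = (\<Sum>y\<in>{F i z}. y * indicator (B y) z)"
          by (rule sum.mono_neutral_right) (use Y that in \<open>auto simp: Y_def B_def indicator_def\<close>)
        also have "\<dots> = F i z" using that by (simp add: B_def indicator_def)
        finally show ?thesis by (rule sym)
      qed
      then have "abs_L2 (F i) = abs_L2 (\<lambda>z. \<Sum>y\<in>Y. y * indicator (B y) z)"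
        by (rule abs_L2_cong[OF conjunct1[OF sum[OF Y B]]])
      then show "abs_L2 (F i) \<in> closure H1" using conjunct2[OF sum[OF Y B]] by (rule ssubst)
    qed
  qed
  then show ?thesis by blast
qed

section \<open>Hilbert space adjoints of the summands of L\<close>

lemma cinner_diff_left: "cinner (x - y) z = cinner x z - cinner y z"
proof -
  have "\<i> *\<^sub>C (x - y) = \<i> *\<^sub>C x - \<i> *\<^sub>C y" using scaleC_add_right[of \<i> "x - y" y] by simp
  then show ?thesis by (simp add: cinner_def inner_diff_left complex_eq_iff)
qed

lemma cinner_diff_right: "cinner x (y - z) = cinner x y - cinner x z"
  by (simp add: cinner_def inner_diff_right complex_eq_iff)

lemma cinner_scaleR_right: "cinner x (r *\<^sub>R y) = r *\<^sub>R cinner x y"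
  by (simp add: cinner_def complex_eq_iff)

lemma cinner_scaleR_left: "cinner (r *\<^sub>R x) y = r *\<^sub>R cinner x y"
proof -
  have "\<i> *\<^sub>C (r *\<^sub>R x) = r *\<^sub>R (\<i> *\<^sub>C x)" by (simp add: scaleR_scaleC scaleC_scaleC mult.commute)
  then show ?thesis by (simp add: cinner_def complex_eq_iff)
qed

text \<open>Two candidates differ by a vector orthogonal to a dense set, hence orthogonal to itself;
  so the \<open>THE\<close> in \<open>adjoint_on\<close> picks w.\<close>

lemma adjoint_on_eqI:
  assumes "closure Dom = UNIV" and w: "\<And>u. u \<in> Dom \<Longrightarrow> cinner w u = cinner v (S u)"
  shows "adjoint_on Dom S v = w"
  unfolding adjoint_on_def
proof (rule the_equality)
  show "\<forall>u\<in>Dom. cinner w u = cinner v (S u)" using w by blast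
  fix w' assume w': "\<forall>u\<in>Dom. cinner w' u = cinner v (S u)"
  have "inner (w' - w) u = 0" if "u \<in> Dom" for u
    using w[OF that] w' that cinner_diff_left[of w' w u] by (simp add: cinner_def complex_eq_iff)
  then have "inner (w' - w) u = 0" if "u \<in> closure Dom" for u
    using continuous_constant_on_closure[of Dom "\<lambda>u. inner (w' - w) u" 0 u] that
    by (simp add: continuous_on_inner continuous_on_const continuous_on_id)
  then have "inner (w' - w) (w' - w) = 0" using assms(1) by blast
  then show "w' = w" by simp
qed

text \<open>The coefficient a_n is real and survives unchanged, while i becomes -i by integration by
  parts. The formula covers exactly the vectors to which the adjoint is applied later, namely
  weighted components in H^1.\<close>

lemma L_adj_summand_eq:
  assumes "v \<in> H1"
  shows "L_adj_summand f n v = (- \<i>) *\<^sub>C L2_mult (\<lambda>z. z) (L2_deriv v) - a_coeff f n *\<^sub>R v"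
  unfolding L_adj_summand_def
proof (rule adjoint_on_eqI[OF closure_H1])
  fix u assume "u \<in> H1"
  then show "cinner ((- \<i>) *\<^sub>C L2_mult (\<lambda>z. z) (L2_deriv v) - a_coeff f n *\<^sub>R v) u = cinner v (L_summand f n u)"
    unfolding L_summand_def cinner_diff_left cinner_diff_right cinner_scaleR_left cinner_scaleR_right
    using cinner_circle_deriv[OF H1_deriv_L2_deriv H1_deriv_L2_deriv[OF assms]] by simp
qed

section \<open>Growth of the derivatives of the iterates\<close>

text \<open>Differentiation along the circle is differentiation in the angle followed by
  multiplication with 1/(2 pi i z). Smoothness in the angle therefore passes to derivatives along
  the circle, here for the two orders that the weights require.\<close>

lemma circle_smooth_C1:
  assumes "circle_smooth g"
  shows "g \<in> circle_C1" "circ_deriv g \<in> circle_C1"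
proof -
  obtain G where G: "\<And>t. G 0 t = g (cis (2 * pi * t))" "\<And>k t. (G k has_vector_derivative G (Suc k) t) (at t)"
    using assms unfolding circle_smooth_def by blast
  define c where "c = 2 * pi * \<i>"
  \<comment> \<open>The derivative dt/dz of the angle along the circle; it reproduces itself up to a
    factor under differentiation in t.\<close>
  define E where "E = (\<lambda>t::real. inverse (c * cis (2 * pi * t)))"
  have c0: "c \<noteq> 0" by (simp add: c_def)
  have E: "(E has_vector_derivative - c * E t) (at t)" for t
  proof -
    let ?w = "cis (2 * pi * t)"
    have w: "((\<lambda>t. cis (2 * pi * t)) has_vector_derivative c * ?w) (at t)"
      using has_vector_derivative_circleD[of "\<lambda>z. z" 1 t] by (simp add: c_def)
    have "((\<lambda>w. inverse (c * w)) has_field_derivative - (inverse (c * ?w) * c * inverse (c * ?w))) (at ?w)"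
      using c0 by (auto intro!: derivative_eq_intros)
    from field_vector_diff_chain_at[OF w this]
    show ?thesis using c0 by (simp add: E_def o_def field_simps)
  qed
  note prod = has_vector_derivative_mult[OF _ E]
  note prod' = has_vector_derivative_mult[OF _ has_vector_derivative_mult[OF has_vector_derivative_const[of "- c"] E]]
  have step: "circ_deriv p (cis (2 * pi * t)) = P t * E t \<and>
      (p has_field_derivative circ_deriv p (cis (2 * pi * t))) (at (cis (2 * pi * t)) within circle)"
    if "\<And>t. ((\<lambda>t. p (cis (2 * pi * t))) has_vector_derivative P t) (at t)" for p P t
  proof -
    have "(p has_field_derivative P t * E t) (at (cis (2 * pi * t)) within circle)"
      using has_field_derivative_circleI[of p "P t" t, OF that] by (simp add: E_def c_def field_simps)
    then show ?thesis using circ_deriv_eq[of p "P t * E t"] by simp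
  qed
  have cont: "continuous_on circle p"
    if p: "\<And>t. ((\<lambda>t. p (cis (2 * pi * t))) has_vector_derivative P t) (at t)" for p :: "complex \<Rightarrow> complex" and P
    unfolding continuous_on_eq_continuous_within
  proof
    fix z assume "z \<in> circle"
    then obtain t where "z = cis (2 * pi * t)" by (rule circle_param_ex)
    then show "continuous (at z within circle) p" using DERIV_continuous step[of p P t, OF p] by blast
  qed
  have C1: "p \<in> circle_C1"
    if p: "\<And>t. ((\<lambda>t. p (cis (2 * pi * t))) has_vector_derivative P t) (at t)"
      and q: "\<And>t. ((\<lambda>t. circ_deriv p (cis (2 * pi * t))) has_vector_derivative Q t) (at t)" for p P Q :: "_ \<Rightarrow> complex"
  proof (rule circle_C1I[OF _ cont[of _ Q, OF q]])
    fix z assume "z \<in> circle"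
    then obtain t where "z = cis (2 * pi * t)" by (rule circle_param_ex)
    then show "(p has_field_derivative circ_deriv p z) (at z within circle)" using step[of p P t, OF p] by blast
  qed
  have 0: "((\<lambda>t. g (cis (2 * pi * t))) has_vector_derivative G 1 t) (at t)" for t
  proof -
    have "G 0 = (\<lambda>t. g (cis (2 * pi * t)))" using G(1) by blast
    then show ?thesis using G(2)[of 0 t] by simp
  qed
  have "(\<lambda>t. circ_deriv g (cis (2 * pi * t))) = (\<lambda>t. G 1 t * E t)" using step[of g "G 1", OF 0] by blast
  then have 1: "((\<lambda>t. circ_deriv g (cis (2 * pi * t))) has_vector_derivative G 1 t * (- c * E t) + G 2 t * E t) (at t)" for t
    using prod[OF G(2)[of 1 t]] by (simp add: numeral_2_eq_2)
  have "(\<lambda>t. circ_deriv (circ_deriv g) (cis (2 * pi * t))) = (\<lambda>t. (G 1 t * (- c * E t) + G 2 t * E t) * E t)"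
    using step[of "circ_deriv g" "\<lambda>t. G 1 t * (- c * E t) + G 2 t * E t", OF 1] by blast
  \<comment> \<open>The second derivative along the circle is differentiable once more in the angle,
    and from this its continuity is obtained.\<close>
  moreover have "\<exists>d. ((\<lambda>t. (G 1 t * (- c * E t) + G 2 t * E t) * E t) has_vector_derivative d) (at t)" for t
    by (rule exI)
       (rule prod[OF has_vector_derivative_add[OF prod'[OF G(2)[of 1]] prod[OF G(2)[of 2]]]])
  ultimately have "\<exists>d. ((\<lambda>t. circ_deriv (circ_deriv g) (cis (2 * pi * t))) has_vector_derivative d) (at t)" for t
    by (simp only:)
  then obtain Q where 2: "\<And>t. ((\<lambda>t. circ_deriv (circ_deriv g) (cis (2 * pi * t))) has_vector_derivative Q t) (at t)"
    by metis
  show "g \<in> circle_C1" by (rule C1[of g "G 1", OF 0 1])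
  show "circ_deriv g \<in> circle_C1" by (rule C1[of "circ_deriv g" _ Q, OF 1 2])
qed

text \<open>Two orders, because the weights are built from the first derivative of an iterate and
  have to be C^1 themselves.\<close>

definition circle_C2 :: "(complex \<Rightarrow> complex) set" where
  "circle_C2 = {g \<in> circle_C1. circ_deriv g \<in> circle_C1}"

lemma circle_C2_compose:
  assumes "f \<in> circle_C2" "g \<in> circle_C2" "g ` circle \<subseteq> circle"
  shows "f \<circ> g \<in> circle_C2"
proof -
  have C1: "f \<in> circle_C1" "circ_deriv f \<in> circle_C1" "g \<in> circle_C1" "circ_deriv g \<in> circle_C1"
    using assms by (auto simp: circle_C2_def)
  have "(\<lambda>z. (circ_deriv f \<circ> g) z * circ_deriv g z) \<in> circle_C1"
    by (intro circle_C1_mult circle_C1_compose C1 assms)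
  then have "circ_deriv (f \<circ> g) \<in> circle_C1"
    by (rule circle_C1_cong) (simp add: circ_deriv_compose[OF C1(1,3) assms(3)])
  then show ?thesis using circle_C1_compose[OF C1(1,3) assms(3)] by (simp add: circle_C2_def)
qed

lemma circle_C2_ident: "id \<in> circle_C2"
proof -
  have "circ_deriv id z = 1" if "z \<in> circle" for z
    by (rule circ_deriv_eq[OF _ that]) (simp add: id_def)
  then have "circ_deriv id \<in> circle_C1" by (intro circle_C1_cong[OF circle_C1_const[of 1]])
  then show ?thesis using circle_C1_ident by (simp add: circle_C2_def id_def)
qed

lemma circle_C2_funpow:
  assumes "f \<in> circle_C2" "f ` circle \<subseteq> circle"
  shows "f ^^ n \<in> circle_C2 \<and> (f ^^ n) ` circle \<subseteq> circle"
proof (induction n)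
  case 0
  show ?case using circle_C2_ident by (simp add: id_def)
next
  case (Suc n)
  then have "f \<circ> f ^^ n \<in> circle_C2" using assms by (intro circle_C2_compose) auto
  moreover have "(f \<circ> f ^^ n) ` circle \<subseteq> circle"
    unfolding image_comp[symmetric] using Suc assms(2) by (meson image_mono order_trans)
  ultimately show ?case by (simp only: funpow.simps simp_thms)
qed

section \<open>Conjugates of rotations and their iterates\<close>

lemma rot_in_circle: "z \<in> circle \<Longrightarrow> rot \<beta> z \<in> circle"
  by (simp add: rot_def norm_mult)

lemma rot_rot: "rot \<beta> (rot \<gamma> z) = rot (\<beta> + \<gamma>) z"
  by (simp add: rot_def cis_mult distrib_left mult.assoc[symmetric])

lemma rot_0: "rot 0 z = z"
  by (simp add: rot_def)

locale circle_homeo =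
  fixes h :: "complex \<Rightarrow> complex"
  assumes homeo: "\<exists>h'. homeomorphism circle circle h h'"
begin

lemma bij_h: "bij_betw h circle circle"
  using homeo by (auto simp: bij_betw_def homeomorphism_def intro: inj_on_inverseI)

lemma h_in_circle: "z \<in> circle \<Longrightarrow> h z \<in> circle"
  using bij_h by (auto simp: bij_betw_def)

lemma cinv_h_in_circle: "z \<in> circle \<Longrightarrow> cinv h z \<in> circle"
  unfolding cinv_def using bij_h by (metis bij_betw_imp_surj_on inv_into_into)

lemma h_cinv_h: "z \<in> circle \<Longrightarrow> h (cinv h z) = z"
  unfolding cinv_def using bij_h by (metis bij_betw_imp_surj_on f_inv_into_f)

lemma cinv_h_h: "z \<in> circle \<Longrightarrow> cinv h (h z) = z"
  unfolding cinv_def using bij_h by (metis bij_betw_imp_inj_on inv_into_f_f)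

lemma continuous_on_h: "continuous_on circle h"
  using homeo by (auto simp: homeomorphism_def)

lemma continuous_on_cinv_h: "continuous_on circle (cinv h)"
proof -
  obtain h' where h': "homeomorphism circle circle h h'" using homeo by blast
  have "cinv h z = h' z" if "z \<in> circle" for z
  proof -
    have "h' z \<in> circle" "h (h' z) = z" using h' that unfolding homeomorphism_def by blast+
    then show ?thesis using cinv_h_h by metis
  qed
  then show ?thesis using h' continuous_on_cong[OF refl, of circle "cinv h" h'] unfolding homeomorphism_def by blast
qed

lemma conjugate_rot_in_circle: "z \<in> circle \<Longrightarrow> conjugate_rot h \<beta> z \<in> circle"
  unfolding conjugate_rot_def o_def by (intro h_in_circle rot_in_circle cinv_h_in_circle)

lemma conjugate_rot_add:
  "z \<in> circle \<Longrightarrow> conjugate_rot h \<beta> (conjugate_rot h \<gamma> z) = conjugate_rot h (\<beta> + \<gamma>) z"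
  unfolding conjugate_rot_def o_def by (simp only: cinv_h_h rot_in_circle cinv_h_in_circle rot_rot)

lemma conjugate_rot_0: "z \<in> circle \<Longrightarrow> conjugate_rot h 0 z = z"
  unfolding conjugate_rot_def o_def by (simp add: rot_0 h_cinv_h)

lemma cinv_conjugate_rot:
  assumes f: "\<And>z. z \<in> circle \<Longrightarrow> f z = conjugate_rot h \<beta> z" and z: "z \<in> circle"
  shows "cinv f z = conjugate_rot h (- \<beta>) z"
  unfolding cinv_def
proof (rule inv_into_f_eq)
  show "inj_on f circle"
  proof (rule inj_on_inverseI)
    fix w assume "w \<in> circle"
    then show "conjugate_rot h (- \<beta>) (f w) = w"
      using f conjugate_rot_add[of w "- \<beta>" \<beta>] conjugate_rot_0 by simp
  qed
  show "conjugate_rot h (- \<beta>) z \<in> circle" using z by (rule conjugate_rot_in_circle)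
  then show "f (conjugate_rot h (- \<beta>) z) = z"
    using f conjugate_rot_add[OF z, of \<beta> "- \<beta>"] conjugate_rot_0[OF z] by simp
qed

lemma funpow_conjugate_rot:
  assumes f: "\<And>z. z \<in> circle \<Longrightarrow> f z = conjugate_rot h \<beta> z" and z: "z \<in> circle"
  shows "(f ^^ n) z = conjugate_rot h (of_nat n * \<beta>) z"
proof (induction n)
  case 0
  then show ?case using conjugate_rot_0[OF z] by simp
next
  case (Suc n)
  have "(f ^^ Suc n) z = conjugate_rot h \<beta> (conjugate_rot h (of_nat n * \<beta>) z)"
    using Suc f[OF conjugate_rot_in_circle[OF z]] by simp
  then show ?case using conjugate_rot_add[OF z] by (simp add: distrib_right)
qed

text \<open>Replaces integer iterates, defined by cases on the sign, by members of the one-parameter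
  group \<open>conjugate_rot h\<close>. Additivity in n and the relation between the iterates of T
  and of f then become additions of angles.\<close>

lemma citer_conjugate_rot:
  assumes f: "\<And>z. z \<in> circle \<Longrightarrow> f z = conjugate_rot h \<beta> z" and z: "z \<in> circle"
  shows "citer f n z = conjugate_rot h (of_int n * \<beta>) z"
proof (cases "n \<ge> 0")
  case True
  then show ?thesis using funpow_conjugate_rot[OF f z, of "nat n"] by (simp add: citer_def of_nat_nat)
next
  case False
  then show ?thesis
    using funpow_conjugate_rot[OF cinv_conjugate_rot[OF f] z, of "nat (- n)"] by (simp add: citer_def of_nat_nat)
qed

end

locale circle_diffeo_conj = circle_homeo +
  fixes f :: "complex \<Rightarrow> complex" and \<beta> :: real
  assumes diffeo: "circle_diffeo f" and f_eq: "z \<in> circle \<Longrightarrow> f z = conjugate_rot h \<beta> z"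
begin

lemma citer_eq: "z \<in> circle \<Longrightarrow> citer f n z = conjugate_rot h (of_int n * \<beta>) z"
  using citer_conjugate_rot[OF f_eq] .

lemma citer_in_circle: "z \<in> circle \<Longrightarrow> citer f n z \<in> circle"
  using citer_eq conjugate_rot_in_circle by simp

lemma citer_image: "citer f n ` circle \<subseteq> circle"
  using citer_in_circle by blast

lemma citer_nonzero: "z \<in> circle \<Longrightarrow> citer f n z \<noteq> 0"
  using citer_in_circle[of z n] by auto

lemma citer_add:
  assumes z: "z \<in> circle"
  shows "citer f (m + n) z = citer f m (citer f n z)"
  unfolding citer_eq[OF z] citer_eq[OF conjugate_rot_in_circle[OF z]] conjugate_rot_add[OF z]
  by (simp add: distrib_right)

lemma citer_C2: "citer f n \<in> circle_C2"
proof -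
  have "f \<in> circle_C2" "cinv f \<in> circle_C2"
    using diffeo circle_smooth_C1 by (auto simp: circle_diffeo_def circle_C2_def)
  moreover have "f ` circle \<subseteq> circle" using f_eq conjugate_rot_in_circle by auto
  moreover have "cinv f ` circle \<subseteq> circle"
    using cinv_conjugate_rot[OF f_eq] conjugate_rot_in_circle by auto
  ultimately show ?thesis unfolding citer_def using circle_C2_funpow by auto
qed

lemma citer_C1: "citer f n \<in> circle_C1" "circ_deriv (citer f n) \<in> circle_C1"
  using citer_C2[of n] by (auto simp: circle_C2_def)

section \<open>The derivative cocycle and the growth constants\<close>

abbreviation D :: "int \<Rightarrow> complex \<Rightarrow> complex" where "D n \<equiv> circ_deriv (citer f n)"

text \<open>The chain rule in cocycle form, from which all estimates of the weights are derived. The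
  two sides of \<open>citer_add\<close> agree on the circle, so derivatives along the circle agree
  as well.\<close>

lemma D_add: "z \<in> circle \<Longrightarrow> D (m + n) z = D m (citer f n z) * D n z"
  using circ_deriv_cong[OF circle_C1_compose[OF citer_C1(1)[of m] citer_C1(1)[of n] citer_image], of "citer f (m + n)"]
    circ_deriv_compose[OF citer_C1(1)[of m] citer_C1(1)[of n] citer_image] citer_add by simp

lemma D_0: "z \<in> circle \<Longrightarrow> D 0 z = 1"
  by (rule circ_deriv_eq) (auto simp: citer_def id_def)

lemma D_inverse: "z \<in> circle \<Longrightarrow> D (- n) (citer f n z) * D n z = 1"
  using D_add[of z "- n" n] D_0 by simp

lemma D_nonzero: "z \<in> circle \<Longrightarrow> D n z \<noteq> 0"
  using D_inverse[of z n] by auto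

lemma bdd_D: "bdd_above ((\<lambda>z. cmod (D n z)) ` circle)"
proof -
  obtain C where "\<And>z. z \<in> circle \<Longrightarrow> cmod (D n z) \<le> C"
    using continuous_on_circle_bounded[OF circle_C1_continuous[OF citer_C1(2)]] by blast
  then show ?thesis by (rule bdd_aboveI2)
qed

lemma Growth_minus: "Growth f (- n) = Growth f n"
  by (simp add: Growth_def max.commute)

lemma D_le_Growth: "z \<in> circle \<Longrightarrow> cmod (D n z) \<le> Growth f n"
  unfolding Growth_def using cSUP_upper[OF _ bdd_D] by (meson max.coboundedI1)

text \<open>The reciprocal of the derivative of an iterate is the derivative of the inverse iterate
  at the image point. Since \<open>Growth\<close> is a maximum over n and -n, it controls inverse
  weights too.\<close>

lemma inverse_D_le_Growth:
  assumes "z \<in> circle"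
  shows "inverse (cmod (D n z)) \<le> Growth f n"
proof -
  have "inverse (D n z) = D (- n) (citer f n z)"
    using D_inverse[OF assms, of n] by (metis inverse_unique mult.commute)
  then show ?thesis
    using D_le_Growth[OF citer_in_circle[OF assms], of "- n" n] by (simp add: Growth_minus flip: norm_inverse)
qed

lemma Growth_nonneg: "Growth f n \<ge> 0"
  using order_trans[OF norm_ge_zero D_le_Growth[of 1 n]] by simp

lemma Growth_leI:
  assumes "\<And>z. z \<in> circle \<Longrightarrow> cmod (D n z) \<le> C" "\<And>z. z \<in> circle \<Longrightarrow> cmod (D (- n) z) \<le> C"
  shows "Growth f n \<le> C"
proof -
  have "circle \<noteq> {}" using sphere_eq_empty[of 0 "1::real"] by simp
  then show ?thesis unfolding Growth_def by (intro max.boundedI cSUP_least assms)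
qed

lemma D_add_le: "z \<in> circle \<Longrightarrow> cmod (D (m + n) z) \<le> Growth f m * Growth f n"
  unfolding D_add norm_mult
  by (intro mult_mono D_le_Growth citer_in_circle Growth_nonneg norm_ge_zero)

lemma Growth_add_le: "Growth f (m + n) \<le> Growth f m * Growth f n"
proof (rule Growth_leI)
  fix z assume "z \<in> circle"
  then show "cmod (D (m + n) z) \<le> Growth f m * Growth f n" "cmod (D (- (m + n)) z) \<le> Growth f m * Growth f n"
    using D_add_le[of z m n] D_add_le[of z "- m" "- n"] by (simp_all add: Growth_minus)
qed

lemma Growth_div_le: "Growth f m / Growth f n \<le> Growth f (m - n)"
  \<comment> \<open>Submultiplicativity for \<open>m = (m - n) + n\<close>; if
    \<open>Growth f n = 0\<close>, the quotient is 0 by convention.\<close>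
  using Growth_add_le[of "m - n" n] Growth_nonneg[of n] Growth_nonneg[of "m - n"]
  by (cases "Growth f n = 0") (auto simp: divide_le_eq)

text \<open>For n \<le> 0 the step from n to n - 1 adds the term with index |n| + 1. The shift
  \<open>l - 1\<close> in the negative branch of \<open>a_coeff\<close> turns it into the growth at
  |n|, which equals that at n by symmetry.\<close>

lemma a_coeff_step: "a_coeff f n - a_coeff f (n - 1) = 1 / Growth f n"
proof (cases "n > 0")
  case True
  then have "{1..n} = insert n {1..n - 1}" by auto
  then show ?thesis using True by (cases "n = 1") (auto simp: a_coeff_def)
next
  case False
  then have "{1..\<bar>n - 1\<bar>} = insert (\<bar>n\<bar> + 1) {1..\<bar>n\<bar>}" by auto
  moreover have "Growth f \<bar>n\<bar> = Growth f n" using Growth_minus False by simp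
  ultimately show ?thesis using False by (simp add: a_coeff_def)
qed

text \<open>Telescoping: the difference consists of k terms \<open>1 / Growth f m\<close> with m
  within distance k of n. Multiplied by \<open>Growth f n\<close>, each is at most
  \<open>Growth f (n - m)\<close>, which depends on the offset alone and hence is uniform in
  n.\<close>

lemma a_coeff_bound_nat:
  "\<exists>C. \<forall>n. Growth f n * \<bar>a_coeff f n - a_coeff f (n + of_nat k)\<bar> \<le> C"
  "\<exists>C. \<forall>n. Growth f n * \<bar>a_coeff f n - a_coeff f (n - of_nat k)\<bar> \<le> C"
proof (induction k)
  case (Suc k)
  { case 1
    from Suc(1) obtain C where C: "\<And>n. Growth f n * \<bar>a_coeff f n - a_coeff f (n + of_nat k)\<bar> \<le> C" by blast
    have "Growth f n * \<bar>a_coeff f n - a_coeff f (n + of_nat (Suc k))\<bar> \<le> C + Growth f (- of_nat (Suc k))" for n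
    proof -
      define m where "m = n + of_nat (Suc k)"
      have "\<bar>a_coeff f n - a_coeff f m\<bar> \<le> \<bar>a_coeff f n - a_coeff f (n + of_nat k)\<bar> + \<bar>a_coeff f m - a_coeff f (m - 1)\<bar>"
        by (simp add: m_def)
      also have "\<bar>a_coeff f m - a_coeff f (m - 1)\<bar> = 1 / Growth f m" using a_coeff_step Growth_nonneg by simp
      finally have "Growth f n * \<bar>a_coeff f n - a_coeff f m\<bar> \<le>
          Growth f n * (\<bar>a_coeff f n - a_coeff f (n + of_nat k)\<bar> + 1 / Growth f m)"
        by (rule mult_left_mono) (rule Growth_nonneg)
      also have "\<dots> \<le> C + Growth f (n - m)"
        using C[of n] Growth_div_le[of n m] by (simp add: distrib_left)
      finally show ?thesis by (simp add: m_def)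
    qed
    then show ?case by blast
  next
    case 2
    from Suc(2) obtain C where C: "\<And>n. Growth f n * \<bar>a_coeff f n - a_coeff f (n - of_nat k)\<bar> \<le> C" by blast
    \<comment> \<open>The offset is k and not k + 1: a step downwards from \<open>n - k\<close>
      contributes the growth at its upper end.\<close>
    have "Growth f n * \<bar>a_coeff f n - a_coeff f (n - of_nat (Suc k))\<bar> \<le> C + Growth f (of_nat k)" for n
    proof -
      define m where "m = n - of_nat k"
      have "\<bar>a_coeff f n - a_coeff f (m - 1)\<bar> \<le> \<bar>a_coeff f n - a_coeff f m\<bar> + \<bar>a_coeff f m - a_coeff f (m - 1)\<bar>"
        by simp
      also have "\<bar>a_coeff f m - a_coeff f (m - 1)\<bar> = 1 / Growth f m" using a_coeff_step Growth_nonneg by simp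
      finally have "Growth f n * \<bar>a_coeff f n - a_coeff f (m - 1)\<bar> \<le>
          Growth f n * (\<bar>a_coeff f n - a_coeff f m\<bar> + 1 / Growth f m)"
        by (rule mult_left_mono) (rule Growth_nonneg)
      also have "\<dots> \<le> C + Growth f (n - m)"
        using C[of n] Growth_div_le[of n m] by (simp add: distrib_left m_def)
      finally show ?thesis by (simp add: m_def algebra_simps)
    qed
    then show ?case by blast
  }
qed auto

lemma a_coeff_bound:
  obtains C where "C \<ge> 0" "\<And>n. Growth f n * \<bar>a_coeff f n - a_coeff f (n + k)\<bar> \<le> C"
proof -
  have "\<exists>C. \<forall>n. Growth f n * \<bar>a_coeff f n - a_coeff f (n + k)\<bar> \<le> C"
    using a_coeff_bound_nat[of "nat \<bar>k\<bar>"] by (cases "k \<ge> 0") auto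
  then obtain C where "\<And>n. Growth f n * \<bar>a_coeff f n - a_coeff f (n + k)\<bar> \<le> C" by blast
  then show thesis by (intro that[of "max C 0"]) (auto simp: le_max_iff_disj)
qed

lemma mod_weight_nonzero: "z \<in> circle \<Longrightarrow> mod_weight f n z \<noteq> 0"
  using D_nonzero[of z n] citer_nonzero[of z n] by (auto simp: mod_weight_def)

lemma norm_mod_weight: "z \<in> circle \<Longrightarrow> cmod (mod_weight f n z) = cmod (D n z)"
  using citer_in_circle[of z n] by (simp add: mod_weight_def norm_mult norm_divide)

text \<open>Consequently \<open>Delta_inv\<close> keeps every component in H^1, where the formula
  for the adjoint applies.\<close>

lemma inverse_mod_weight_C1: "(\<lambda>z. inverse (mod_weight f n z)) \<in> circle_C1"
proof -
  have "(\<lambda>z. z * D n z * inverse (citer f n z)) \<in> circle_C1"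
    by (intro circle_C1_mult circle_C1_inverse circle_C1_ident citer_C1 citer_nonzero)
  then have "mod_weight f n \<in> circle_C1" by (rule circle_C1_cong) (simp add: mod_weight_def divide_inverse)
  then show ?thesis using mod_weight_nonzero by (rule circle_C1_inverse)
qed

end

section \<open>The deformed commutator as a band operator\<close>

lemma comps_add: "comps (x + y) n = comps x n + comps y n"
  by (simp add: plus_dsum.rep_eq)

lemma comps_diff: "comps (x - y) n = comps x n - comps y n"
  by (simp add: minus_dsum.rep_eq)

lemma comps_scaleC: "comps (c *\<^sub>C x) n = c *\<^sub>C comps x n"
  by (simp add: scaleC_dsum.rep_eq)

lemma comps_zero: "comps 0 n = 0"
  by (simp add: zero_dsum.rep_eq)

lemma comps_sum: "comps (sum x I) n = (\<Sum>i\<in>I. comps (x i) n)"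
  by (induction I rule: infinite_finite_induct) (auto simp: comps_zero comps_add)

lemma comps_Dsum: "(\<lambda>n. (norm (x n))\<^sup>2) summable_on UNIV \<Longrightarrow> comps (Dsum x) = x"
  by (simp add: Dsum_inverse)

lemma summable_comps: "(\<lambda>n. (norm (comps x n))\<^sup>2) summable_on UNIV"
  using comps[of x] by simp

lemma norm_dsum_power2: "(norm x)\<^sup>2 = (\<Sum>\<^sub>\<infinity>n. (norm (comps x n))\<^sup>2)"
  by (simp add: power2_norm_eq_inner inner_dsum.rep_eq)

lemma norm_comps_le: "norm (comps x n) \<le> norm x"
proof -
  have "(norm (comps x n))\<^sup>2 = (\<Sum>\<^sub>\<infinity>k\<in>{n}. (norm (comps x k))\<^sup>2)" by simp
  also have "\<dots> \<le> (norm x)\<^sup>2"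
    unfolding norm_dsum_power2 by (rule infsum_mono_neutral) (auto intro: summable_comps)
  finally show ?thesis by (simp add: power2_le_iff_abs_le)
qed

lemma comps_dsum_single: "comps (dsum_single m u) n = (if n = m then u else 0)"
proof -
  have "(\<lambda>n. (norm (if n = m then u else 0))\<^sup>2) summable_on UNIV"
    by (rule finite_nonzero_values_imp_summable_on) (auto intro: finite_subset[of _ "{m}"])
  then show ?thesis unfolding dsum_single_def by (subst comps_Dsum) auto
qed

text \<open>The operator is an isometric shift by l followed by uniformly bounded multiplications.
  \<open>Dsum\<close> is meaningful on square-summable sequences only, so comparison with the
  shifted sequence has to come before its components can be read off.\<close>

lemma diagonal_bound:
  assumes M: "\<And>n. continuous_on circle (M n)" "C \<ge> 0" "\<And>n z. z \<in> circle \<Longrightarrow> cmod (M n z) \<le> C"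
  shows "comps (Dsum (\<lambda>n. L2_mult (M n) (comps \<xi> (n - l)))) = (\<lambda>n. L2_mult (M n) (comps \<xi> (n - l)))" (is ?comps)
    and "norm (Dsum (\<lambda>n. L2_mult (M n) (comps \<xi> (n - l)))) \<le> C * norm \<xi>"
proof -
  have bij: "bij_betw (\<lambda>n::int. n - l) UNIV UNIV"
    by (rule bij_betw_byWitness[of _ "\<lambda>n. n + l"]) auto
  have sum: "(\<lambda>n. C\<^sup>2 * (norm (comps \<xi> (n - l)))\<^sup>2) summable_on UNIV"
    using summable_on_reindex_bij_betw[OF bij, of "\<lambda>n. (norm (comps \<xi> n))\<^sup>2"] summable_comps[of \<xi>]
    by (intro summable_on_cmult_right) simp
  have le: "(norm (L2_mult (M n) (comps \<xi> (n - l))))\<^sup>2 \<le> C\<^sup>2 * (norm (comps \<xi> (n - l)))\<^sup>2" for n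
  proof -
    have "norm (L2_mult (M n) (comps \<xi> (n - l))) \<le> C * norm (comps \<xi> (n - l))"
      by (rule norm_L2_mult_le) (use M in auto)
    from power_mono[OF this, of 2] show ?thesis by (simp add: power_mult_distrib)
  qed
  have s: "(\<lambda>n. (norm (L2_mult (M n) (comps \<xi> (n - l))))\<^sup>2) summable_on UNIV"
    by (rule summable_on_comparison_test[OF sum]) (use le in auto)
  show c: ?comps by (rule comps_Dsum[OF s])
  have "(norm (Dsum (\<lambda>n. L2_mult (M n) (comps \<xi> (n - l)))))\<^sup>2 \<le> (\<Sum>\<^sub>\<infinity>n. C\<^sup>2 * (norm (comps \<xi> (n - l)))\<^sup>2)"
    unfolding norm_dsum_power2 c by (rule infsum_mono[OF s sum le])
  also have "\<dots> = C\<^sup>2 * (\<Sum>\<^sub>\<infinity>n. (norm (comps \<xi> (n - l)))\<^sup>2)"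
    by (rule infsum_cmult_right')
  also have "(\<Sum>\<^sub>\<infinity>n. (norm (comps \<xi> (n - l)))\<^sup>2) = (norm \<xi>)\<^sup>2"
    unfolding norm_dsum_power2 by (rule infsum_reindex_bij_betw[OF bij, of "\<lambda>n. (norm (comps \<xi> n))\<^sup>2"])
  finally have "(norm (Dsum (\<lambda>n. L2_mult (M n) (comps \<xi> (n - l)))))\<^sup>2 \<le> (C * norm \<xi>)\<^sup>2"
    by (simp add: power_mult_distrib)
  then show "norm (Dsum (\<lambda>n. L2_mult (M n) (comps \<xi> (n - l)))) \<le> C * norm \<xi>"
    using M(2) by (simp add: power2_le_iff_abs_le)
qed

definition band_op :: "int set \<Rightarrow> (int \<Rightarrow> int \<Rightarrow> complex \<Rightarrow> complex) \<Rightarrow> dsum \<Rightarrow> dsum" where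
  "band_op J M \<xi> = (\<Sum>l\<in>J. Dsum (\<lambda>n. L2_mult (M l n) (comps \<xi> (n - l))))"

lemma band_op_props:
  assumes M: "\<And>l n. l \<in> J \<Longrightarrow> continuous_on circle (M l n)"
    and C: "\<And>l. l \<in> J \<Longrightarrow> C l \<ge> 0" "\<And>l n z. l \<in> J \<Longrightarrow> z \<in> circle \<Longrightarrow> cmod (M l n z) \<le> C l"
  shows comps_band_op: "comps (band_op J M \<xi>) n = (\<Sum>l\<in>J. L2_mult (M l n) (comps \<xi> (n - l)))"
    and norm_band_op: "norm (band_op J M \<xi>) \<le> sum C J * norm \<xi>"
    and band_op_add: "band_op J M (\<xi> + \<eta>) = band_op J M \<xi> + band_op J M \<eta>"
    and band_op_scaleC: "band_op J M (c *\<^sub>C \<xi>) = c *\<^sub>C band_op J M \<xi>"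
proof -
  have diag: "comps (Dsum (\<lambda>n. L2_mult (M l n) (comps \<xi> (n - l)))) = (\<lambda>n. L2_mult (M l n) (comps \<xi> (n - l)))"
    "norm (Dsum (\<lambda>n. L2_mult (M l n) (comps \<xi> (n - l)))) \<le> C l * norm \<xi>" if "l \<in> J" for l \<xi>
    using diagonal_bound[of "M l" "C l" \<xi> l] M C that by blast+
  have c: "comps (band_op J M \<xi>) n = (\<Sum>l\<in>J. L2_mult (M l n) (comps \<xi> (n - l)))" for \<xi> n
    unfolding band_op_def comps_sum by (rule sum.cong) (simp_all add: diag)
  show "comps (band_op J M \<xi>) n = (\<Sum>l\<in>J. L2_mult (M l n) (comps \<xi> (n - l)))" by (rule c)
  show "norm (band_op J M \<xi>) \<le> sum C J * norm \<xi>"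
    unfolding band_op_def sum_distrib_right by (intro order_trans[OF norm_sum] sum_mono diag)
  show "band_op J M (\<xi> + \<eta>) = band_op J M \<xi> + band_op J M \<eta>"
    by (intro iffD1[OF comps_inject] ext)
       (simp add: c comps_add L2_mult_add M sum.distrib cong: sum.cong)
  have sc: "sum (\<lambda>l. c *\<^sub>C x l) I = c *\<^sub>C sum x I" for c :: complex and x :: "int \<Rightarrow> L2" and I
    using scaleC_add_right[of c "0::L2" 0]
    by (induction I rule: infinite_finite_induct) (simp_all add: scaleC_add_right)
  show "band_op J M (c *\<^sub>C \<xi>) = c *\<^sub>C band_op J M \<xi>"
    by (intro iffD1[OF comps_inject] ext)
       (simp add: c comps_scaleC L2_mult_scaleC M sc[symmetric] cong: sum.cong)
qed

text \<open>All components are approximated at once, with squared errors below a multiple of a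
  summable weight, so that the error sequence is itself a vector of small norm in the direct
  sum.\<close>

lemma closure_H1_dsum: "closure {\<xi>. \<forall>n. comps \<xi> n \<in> H1} = UNIV"
proof -
  have "\<exists>y\<in>{\<xi>. \<forall>n. comps \<xi> n \<in> H1}. dist y \<xi> < e" if e: "e > 0" for \<xi> e
  proof -
    \<comment> \<open>A geometric series along an enumeration of the integers: positive weights with
      a finite sum.\<close>
    define w where "w = (\<lambda>n::int. (1 / 2 :: real) ^ to_nat n)"
    have "(\<lambda>k. (1 / 2 :: real) ^ k) summable_on UNIV"
      by (rule norm_summable_imp_summable_on) (simp add: summable_geometric)
    then have "(\<lambda>k. (1 / 2 :: real) ^ k) summable_on range (to_nat :: int \<Rightarrow> nat)"
      by (rule summable_on_subset_banach) simp
    then have w: "w summable_on UNIV"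
      using summable_on_reindex[of "to_nat :: int \<Rightarrow> nat" UNIV "\<lambda>k. (1 / 2 :: real) ^ k"]
      by (simp add: w_def o_def)
    define S where "S = (\<Sum>\<^sub>\<infinity>n. w n)"
    have S: "S \<ge> 0" unfolding S_def by (rule infsum_nonneg) (simp add: w_def)
    define d where "d = e\<^sup>2 / (S + 1)"
    have d: "d > 0" using e S by (simp add: d_def)
    have "\<exists>y\<in>H1. dist y (comps \<xi> n) < sqrt (d * w n)" for n
    proof -
      have "sqrt (d * w n) > 0" using d by (simp add: w_def)
      moreover have "comps \<xi> n \<in> closure H1" by (simp add: closure_H1)
      ultimately show ?thesis unfolding closure_approachable by blast
    qed
    then obtain y where y: "\<And>n. y n \<in> H1" "\<And>n. dist (y n) (comps \<xi> n) < sqrt (d * w n)" by metis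
    have le: "(norm (y n - comps \<xi> n))\<^sup>2 \<le> d * w n" for n
      using power_mono[OF less_imp_le[OF y(2)[of n]], of 2] d by (simp add: dist_norm w_def)
    have sw: "(\<lambda>n. d * w n) summable_on UNIV" using w by (rule summable_on_cmult_right)
    have s: "(\<lambda>n. (norm (y n - comps \<xi> n))\<^sup>2) summable_on UNIV"
      by (rule summable_on_comparison_test[OF sw]) (use le in auto)
    define z where "z = Dsum (\<lambda>n. y n - comps \<xi> n)"
    have cz: "comps z = (\<lambda>n. y n - comps \<xi> n)" unfolding z_def by (rule comps_Dsum[OF s])
    have "(norm z)\<^sup>2 \<le> (\<Sum>\<^sub>\<infinity>n. d * w n)"
      unfolding norm_dsum_power2 cz by (rule infsum_mono[OF s sw le])
    also have "\<dots> = d * S" unfolding S_def by (rule infsum_cmult_right')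
    also have "\<dots> < d * (S + 1)" using d by simp
    also have "\<dots> = e\<^sup>2" using S by (simp add: d_def)
    finally have "norm z < e" using e by (intro power_less_imp_less_base[of _ 2 e]) auto
    moreover have "comps (\<xi> + z) n \<in> H1" for n using y(1) by (simp add: comps_add cz)
    ultimately show ?thesis by (intro bexI[of _ "\<xi> + z"]) (auto simp: dist_norm)
  qed
  then show ?thesis unfolding set_eq_iff closure_approachable by blast
qed

section \<open>The representation on functions of U times powers of V\<close>

lemma star_rep_norm_le:
  assumes "star_rep \<rho>"
  shows "norm (\<rho> a x) \<le> norm a * norm x"
proof -
  have "bounded_linear (\<rho> a)" "onorm (\<rho> a) \<le> norm a"
    using assms by (auto simp: star_rep_def bounded_clinear_def)
  then show ?thesis using onorm[of "\<rho> a" x] mult_right_mono[of "onorm (\<rho> a)" "norm a" "norm x"] by simp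
qed

lemma star_rep_add: "star_rep \<rho> \<Longrightarrow> \<rho> (a + b) x = \<rho> a x + \<rho> b x"
  by (simp add: star_rep_def)

lemma star_rep_diff: "star_rep \<rho> \<Longrightarrow> \<rho> (a - b) x = \<rho> a x - \<rho> b x"
  using star_rep_add[of \<rho> "a - b" b x] by simp

lemma star_rep_sum: "star_rep \<rho> \<Longrightarrow> \<rho> (sum a I) x = (\<Sum>i\<in>I. \<rho> (a i) x)"
  using star_rep_add[of \<rho> 0 0 x]
  by (induction I rule: infinite_finite_induct) (simp_all add: star_rep_add)

lemma scaleC_zero_left: "0 *\<^sub>C (x::'a::complex_normed) = 0"
  using scaleC_add_left[of 0 0 x] by simp

text \<open>Writes p(U) V^l as a Weyl sum concentrated in row l. The coefficients must undo the
  phase built into \<open>Weyl\<close>, and in the row polynomial this phase amounts to rotating the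
  argument by the angle \<alpha> l.\<close>

lemma Laurent_poly_Weyl_sum:
  fixes U V :: "'a::cstar_algebra" and c :: "int \<Rightarrow> complex" and \<alpha> :: real and l :: int
  assumes K: "finite K"
  defines "C \<equiv> (\<lambda>(k, m). if k \<in> K \<and> m = l then c k * cis (2 * pi * \<alpha> * of_int k * of_int l) else 0)"
  shows "fin_supp C" "Weyl_sum \<alpha> U V C = (\<Sum>k\<in>K. c k *\<^sub>C upow U k) * upow V l"
    "(\<exists>k. C (k, m) \<noteq> 0) \<Longrightarrow> m = l"
    "row_poly C l z = (\<Sum>k\<in>K. c k * (rot (\<alpha> * of_int l) z) powi k)"
proof -
  have sub: "{p. C p \<noteq> 0} \<subseteq> (\<lambda>k. (k, l)) ` K" by (auto simp: C_def split: if_splits)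
  show "fin_supp C" unfolding fin_supp_def using sub K by (rule finite_subset[OF _ finite_imageI])
  have "Weyl_sum \<alpha> U V C = (\<Sum>p\<in>(\<lambda>k. (k, l)) ` K. C p *\<^sub>C Weyl \<alpha> U V (fst p) (snd p))"
    unfolding Weyl_sum_def by (rule sum.mono_neutral_left) (use sub K in \<open>auto simp: scaleC_zero_left\<close>)
  also have "\<dots> = (\<Sum>k\<in>K. C (k, l) *\<^sub>C Weyl \<alpha> U V k l)"
    by (subst sum.reindex) (auto simp: inj_on_def)
  also have "\<dots> = (\<Sum>k\<in>K. (c k *\<^sub>C upow U k) * upow V l)"
  proof (rule sum.cong)
    fix k assume "k \<in> K"
    then have "C (k, l) * cis (- 2 * pi * \<alpha> * of_int k * of_int l) = c k"
      by (simp add: C_def mult.assoc cis_mult)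
    then show "C (k, l) *\<^sub>C Weyl \<alpha> U V k l = (c k *\<^sub>C upow U k) * upow V l"
      by (simp add: Weyl_def scaleC_scaleC scaleC_mult_left)
  qed simp
  finally show "Weyl_sum \<alpha> U V C = (\<Sum>k\<in>K. c k *\<^sub>C upow U k) * upow V l"
    by (simp add: sum_distrib_right)
  show "(\<exists>k. C (k, m) \<noteq> 0) \<Longrightarrow> m = l" by (auto simp: C_def split: if_splits)
  have "row_poly C l z = (\<Sum>k\<in>K. C (k, l) * z powi k)"
    unfolding row_poly_def by (rule sum.mono_neutral_left) (use K in \<open>auto simp: C_def\<close>)
  also have "\<dots> = (\<Sum>k\<in>K. c k * (rot (\<alpha> * of_int l) z) powi k)"
  proof (rule sum.cong)
    fix k assume "k \<in> K"
    then show "C (k, l) * z powi k = c k * (rot (\<alpha> * of_int l) z) powi k"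
      by (simp add: C_def rot_def power_int_mult_distrib cis_power_int mult_ac)
  qed simp
  finally show "row_poly C l z = (\<Sum>k\<in>K. c k * (rot (\<alpha> * of_int l) z) powi k)" .
qed

context circle_homeo
begin

lemma conjugate_rot_shift:
  assumes "z \<in> circle"
  shows "h (rot \<beta> (cinv h (conjugate_rot h \<gamma> z))) = conjugate_rot h (\<beta> + \<gamma>) z"
  using conjugate_rot_add[OF assms, of \<beta> \<gamma>] by (simp add: conjugate_rot_def)

text \<open>The rotation by \<alpha> l coming from the Weyl phases combines with the iterate 2n - l
  of T to the conjugate rotation by 2 n \<alpha>, so the symbol no longer depends on l. This is
  exact for Laurent polynomials and passes to uniform limits because the representation is
  contractive and multiplication operators are bounded by the supremum.\<close>

lemma pi_omega_fun_calc:
  assumes pi: "is_pi_omega \<alpha> h U V \<omega> \<rho>" and F: "has_fun_calc U (g \<circ> h) X" and g: "continuous_on circle g"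
  shows "comps (\<rho> (X * upow V l) x) n = L2_mult (g \<circ> conjugate_rot h (2 * of_int n * \<alpha>)) (comps x (n - l))"
proof -
  have \<rho>: "star_rep \<rho>" using pi by (simp add: is_pi_omega_def GNS_def)
  define T where "T = conjugate_rot h \<alpha>"
  \<comment> \<open>The point at which a Laurent polynomial in U is evaluated;
    \<open>h \<circ> R\<close> is the conjugate rotation by 2 n \<alpha> on the circle.\<close>
  define R where "R = (\<lambda>z. rot (\<alpha> * of_int l) (cinv h (citer T (2 * n - l) z)))"
  have citer_T: "citer T (2 * n - l) z = conjugate_rot h (of_int (2 * n - l) * \<alpha>) z" if "z \<in> circle" for z
    using that by (intro citer_conjugate_rot) (simp add: T_def)
  have R_in: "R z \<in> circle" if "z \<in> circle" for z
    unfolding R_def citer_T[OF that] by (intro rot_in_circle cinv_h_in_circle conjugate_rot_in_circle that)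
  have hR: "h (R z) = conjugate_rot h (2 * of_int n * \<alpha>) z" if "z \<in> circle" for z
    unfolding R_def citer_T[OF that] conjugate_rot_shift[OF that] by (simp add: algebra_simps)
  have cont_conj: "continuous_on circle (conjugate_rot h \<gamma>)" for \<gamma>
  proof -
    have "continuous_on circle (\<lambda>z. rot \<gamma> (cinv h z))"
      unfolding rot_def by (intro continuous_intros continuous_on_cinv_h)
    then show ?thesis
      unfolding conjugate_rot_def o_def
      by (rule continuous_on_compose2[OF continuous_on_h]) (blast intro: rot_in_circle cinv_h_in_circle)
  qed
  have cont_g: "continuous_on circle (g \<circ> conjugate_rot h (2 * of_int n * \<alpha>))"
    by (intro continuous_on_compose[OF cont_conj] continuous_on_subset[OF g])
       (use conjugate_rot_in_circle in blast)
  have "continuous_on circle (\<lambda>z. cinv h (conjugate_rot h (of_int (2 * n - l) * \<alpha>) z))"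
    by (rule continuous_on_compose2[OF continuous_on_cinv_h cont_conj]) (use conjugate_rot_in_circle in blast)
  then have "continuous_on circle (\<lambda>z. rot (\<alpha> * of_int l) (cinv h (conjugate_rot h (of_int (2 * n - l) * \<alpha>) z)))"
    unfolding rot_def by (intro continuous_intros)
  then have cont_R: "continuous_on circle R"
    by (rule continuous_on_eq) (simp add: R_def citer_T)
  define y where "y = comps x (n - l)"
  \<comment> \<open>One summand for replacing X by a Laurent polynomial inside the representation,
    one for replacing the symbol in the multiplication operator.\<close>
  define B where "B = norm (upow V l) * norm x + norm y"
  have B: "B \<ge> 0" by (simp add: B_def)
  have est: "norm (comps (\<rho> (X * upow V l) x) n - L2_mult (g \<circ> conjugate_rot h (2 * of_int n * \<alpha>)) y) \<le> e * B"
    if e: "e > 0" for e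
  proof -
    obtain K c where K: "finite K" and close: "\<forall>z\<in>circle. cmod ((g \<circ> h) z - (\<Sum>k\<in>K. c k * z powi k)) < e"
      and near: "norm (X - (\<Sum>k\<in>K. c k *\<^sub>C upow U k)) < e"
      using mp[OF spec[OF F[unfolded has_fun_calc_def]] e] by (elim exE conjE) (rule that)
    define p where "p = (\<lambda>z::complex. \<Sum>k\<in>K. c k * z powi k)"
    define P where "P = (\<Sum>k\<in>K. c k *\<^sub>C upow U k)"
    define C where "C = (\<lambda>(k, m). if k \<in> K \<and> m = l then c k * cis (2 * pi * \<alpha> * of_int k * of_int l) else 0)"
    note C = Laurent_poly_Weyl_sum[OF K, where l = l and c = c and \<alpha> = \<alpha>, folded C_def]
    \<comment> \<open>Negative powers are continuous here because R takes values on the circle, away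
      from 0.\<close>
    have cont_p: "continuous_on circle (p \<circ> R)"
      unfolding p_def o_def using R_in
      by (intro continuous_intros cont_R) (metis mem_sphere_0 norm_zero zero_neq_one)
    have "comps (\<rho> (P * upow V l) x) n =
        (\<Sum>m | \<exists>k. C (k, m) \<noteq> 0. L2_mult (row_poly C m \<circ> cinv h \<circ> citer T (2 * n - m)) (comps x (n - m)))"
      using pi C(1) unfolding is_pi_omega_def P_def C(2)[symmetric] T_def by blast
    \<comment> \<open>If all coefficients vanish, row l is missing from the index set; its summand
      is 0 in that case.\<close>
    also have "\<dots> = (\<Sum>m\<in>{l}. L2_mult (row_poly C m \<circ> cinv h \<circ> citer T (2 * n - m)) (comps x (n - m)))"
    proof (rule sum.mono_neutral_left)
      show "{m. \<exists>k. C (k, m) \<noteq> 0} \<subseteq> {l}" using C(3) by blast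
      show "\<forall>m\<in>{l} - {m. \<exists>k. C (k, m) \<noteq> 0}. L2_mult (row_poly C m \<circ> cinv h \<circ> citer T (2 * n - m)) (comps x (n - m)) = 0"
      proof
        fix m assume "m \<in> {l} - {m. \<exists>k. C (k, m) \<noteq> 0}"
        then have "C (k, m) = 0" for k by blast
        then have "row_poly C m = (\<lambda>_. 0)" by (simp add: row_poly_def fun_eq_iff)
        then show "L2_mult (row_poly C m \<circ> cinv h \<circ> citer T (2 * n - m)) (comps x (n - m)) = 0"
          by (simp add: o_def L2_mult_const scaleC_zero_left)
      qed
    qed simp
    also have "\<dots> = L2_mult (row_poly C l \<circ> cinv h \<circ> citer T (2 * n - l)) y" by (simp add: y_def)
    also have "row_poly C l \<circ> cinv h \<circ> citer T (2 * n - l) = p \<circ> R"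
      by (simp add: fun_eq_iff C(4) p_def R_def)
    finally have P_eq: "comps (\<rho> (P * upow V l) x) n = L2_mult (p \<circ> R) y" .
    have "norm (comps (\<rho> (X * upow V l) x) n - comps (\<rho> (P * upow V l) x) n) = norm (comps (\<rho> ((X - P) * upow V l) x) n)"
      by (simp add: left_diff_distrib star_rep_diff[OF \<rho>] comps_diff)
    also have "\<dots> \<le> norm ((X - P) * upow V l) * norm x"
      using norm_comps_le star_rep_norm_le[OF \<rho>] by (rule order_trans)
    also have "\<dots> \<le> (e * norm (upow V l)) * norm x"
      using near by (intro mult_right_mono order_trans[OF norm_mult_ineq]) (auto simp: P_def)
    finally have 1: "norm (comps (\<rho> (X * upow V l) x) n - comps (\<rho> (P * upow V l) x) n) \<le> e * (norm (upow V l) * norm x)"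
      by (simp add: mult.assoc)
    have "norm (L2_mult (p \<circ> R) y - L2_mult (g \<circ> conjugate_rot h (2 * of_int n * \<alpha>)) y) \<le> e * norm y"
      unfolding L2_mult_diff_fun[OF cont_p cont_g, symmetric]
    proof (rule norm_L2_mult_le)
      fix z assume z: "z \<in> circle"
      show "cmod ((p \<circ> R) z - (g \<circ> conjugate_rot h (2 * of_int n * \<alpha>)) z) \<le> e"
        using bspec[OF close R_in[OF z]] hR[OF z] by (simp add: p_def norm_minus_commute)
    next
      show "continuous_on circle (\<lambda>z. (p \<circ> R) z - (g \<circ> conjugate_rot h (2 * of_int n * \<alpha>)) z)"
        by (rule continuous_on_diff[OF cont_p cont_g])
    qed (use e in simp)
    from norm_diff_triangle_le[OF 1[unfolded P_eq] this] show ?thesis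
      unfolding B_def distrib_left .
  qed
  have "norm (comps (\<rho> (X * upow V l) x) n - L2_mult (g \<circ> conjugate_rot h (2 * of_int n * \<alpha>)) y) \<le> e" if e: "e > 0" for e
  proof -
    have "e / (B + 1) * B \<le> e" using e B by (simp add: field_simps)
    with est[of "e / (B + 1)"] e B show ?thesis by simp
  qed
  then have "norm (comps (\<rho> (X * upow V l) x) n - L2_mult (g \<circ> conjugate_rot h (2 * of_int n * \<alpha>)) y) \<le> 0"
    by (rule field_le_epsilon[of _ 0, simplified])
  then show ?thesis by (simp add: y_def)
qed

end

text \<open>The terms in which the derivative falls on u cancel, and the product rule leaves
  multiplication by the derivative of the symbol. The values s = i and s = -i give L and its
  adjoint; a and b are the coefficients of the target and the source component.\<close>

lemma commutator_summand:
  assumes \<phi>: "\<phi> \<in> circle_C1" and u: "u \<in> H1"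
  shows "(s *\<^sub>C L2_mult (\<lambda>z. z) (L2_deriv (L2_mult \<phi> u)) - a *\<^sub>R L2_mult \<phi> u)
      - L2_mult \<phi> (s *\<^sub>C L2_mult (\<lambda>z. z) (L2_deriv u) - b *\<^sub>R u)
    = L2_mult (\<lambda>z. s * (z * circ_deriv \<phi> z) - of_real (a - b) * \<phi> z) u"
proof -
  define v where "v = L2_deriv u"
  have c: "continuous_on circle \<phi>" "continuous_on circle (circ_deriv \<phi>)"
    using \<phi> circle_C1_continuous circle_C1_continuous_deriv by blast+
  have id: "continuous_on circle (\<lambda>z. z)" by (rule continuous_on_id)
  have k: "continuous_on circle (\<lambda>_. r)" for r :: complex by (rule continuous_on_const)
  note cm = continuous_on_mult
  have sc: "r *\<^sub>C L2_mult \<psi> x = L2_mult (\<lambda>z. r * \<psi> z) x" if "continuous_on circle \<psi>" for r \<psi> x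
    using L2_mult_mult[OF k that, of r x] by (simp add: L2_mult_const)
  have 1: "s *\<^sub>C L2_mult (\<lambda>z. z) (L2_deriv (L2_mult \<phi> u)) =
      L2_mult (\<lambda>z. s * (z * \<phi> z)) v + L2_mult (\<lambda>z. s * (z * circ_deriv \<phi> z)) u"
    unfolding L2_deriv_mult[OF \<phi> u] v_def[symmetric] L2_mult_add[OF id] scaleC_add_right
      L2_mult_mult[OF id c(1)] L2_mult_mult[OF id c(2)] sc[OF cm[OF id c(1)]] sc[OF cm[OF id c(2)]] ..
  have 2: "L2_mult \<phi> (s *\<^sub>C L2_mult (\<lambda>z. z) v) = L2_mult (\<lambda>z. s * (z * \<phi> z)) v"
    unfolding sc[OF id] L2_mult_mult[OF c(1) cm[OF k id]] by (simp add: mult_ac)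
  have 3: "L2_mult \<phi> (b *\<^sub>R u) = L2_mult (\<lambda>z. of_real b * \<phi> z) u"
    unfolding scaleR_scaleC L2_mult_scaleC[OF c(1)] sc[OF c(1)] ..
  have 4: "a *\<^sub>R L2_mult \<phi> u = L2_mult (\<lambda>z. of_real a * \<phi> z) u"
    unfolding scaleR_scaleC sc[OF c(1)] ..
  have "L2_mult (\<lambda>z. of_real (a - b) * \<phi> z) u =
      L2_mult (\<lambda>z. of_real a * \<phi> z) u - L2_mult (\<lambda>z. of_real b * \<phi> z) u"
    unfolding L2_mult_diff_fun[OF cm[OF k c(1)] cm[OF k c(1)], symmetric] by (simp add: left_diff_distrib)
  then show ?thesis
    unfolding L2_mult_diff_fun[OF cm[OF k cm[OF id c(2)]] cm[OF k c(1)]] L2_mult_diff[OF c(1)] 1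
      v_def[symmetric] 2 3 4 by (simp add: algebra_simps)
qed

context circle_diffeo_conj
begin

text \<open>Treats L and its adjoint together through s. The sequence x is not assumed
  square-summable, since Delta^{-1} xi need not be; the extension \<open>ext_comps\<close> makes
  sense all the same because each row of the band matrix has finitely many entries.\<close>

lemma dcommutator_band:
  assumes J: "finite J" and A: "\<And>x n. comps (A x) n = (\<Sum>l\<in>J. L2_mult (g l \<circ> citer f n) (comps x (n - l)))"
    and g: "\<And>l. l \<in> J \<Longrightarrow> g l \<in> circle_C1"
    and S: "\<And>m u. u \<in> H1 \<Longrightarrow> S m u = s *\<^sub>C L2_mult (\<lambda>z. z) (L2_deriv u) - a_coeff f m *\<^sub>R u"
    and x: "\<And>n. x n \<in> H1"
  shows "dcommutator S A x n = (\<Sum>l\<in>J. L2_mult (\<lambda>z. s * (z * circ_deriv (g l \<circ> citer f n) z)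
      - of_real (a_coeff f n - a_coeff f (n - l)) * (g l \<circ> citer f n) z) (x (n - l)))"
proof -
  have G: "g l \<circ> citer f n \<in> circle_C1" if "l \<in> J" for l n
    using circle_C1_compose[OF g[OF that] citer_C1(1) citer_image] .
  have L0: "L2_mult \<phi> 0 = 0" if "continuous_on circle \<phi>" for \<phi>
    using L2_mult_diff[OF that, of 0 0] by simp
  have LG: "L2_mult (g l \<circ> citer f n) 0 = 0" if "l \<in> J" for l n
    by (rule L0[OF circle_C1_continuous[OF G[OF that]]])
  have mat: "mat_entry A n m u = (\<Sum>l\<in>J. if m = n - l then L2_mult (g l \<circ> citer f n) u else 0)" for m u
    unfolding mat_entry_def A comps_dsum_single
    by (rule sum.cong) (simp_all add: LG)
  have ext: "ext_comps A y n = (\<Sum>l\<in>J. L2_mult (g l \<circ> citer f n) (y (n - l)))" for y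
  proof -
    \<comment> \<open>Row n meets only the columns \<open>n - l\<close> with l in J, which reduces
      the infinite sum to a finite one.\<close>
    have "ext_comps A y n = (\<Sum>\<^sub>\<infinity>m\<in>(\<lambda>l. n - l) ` J. mat_entry A n m (y m))"
      unfolding ext_comps_def
      by (rule infsum_cong_neutral) (auto simp: mat intro!: sum.neutral)
    also have "\<dots> = (\<Sum>m\<in>(\<lambda>l. n - l) ` J. mat_entry A n m (y m))" using J by simp
    also have "\<dots> = (\<Sum>l\<in>J. mat_entry A n (n - l) (y (n - l)))"
      by (subst sum.reindex) (auto simp: inj_on_def)
    also have "\<dots> = (\<Sum>l\<in>J. L2_mult (g l \<circ> citer f n) (y (n - l)))"
      using J by (intro sum.cong) (auto simp: mat)
    finally show ?thesis .
  qed
  have Gx: "L2_mult (g l \<circ> citer f n) (x (n - l)) \<in> H1" if "l \<in> J" for l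
    using G[OF that] x by (rule H1_mult)
  \<comment> \<open>S is known through its formula on H^1 alone, so additivity is proved by an
    induction whose partial sums stay in H^1.\<close>
  have Ssum: "S n (sum y J) = (\<Sum>l\<in>J. S n (y l))" if "\<And>l. l \<in> J \<Longrightarrow> y l \<in> H1" for y
    using J that
  proof (induction J)
    case empty
    then show ?case using S[OF H1_zero] L0[OF continuous_on_id] scaleC_add_right[of s "0::L2" 0]
      by (simp add: L2_deriv_zero)
  next
    case (insert l J)
    have u: "y l \<in> H1" "sum y J \<in> H1"
      by (intro H1_sum insert.prems insertI1 insertI2; assumption)+
    have "S n (y l + sum y J) = S n (y l) + S n (sum y J)"
      by (simp only: S[OF u(1)] S[OF u(2)] S[OF H1_add[OF u]] L2_deriv_add[OF u] L2_mult_add[OF continuous_on_id]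
          scaleC_add_right scaleR_add_right add_diff_add)
    then show ?case using insert by simp
  qed
  have "dcommutator S A x n =
      (\<Sum>l\<in>J. S n (L2_mult (g l \<circ> citer f n) (x (n - l))) - L2_mult (g l \<circ> citer f n) (S (n - l) (x (n - l))))"
    unfolding dcommutator_def ext sum_subtractf by (subst Ssum) (auto intro: Gx simp del: o_apply)
  also have "\<dots> = (\<Sum>l\<in>J. L2_mult (\<lambda>z. s * (z * circ_deriv (g l \<circ> citer f n) z)
      - of_real (a_coeff f n - a_coeff f (n - l)) * (g l \<circ> citer f n) z) (x (n - l)))"
  proof (rule sum.cong[OF refl])
    fix l assume l: "l \<in> J"
    show "S n (L2_mult (g l \<circ> citer f n) (x (n - l))) - L2_mult (g l \<circ> citer f n) (S (n - l) (x (n - l))) =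
        L2_mult (\<lambda>z. s * (z * circ_deriv (g l \<circ> citer f n) z)
          - of_real (a_coeff f n - a_coeff f (n - l)) * (g l \<circ> citer f n) z) (x (n - l))"
      unfolding S[OF Gx[OF l]] S[OF x] by (rule commutator_summand[OF G[OF l] x])
  qed
  finally show ?thesis .
qed

text \<open>For the derivative term the cocycle identity is decisive: dividing by the weight of the
  target cancels D f^n, and dividing by that of the source leaves D f^l at a shifted point, at most
  Gamma_l. The coefficient term is handled by comparing inverse weights with growth constants and
  then telescoping.\<close>

lemma commutator_symbol_bounds:
  fixes l :: int
  assumes g: "g \<in> circle_C1" and s: "cmod s = 1"
  defines "\<kappa> \<equiv> \<lambda>n z. s * (z * circ_deriv (g \<circ> citer f n) z) - of_real (a_coeff f n - a_coeff f (n - l)) * (g \<circ> citer f n) z"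
  shows "continuous_on circle (\<kappa> n)"
    and "\<exists>C\<ge>0. \<forall>n. \<forall>z\<in>circle. cmod (inverse (mod_weight f n z) * \<kappa> n z) \<le> C"
    and "\<exists>C\<ge>0. \<forall>n. \<forall>z\<in>circle. cmod (\<kappa> n z * inverse (mod_weight f (n - l) z)) \<le> C"
proof -
  note C1 = circle_C1_compose[OF g citer_C1(1) citer_image]
  show "continuous_on circle (\<kappa> n)"
    unfolding \<kappa>_def by (intro continuous_intros circle_C1_continuous[OF C1] circle_C1_continuous_deriv[OF C1])
  obtain B where B: "B \<ge> 0" "\<And>z. z \<in> circle \<Longrightarrow> cmod (g z) \<le> B"
    using continuous_on_circle_bounded[OF circle_C1_continuous[OF g]] by blast
  obtain B' where B': "B' \<ge> 0" "\<And>z. z \<in> circle \<Longrightarrow> cmod (circ_deriv g z) \<le> B'"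
    using continuous_on_circle_bounded[OF circle_C1_continuous_deriv[OF g]] by blast
  have \<kappa>_le: "cmod (\<kappa> n z) \<le> B' * cmod (D n z) + \<bar>a_coeff f n - a_coeff f (n - l)\<bar> * B" if z: "z \<in> circle" for n z
  proof -
    have "cmod (\<kappa> n z) \<le> cmod (s * (z * circ_deriv (g \<circ> citer f n) z)) +
        cmod (of_real (a_coeff f n - a_coeff f (n - l)) * (g \<circ> citer f n) z)"
      unfolding \<kappa>_def by (rule norm_triangle_ineq4)
    also have "\<dots> = cmod (circ_deriv g (citer f n z)) * cmod (D n z) + \<bar>a_coeff f n - a_coeff f (n - l)\<bar> * cmod (g (citer f n z))"
      using s z by (simp add: norm_mult circ_deriv_compose[OF g citer_C1(1) citer_image z] flip: of_real_diff)
    also have "\<dots> \<le> B' * cmod (D n z) + \<bar>a_coeff f n - a_coeff f (n - l)\<bar> * B"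
      using B(2) B'(2) citer_in_circle[OF z] by (intro add_mono mult_right_mono mult_left_mono) auto
    finally show ?thesis .
  qed
  show "\<exists>C\<ge>0. \<forall>n. \<forall>z\<in>circle. cmod (inverse (mod_weight f n z) * \<kappa> n z) \<le> C"
  proof -
    obtain C where C: "C \<ge> 0" "\<And>n. Growth f n * \<bar>a_coeff f n - a_coeff f (n + - l)\<bar> \<le> C"
      using a_coeff_bound[of "- l"] by blast
    have "cmod (inverse (mod_weight f n z) * \<kappa> n z) \<le> B' + C * B" if z: "z \<in> circle" for n z
    proof -
      let ?d = "inverse (cmod (D n z))"
      have "cmod (inverse (mod_weight f n z) * \<kappa> n z) = ?d * cmod (\<kappa> n z)"
        by (simp add: norm_mult norm_inverse norm_mod_weight[OF z])
      also have "\<dots> \<le> ?d * (B' * cmod (D n z) + \<bar>a_coeff f n - a_coeff f (n - l)\<bar> * B)"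
        using \<kappa>_le[OF z] by (rule mult_left_mono) simp
      also have "\<dots> = B' + ?d * \<bar>a_coeff f n - a_coeff f (n - l)\<bar> * B"
        using D_nonzero[OF z, of n] by (simp add: field_simps)
      also have "\<dots> \<le> B' + (Growth f n * \<bar>a_coeff f n - a_coeff f (n - l)\<bar>) * B"
        using inverse_D_le_Growth[OF z, of n] B(1) by (intro add_left_mono mult_right_mono) auto
      also have "\<dots> \<le> B' + C * B" using C(2)[of n] B(1) by (intro add_left_mono mult_right_mono) auto
      finally show ?thesis .
    qed
    then show ?thesis using B(1) B'(1) C(1) by (intro exI[of _ "B' + C * B"]) auto
  qed
  show "\<exists>C\<ge>0. \<forall>n. \<forall>z\<in>circle. cmod (\<kappa> n z * inverse (mod_weight f (n - l) z)) \<le> C"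
  proof -
    \<comment> \<open>The weight now sits at the source index n - l, so the coefficient bound is
      used with that base point and the opposite shift, +l.\<close>
    obtain C where C: "C \<ge> 0" "\<And>n. Growth f n * \<bar>a_coeff f n - a_coeff f (n + l)\<bar> \<le> C"
      using a_coeff_bound[of l] by blast
    have "cmod (\<kappa> n z * inverse (mod_weight f (n - l) z)) \<le> B' * Growth f l + C * B" if z: "z \<in> circle" for n z
    proof -
      let ?d = "inverse (cmod (D (n - l) z))" and ?a = "\<bar>a_coeff f n - a_coeff f (n - l)\<bar>"
      have "D n z = D l (citer f (n - l) z) * D (n - l) z" using D_add[OF z, of l "n - l"] by simp
      then have q: "?d * cmod (D n z) = cmod (D l (citer f (n - l) z))"
        using D_nonzero[OF z, of "n - l"] by (simp add: norm_mult)
      have "cmod (\<kappa> n z * inverse (mod_weight f (n - l) z)) = ?d * cmod (\<kappa> n z)"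
        by (simp add: norm_mult norm_inverse norm_mod_weight[OF z])
      also have "\<dots> \<le> ?d * (B' * cmod (D n z) + ?a * B)"
        using \<kappa>_le[OF z] by (rule mult_left_mono) simp
      also have "\<dots> = B' * (?d * cmod (D n z)) + ?d * ?a * B" by (simp add: algebra_simps)
      also have "\<dots> \<le> B' * Growth f l + (Growth f (n - l) * ?a) * B"
        unfolding q using inverse_D_le_Growth[OF z, of "n - l"] D_le_Growth[OF citer_in_circle[OF z]] B(1) B'(1)
        by (intro add_mono mult_right_mono mult_left_mono) auto
      also have "\<dots> \<le> B' * Growth f l + C * B"
        using C(2)[of "n - l"] B(1) by (intro add_left_mono mult_right_mono) (auto simp: abs_minus_commute)
      finally show ?thesis .
    qed
    then show ?thesis using B(1) B'(1) C(1) Growth_nonneg[of l] by (intro exI[of _ "B' * Growth f l + C * B"]) auto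
  qed
qed

text \<open>On vectors with components in H^1 the two corners coincide with band operators that are
  defined and bounded everywhere; linearity and the norm estimate are inherited from these.\<close>

lemma D_sigma_bounded:
  assumes J: "finite J" and A: "\<And>x n. comps (A x) n = (\<Sum>l\<in>J. L2_mult (g l \<circ> citer f n) (comps x (n - l)))"
    and g: "\<And>l. l \<in> J \<Longrightarrow> g l \<in> circle_C1"
  shows "densely_defined_bounded (D_sigma_dom f A) (D_sigma f A)"
proof -
  define \<kappa> where "\<kappa> = (\<lambda>s l n z. s * (z * circ_deriv (g l \<circ> citer f n) z) -
    of_real (a_coeff f n - a_coeff f (n - l)) * (g l \<circ> citer f n) z)"
  \<comment> \<open>\<open>M1\<close> carries the weight of the target component n, as Delta^{-1}
    acts after the commutator; \<open>M2\<close> carries that of the source \<open>n - l\<close>, as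
    it acts before.\<close>
  define M1 where "M1 = (\<lambda>l n z. inverse (mod_weight f n z) * \<kappa> \<i> l n z)"
  define M2 where "M2 = (\<lambda>l n z. \<kappa> (- \<i>) l n z * inverse (mod_weight f (n - l) z))"
  note cw = circle_C1_continuous[OF inverse_mod_weight_C1]
  have c\<kappa>: "continuous_on circle (\<kappa> \<i> l n)" "continuous_on circle (\<kappa> (- \<i>) l n)" if "l \<in> J" for l n
    unfolding \<kappa>_def by (rule commutator_symbol_bounds(1)[OF g[OF that]], simp)+
  have cM: "continuous_on circle (M1 l n)" "continuous_on circle (M2 l n)" if "l \<in> J" for l n
    unfolding M1_def M2_def by (intro continuous_on_mult c\<kappa> cw that)+
  have "\<forall>l\<in>J. \<exists>C\<ge>0. \<forall>n. \<forall>z\<in>circle. cmod (M1 l n z) \<le> C"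
    unfolding M1_def \<kappa>_def by (intro ballI commutator_symbol_bounds(2) g) simp_all
  then obtain C1 where C1: "\<And>l. l \<in> J \<Longrightarrow> C1 l \<ge> 0" "\<And>l n z. l \<in> J \<Longrightarrow> z \<in> circle \<Longrightarrow> cmod (M1 l n z) \<le> C1 l"
    by metis
  have "\<forall>l\<in>J. \<exists>C\<ge>0. \<forall>n. \<forall>z\<in>circle. cmod (M2 l n z) \<le> C"
    unfolding M2_def \<kappa>_def by (intro ballI commutator_symbol_bounds(3) g) simp_all
  then obtain C2 where C2: "\<And>l. l \<in> J \<Longrightarrow> C2 l \<ge> 0" "\<And>l n z. l \<in> J \<Longrightarrow> z \<in> circle \<Longrightarrow> cmod (M2 l n z) \<le> C2 l"
    by metis
  have band1: "comps (band_op J M1 \<xi>) n = (\<Sum>l\<in>J. L2_mult (M1 l n) (comps \<xi> (n - l)))"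
    "norm (band_op J M1 \<xi>) \<le> sum C1 J * norm \<xi>"
    "band_op J M1 (\<xi> + \<eta>) = band_op J M1 \<xi> + band_op J M1 \<eta>"
    "band_op J M1 (c *\<^sub>C \<xi>) = c *\<^sub>C band_op J M1 \<xi>" for \<xi> \<eta> c n
    by (rule band_op_props[of J M1 C1]; blast intro: cM C1)+
  have band2: "comps (band_op J M2 \<xi>) n = (\<Sum>l\<in>J. L2_mult (M2 l n) (comps \<xi> (n - l)))"
    "norm (band_op J M2 \<xi>) \<le> sum C2 J * norm \<xi>"
    "band_op J M2 (\<xi> + \<eta>) = band_op J M2 \<xi> + band_op J M2 \<eta>"
    "band_op J M2 (c *\<^sub>C \<xi>) = c *\<^sub>C band_op J M2 \<xi>" for \<xi> \<eta> c n
    by (rule band_op_props[of J M2 C2]; blast intro: cM C2)+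
  have eq1: "Delta_inv f (dcommutator (L_summand f) A (comps \<eta>)) = comps (band_op J M1 \<eta>)"
    if \<eta>: "\<And>n. comps \<eta> n \<in> H1" for \<eta>
  proof
    fix n
    have "dcommutator (L_summand f) A (comps \<eta>) n = (\<Sum>l\<in>J. L2_mult (\<kappa> \<i> l n) (comps \<eta> (n - l)))"
      unfolding \<kappa>_def by (rule dcommutator_band[OF J A g _ \<eta>]) (auto simp: L_summand_def)
    then have "Delta_inv f (dcommutator (L_summand f) A (comps \<eta>)) n =
        L2_mult (\<lambda>z. inverse (mod_weight f n z)) (\<Sum>l\<in>J. L2_mult (\<kappa> \<i> l n) (comps \<eta> (n - l)))"
      by (simp add: Delta_inv_def)
    also have "\<dots> = (\<Sum>l\<in>J. L2_mult (\<lambda>z. inverse (mod_weight f n z)) (L2_mult (\<kappa> \<i> l n) (comps \<eta> (n - l))))"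
      using J L2_mult_diff[OF cw, of n 0 0]
      by (induction J rule: finite_induct) (simp_all add: L2_mult_add[OF cw])
    also have "\<dots> = comps (band_op J M1 \<eta>) n"
      unfolding band1(1) by (rule sum.cong[OF refl], unfold M1_def) (intro L2_mult_mult cw c\<kappa>)
    finally show "Delta_inv f (dcommutator (L_summand f) A (comps \<eta>)) n = comps (band_op J M1 \<eta>) n" .
  qed
  have eq2: "dcommutator (L_adj_summand f) A (Delta_inv f (comps \<xi>)) = comps (band_op J M2 \<xi>)"
    if \<xi>: "\<And>n. comps \<xi> n \<in> H1" for \<xi>
  proof
    fix n
    have H: "Delta_inv f (comps \<xi>) n \<in> H1" for n
      unfolding Delta_inv_def by (intro H1_mult inverse_mod_weight_C1 \<xi>)
    have "dcommutator (L_adj_summand f) A (Delta_inv f (comps \<xi>)) n =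
        (\<Sum>l\<in>J. L2_mult (\<kappa> (- \<i>) l n) (Delta_inv f (comps \<xi>) (n - l)))"
      unfolding \<kappa>_def by (rule dcommutator_band[OF J A g L_adj_summand_eq H])
    also have "\<dots> = comps (band_op J M2 \<xi>) n"
      unfolding band2(1) by (rule sum.cong[OF refl], unfold M2_def Delta_inv_def) (intro L2_mult_mult cw c\<kappa>)
    finally show "dcommutator (L_adj_summand f) A (Delta_inv f (comps \<xi>)) n = comps (band_op J M2 \<xi>) n" .
  qed
  define H where "H = {\<xi>. \<forall>n. comps \<xi> n \<in> H1}"
  \<comment> \<open>Both sequences in the domain condition are components of vectors in the direct
    sum, so their square-summability is automatic.\<close>
  have dom: "D_sigma_dom f A = H \<times> H"
  proof -
    have "(\<xi>, \<eta>) \<in> D_sigma_dom f A \<longleftrightarrow> (\<xi>, \<eta>) \<in> H \<times> H" for \<xi> \<eta>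
    proof (cases "(\<xi>, \<eta>) \<in> H \<times> H")
      case True
      then have "(\<lambda>n. (norm (dcommutator (L_adj_summand f) A (Delta_inv f (comps \<xi>)) n))\<^sup>2 +
          (norm (Delta_inv f (dcommutator (L_summand f) A (comps \<eta>)) n))\<^sup>2) summable_on UNIV"
        using eq1[of \<eta>] eq2[of \<xi>] by (simp add: H_def summable_on_add summable_comps)
      then show ?thesis using True by (simp add: D_sigma_dom_def H_def)
    qed (auto simp: D_sigma_dom_def H_def)
    then show ?thesis by auto
  qed
  have op: "D_sigma f A x = \<i> *\<^sub>C (band_op J M1 (snd x), band_op J M2 (fst x))" if "x \<in> H \<times> H" for x
    using that eq1[of "snd x"] eq2[of "fst x"] by (auto simp: D_sigma_def H_def comps_inverse)
  have Hadd: "x + y \<in> H \<times> H" if "x \<in> H \<times> H" "y \<in> H \<times> H" for x y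
    using that by (auto simp: H_def comps_add H1_add)
  have Hsc: "c *\<^sub>C x \<in> H \<times> H" if "x \<in> H \<times> H" for c x
    using that by (auto simp: H_def comps_scaleC H1_scaleC scaleC_prod_def)
  have H0: "0 \<in> H \<times> H" by (simp add: H_def comps_zero H1_zero zero_prod_def)
  have add: "D_sigma f A (x + y) = D_sigma f A x + D_sigma f A y" if "x \<in> H \<times> H" "y \<in> H \<times> H" for x y
    unfolding op[OF that(1)] op[OF that(2)] op[OF Hadd[OF that]]
    by (simp add: band1(3) band2(3) flip: scaleC_add_right)
  have sc: "D_sigma f A (c *\<^sub>C x) = c *\<^sub>C D_sigma f A x" if "x \<in> H \<times> H" for c x
    unfolding op[OF that] op[OF Hsc[OF that]]
    by (simp add: scaleC_prod_def band1(4) band2(4) scaleC_scaleC mult.commute)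
  have bound: "norm (D_sigma f A x) \<le> (sum C1 J + sum C2 J) * norm x" if x: "x \<in> H \<times> H" for x
  proof -
    have nn: "sum C1 J \<ge> 0" "sum C2 J \<ge> 0" using C1(1) C2(1) by (auto intro: sum_nonneg)
    have "norm (D_sigma f A x) = norm (band_op J M1 (snd x), band_op J M2 (fst x))"
      unfolding op[OF x] norm_scaleC by simp
    also have "\<dots> \<le> norm (band_op J M1 (snd x)) + norm (band_op J M2 (fst x))" by (rule norm_Pair_le)
    also have "\<dots> \<le> sum C1 J * norm (snd x) + sum C2 J * norm (fst x)"
      by (intro add_mono band1(2) band2(2))
    also have "\<dots> \<le> sum C1 J * norm x + sum C2 J * norm x"
      using norm_fst_le[of "fst x" "snd x"] norm_snd_le[of "snd x" "fst x"] nn by (intro add_mono mult_left_mono) auto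
    finally show ?thesis by (simp add: distrib_right)
  qed
  have "closure (H \<times> H) = UNIV"
    unfolding closure_Times using closure_H1_dsum by (simp add: H_def)
  then show ?thesis
    unfolding densely_defined_bounded_def dom
    by (intro conjI ballI allI H0 Hadd Hsc add sc exI[of _ "sum C1 J + sum C2 J"] bound)
qed

end

theorem theorem9p2:
  fixes \<alpha> :: real and f h :: "complex \<Rightarrow> complex"
    and U V :: "'a::cstar_algebra" and \<omega> :: "'a \<Rightarrow> complex" and \<rho> :: "'a \<Rightarrow> dsum \<Rightarrow> dsum"
    and A :: "dsum \<Rightarrow> dsum"
  assumes "0 < \<alpha>" and "\<alpha> < 1/2" and "\<alpha> \<notin> \<rat>"
    and "circle_diffeo f" and "orientation_preserving f" and "has_rotation_number f (2 * \<alpha>)"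
    and "\<exists>h'. homeomorphism circle circle h h'" and "h 1 = 1"
    and "\<forall>z\<in>circle. f z = conjugate_rot h (2 * \<alpha>) z"
    and "is_rotation_algebra (2 * \<alpha>) U V"
    and "is_omega_mu \<alpha> h U V \<omega>"
    and "is_pi_omega \<alpha> h U V \<omega> \<rho>"
    and "A \<in> \<rho> ` smooth_subalgebra h U V"
  shows "densely_defined_bounded (D_sigma_dom f A) (D_sigma f A)"
proof -
  interpret circle_diffeo_conj h f "2 * \<alpha>"
    by unfold_locales (use assms in auto)
  obtain J X where J: "finite J" and X: "\<forall>k\<in>J. \<exists>g\<in>circle_C1. has_fun_calc U (g \<circ> h) (X k)"
    and A: "A = \<rho> (\<Sum>k\<in>J. X k * upow V k)"
    using assms(13) unfolding smooth_subalgebra_def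
    by (elim imageE CollectE exE conjE) (rule that, assumption+, simp only:)
  from X obtain g where g: "\<And>k. k \<in> J \<Longrightarrow> g k \<in> circle_C1" "\<And>k. k \<in> J \<Longrightarrow> has_fun_calc U (g k \<circ> h) (X k)"
    by metis
  have \<rho>: "star_rep \<rho>" using assms(12) by (simp add: is_pi_omega_def GNS_def)
  show ?thesis
  proof (rule D_sigma_bounded[OF J])
    fix x n
    \<comment> \<open>The conjugate rotation by 2 n \<alpha> and the n-th iterate of f agree on the
      circle, which is all that a multiplication operator sees.\<close>
    have "L2_mult (g l \<circ> conjugate_rot h (2 * of_int n * \<alpha>)) u = L2_mult (g l \<circ> citer f n) u" if "l \<in> J" for l u
      by (rule L2_mult_cong)
         (use circle_C1_continuous[OF circle_C1_compose[OF g(1)[OF that] citer_C1(1) citer_image]] citer_eq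
           in \<open>auto simp: mult_ac\<close>)
    then show "comps (A x) n = (\<Sum>l\<in>J. L2_mult (g l \<circ> citer f n) (comps x (n - l)))"
      unfolding A star_rep_sum[OF \<rho>] comps_sum
      using pi_omega_fun_calc[OF assms(12) g(2) circle_C1_continuous[OF g(1)]] by (intro sum.cong) auto
  qed (rule g(1))
qed

end
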